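(* Let $N$ be a finitely generated nilpotent group of class $k$. Then there is an effective procedure (algorithm) which, for any automorphism $\varphi : N \rightarrow N$, calculates the Reidemeister number $R(\varphi) \in \{1,2,3,\dots\} \cup \{\infty\}$.
   Context: For an automorphism $\varphi$ of a group $G$ (written on the right, $x \mapsto x\varphi$), elements $g, f \in G$ are called $\varphi$-twisted conjugate (or $\varphi$-conjugate), written $g \sim_{\varphi} f$, if there exists $x \in G$ with $(x\varphi) g = f x$. This is an equivalence relation; its classes are called Reidemeister classes (or $\varphi$-conjugacy classes), and the Reidemeister number $R(\varphi)$ is the number of these classes, with $R(\varphi) = \infty$ if there are infinitely many. "Effective procedure" means an algorithm: the group $N$ is given by a finite presentation, and the input automorphism $\varphi$ is given by the images, as words, of the given finite generating set; the algorithm halts on every such input and outputs $R(\varphi)$ (a positive integer or the symbol $\infty$). *)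

theory Defs
  imports "HOL-Algebra.Algebra" "HOL-Library.Extended_Nat" "HOL-Library.Nat_Bijection"
begin

section \<open>Twisted conjugacy\<close>

definition twisted_conj_rel :: "('a, 'b) monoid_scheme \<Rightarrow> ('a \<Rightarrow> 'a) \<Rightarrow> ('a \<times> 'a) set"
  where "twisted_conj_rel G \<phi> =
    {(g, f). g \<in> carrier G \<and> f \<in> carrier G \<and>
             (\<exists>x \<in> carrier G. \<phi> x \<otimes>\<^bsub>G\<^esub> g = f \<otimes>\<^bsub>G\<^esub> x)}"

lemma (in group) equiv_twisted_conj_rel:
  assumes "\<phi> \<in> hom G G"
  shows "equiv (carrier G) (twisted_conj_rel G \<phi>)"
proof -
  interpret \<phi>: group_hom G G \<phi>
    using assms by unfold_locales
  show ?thesis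
  proof (rule equivI)
    show "twisted_conj_rel G \<phi> \<subseteq> carrier G \<times> carrier G"
      by (auto simp: twisted_conj_rel_def)
    show "refl_on (carrier G) (twisted_conj_rel G \<phi>)"
      by (auto simp: refl_on_def twisted_conj_rel_def intro!: bexI[of _ \<one>])
    show "sym (twisted_conj_rel G \<phi>)"
    proof (rule symI)
      fix g f assume "(g, f) \<in> twisted_conj_rel G \<phi>"
      then obtain x where x: "g \<in> carrier G" "f \<in> carrier G" "x \<in> carrier G" "\<phi> x \<otimes> g = f \<otimes> x"
        by (auto simp: twisted_conj_rel_def)
      have "\<phi> (inv x) \<otimes> f = inv (\<phi> x) \<otimes> (f \<otimes> x) \<otimes> inv x"
        using x(1-3) by (simp add: m_assoc)
      also have "\<dots> = inv (\<phi> x) \<otimes> (\<phi> x \<otimes> g) \<otimes> inv x"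
        by (simp add: x(4))
      also have "\<dots> = g \<otimes> inv x"
        using x(1-3) by (simp add: m_assoc[symmetric])
      finally show "(f, g) \<in> twisted_conj_rel G \<phi>"
        using x(1-3) by (auto simp: twisted_conj_rel_def intro!: bexI[of _ "inv x"])
    qed
    show "trans (twisted_conj_rel G \<phi>)"
    proof (rule transI)
      fix g f h assume "(g, f) \<in> twisted_conj_rel G \<phi>" "(f, h) \<in> twisted_conj_rel G \<phi>"
      then obtain x y where c: "g \<in> carrier G" "f \<in> carrier G" "h \<in> carrier G"
          "x \<in> carrier G" "y \<in> carrier G"
        and x: "\<phi> x \<otimes> g = f \<otimes> x" and y: "\<phi> y \<otimes> f = h \<otimes> y"
        by (auto simp: twisted_conj_rel_def)
      have "\<phi> (y \<otimes> x) \<otimes> g = \<phi> y \<otimes> (\<phi> x \<otimes> g)"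
        using c by (simp add: m_assoc)
      also have "\<dots> = (\<phi> y \<otimes> f) \<otimes> x"
        using c by (simp add: x m_assoc)
      also have "\<dots> = h \<otimes> (y \<otimes> x)"
        using c by (simp add: y m_assoc)
      finally show "(g, h) \<in> twisted_conj_rel G \<phi>"
        using c by (auto simp: twisted_conj_rel_def intro!: bexI[of _ "y \<otimes> x"])
    qed
  qed
qed

definition reidemeister_number :: "('a, 'b) monoid_scheme \<Rightarrow> ('a \<Rightarrow> 'a) \<Rightarrow> enat"
  where "reidemeister_number G \<phi> =
    (let Q = carrier G // twisted_conj_rel G \<phi>
     in if finite Q then enat (card Q) else \<infinity>)"


section \<open>Nilpotency class\<close>

text \<open>Indexing starts at 0: \<open>lower_central G i\<close> is the term usually written
  \<open>\<gamma>\<close> with index \<open>i + 1\<close>.\<close>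

primrec lower_central :: "('a, 'b) monoid_scheme \<Rightarrow> nat \<Rightarrow> 'a set"
  where
    "lower_central G 0 = carrier G"
  | "lower_central G (Suc i) =
       generate G (\<Union>x \<in> lower_central G i. \<Union>y \<in> carrier G.
         {x \<otimes>\<^bsub>G\<^esub> y \<otimes>\<^bsub>G\<^esub> inv\<^bsub>G\<^esub> x \<otimes>\<^bsub>G\<^esub> inv\<^bsub>G\<^esub> y})"

definition nilpotent_of_class :: "('a, 'b) monoid_scheme \<Rightarrow> nat \<Rightarrow> bool"
  where "nilpotent_of_class G k \<longleftrightarrow>
    group G \<and> lower_central G k = {\<one>\<^bsub>G\<^esub>} \<and> (\<forall>i < k. lower_central G i \<noteq> {\<one>\<^bsub>G\<^esub>})"


section \<open>Words and finite presentations\<close>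

text \<open>The letter \<open>(i, True)\<close> stands for the \<open>i\<close>-th generator and \<open>(i, False)\<close> for its
  inverse.\<close>

type_synonym letter = "nat \<times> bool"
type_synonym word = "letter list"

definition words_over :: "nat \<Rightarrow> word set"
  where "words_over n = lists ({..<n} \<times> UNIV)"

primrec word_value :: "('a, 'b) monoid_scheme \<Rightarrow> 'a list \<Rightarrow> word \<Rightarrow> 'a"
  where
    "word_value G gens [] = \<one>\<^bsub>G\<^esub>"
  | "word_value G gens (l # w) =
       (if snd l then gens ! fst l else inv\<^bsub>G\<^esub> (gens ! fst l)) \<otimes>\<^bsub>G\<^esub> word_value G gens w"

inductive cancel_or_relator :: "nat \<Rightarrow> word set \<Rightarrow> word \<Rightarrow> word \<Rightarrow> bool"
  for n :: nat and R :: "word set"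
  where
    cancel: "\<lbrakk>u \<in> words_over n; v \<in> words_over n; i < n\<rbrakk> \<Longrightarrow>
      cancel_or_relator n R (u @ [(i, b), (i, \<not> b)] @ v) (u @ v)"
  | relator: "\<lbrakk>u \<in> words_over n; v \<in> words_over n; r \<in> R\<rbrakk> \<Longrightarrow>
      cancel_or_relator n R (u @ r @ v) (u @ v)"

text \<open>The group presented by \<open>n\<close> generators and relators \<open>R\<close> is the quotient of \<open>words_over n\<close>
  by the equivalence closure of \<open>cancel_or_relator n R\<close>.  The last two conditions say that sending
  the generators to the members of \<open>gens\<close> defines an isomorphism from that group onto \<open>G\<close>.
  Repetitions in \<open>gens\<close> are allowed.\<close>

definition finite_presentation ::
    "('a, 'b) monoid_scheme \<Rightarrow> 'a list \<Rightarrow> word list \<Rightarrow> bool"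
  where "finite_presentation G gens rels \<longleftrightarrow>
    set gens \<subseteq> carrier G \<and>
    set rels \<subseteq> words_over (length gens) \<and>
    generate G (set gens) = carrier G \<and>
    (\<forall>u \<in> words_over (length gens). \<forall>v \<in> words_over (length gens).
       word_value G gens u = word_value G gens v \<longleftrightarrow>
       equivclp (cancel_or_relator (length gens) (set rels)) u v)"

definition given_by_words ::
    "('a, 'b) monoid_scheme \<Rightarrow> 'a list \<Rightarrow> ('a \<Rightarrow> 'a) \<Rightarrow> word list \<Rightarrow> bool"
  where "given_by_words G gens \<phi> ws \<longleftrightarrow>
    length ws = length gens \<and> set ws \<subseteq> words_over (length gens) \<and>
    (\<forall>i < length gens. \<phi> (gens ! i) = word_value G gens (ws ! i))"


section \<open>Algorithms as partial recursive functions\<close>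

text \<open>Terms denote Kleene's partial recursive functions; a call diverges if and only if no value is
  related to it.  Minimisation requires the earlier values to be defined and nonzero.\<close>

datatype recf = Zero | Succ | Proj nat | Comp recf "recf list" | PrimRec recf recf | Mu recf

inductive recf_eval :: "recf \<Rightarrow> nat list \<Rightarrow> nat \<Rightarrow> bool"
  where
    Zero: "recf_eval Zero xs 0"
  | Succ: "recf_eval Succ [x] (Suc x)"
  | Proj: "i < length xs \<Longrightarrow> recf_eval (Proj i) xs (xs ! i)"
  | Comp: "\<lbrakk>list_all2 (\<lambda>g y. recf_eval g xs y) gs ys; recf_eval f ys z\<rbrakk> \<Longrightarrow>
      recf_eval (Comp f gs) xs z"
  | PrimRec_0: "recf_eval f xs y \<Longrightarrow> recf_eval (PrimRec f g) (0 # xs) y"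
  | PrimRec_Suc: "\<lbrakk>recf_eval (PrimRec f g) (m # xs) y; recf_eval g (m # y # xs) z\<rbrakk> \<Longrightarrow>
      recf_eval (PrimRec f g) (Suc m # xs) z"
  | Mu: "\<lbrakk>recf_eval f (m # xs) 0; \<forall>j < m. \<exists>y. recf_eval f (j # xs) (Suc y)\<rbrakk> \<Longrightarrow>
      recf_eval (Mu f) xs m"

inductive_cases recf_eval_ZeroE: "recf_eval Zero xs z"
inductive_cases recf_eval_SuccE: "recf_eval Succ xs z"
inductive_cases recf_eval_ProjE: "recf_eval (Proj i) xs z"
inductive_cases recf_eval_CompE: "recf_eval (Comp f gs) xs z"
inductive_cases recf_eval_PrimRec_0E: "recf_eval (PrimRec f g) (0 # xs) z"
inductive_cases recf_eval_PrimRec_SucE: "recf_eval (PrimRec f g) (Suc m # xs) z"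
inductive_cases recf_eval_MuE: "recf_eval (Mu f) xs z"

lemma recf_eval_deterministic:
  "recf_eval f xs y \<Longrightarrow> recf_eval f xs z \<Longrightarrow> y = z"
proof (induction f xs y arbitrary: z rule: recf_eval.induct)
  case (Zero xs)
  then show ?case by (rule recf_eval_ZeroE) simp
next
  case (Succ x)
  then show ?case by (rule recf_eval_SuccE) simp
next
  case (Proj i xs)
  from Proj.prems show ?case by (rule recf_eval_ProjE) simp
next
  case (Comp xs gs ys f y)
  from Comp.prems obtain ys' where ys':
    "list_all2 (\<lambda>g y. recf_eval g xs y) gs ys'" "recf_eval f ys' z"
    by (rule recf_eval_CompE)
  have "ys = ys'"
    using Comp.IH(1) ys'(1)
    by (intro nth_equalityI) (simp_all add: list_all2_conv_all_nth)
  with Comp.IH(2) ys'(2) show ?case by blast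
next
  case (PrimRec_0 f xs y g)
  from PrimRec_0.prems have "recf_eval f xs z"
    by (rule recf_eval_PrimRec_0E)
  then show ?case by (rule PrimRec_0.IH)
next
  case (PrimRec_Suc f g m xs y z')
  from PrimRec_Suc.prems obtain y' where
    y': "recf_eval (PrimRec f g) (m # xs) y'" "recf_eval g (m # y' # xs) z"
    by (rule recf_eval_PrimRec_SucE)
  from PrimRec_Suc.IH(1)[OF y'(1)] y'(2) have "recf_eval g (m # y # xs) z" by simp
  then show ?case by (rule PrimRec_Suc.IH(2))
next
  case (Mu f m xs)
  from Mu.prems have z: "recf_eval f (z # xs) 0 \<and> (\<forall>j < z. \<exists>y. recf_eval f (j # xs) (Suc y))"
    by (rule recf_eval_MuE) simp
  show ?case
  proof (rule linorder_cases[of m z])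
    assume "m < z"
    with z obtain y where "recf_eval f (m # xs) (Suc y)" by blast
    from Mu.IH(1)[OF this] show ?thesis by simp
  next
    assume "z < m"
    with Mu.IH(2) obtain y where "\<forall>y'. recf_eval f (z # xs) y' \<longrightarrow> Suc y = y'" by blast
    with z show ?thesis by blast
  qed
qed

definition letter_code :: "letter \<Rightarrow> nat"
  where "letter_code l = 2 * fst l + (if snd l then 0 else 1)"

definition words_code :: "word list \<Rightarrow> nat"
  where "words_code ws = list_encode (map (\<lambda>w. list_encode (map letter_code w)) ws)"

definition enat_code :: "enat \<Rightarrow> nat"
  where "enat_code r = (case r of enat m \<Rightarrow> Suc m | \<infinity> \<Rightarrow> 0)"

end

theory Submission
  imports Defs
begin

text \<open>
  The algorithm searches for a finite certificate of the value of the Reidemeister number; everything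
  that depends on \<open>N\<close> alone is built into it.  Let \<open>\<gamma>\<close> be the lower central series.  Its terms
  are finitely generated, and an automorphism \<open>\<phi>\<close> maps each of them into itself, so the displacement
  \<open>x \<mapsto> \<phi> x \<otimes> inv x\<close> induces an endomorphism of every factor of the series.  The factors are finitely
  generated abelian groups; comparing ranks shows that the kernel of this endomorphism is a torsion
  group if and only if its cokernel is one (\<open>ker_torsion_iff_coker_torsion\<close>).

  The number of classes is finite if and only if this happens in every factor.  With finitely many
  classes, two powers of an element of \<open>\<gamma> i\<close> are conjugate, which makes a power of it a displacement
  modulo \<open>\<gamma> (Suc i)\<close> (\<open>ker_torsion_if_finitely_many_classes\<close>).  Conversely, if the \<open>m\<close>-th power of each
  generator of each \<open>\<gamma> i\<close> is a displacement modulo \<open>\<gamma> (Suc i)\<close>, then every element is conjugate to a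
  product of powers of these generators with exponents below \<open>m\<close> (\<open>every_element_conj_to_box\<close>).

  Infinity is therefore certified by an element of \<open>\<gamma> i\<close> that has infinite order modulo \<open>\<gamma> (Suc i)\<close>
  and is fixed by \<open>\<phi>\<close> modulo \<open>\<gamma> (Suc i)\<close>.  Infinite order is a negative statement, but it follows from a
  positive one: the element is \<open>b [^] E \<otimes> h\<close> with \<open>E > 0\<close> and \<open>h \<in> H\<close>, where \<open>(b, H)\<close> is one of finitely
  many pairs, fixed with the group, such that no positive power of \<open>b\<close> is in \<open>H\<close>
  (\<open>aperiodic_decomposition\<close>).

  The value \<open>r\<close> is certified from both sides.  At most \<open>r\<close> classes: an exponent \<open>m\<close> as above, and
  conjugations that take each of the finitely many products to one of \<open>r\<close> representatives.  At least
  \<open>r\<close> classes: the coset table of a finite quotient together with a colouring of its points by \<open>r\<close>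
  colours that is constant on classes.  Such a table exists because, when there are finitely many
  classes, some normal subgroup of finite index has all its cosets within classes
  (\<open>finite_index_normal_subgroup_within_classes\<close>).

  All conditions are equations between words, which are semidecidable because the presentation is
  finite, or finite checks of tables.
\<close>

section \<open>Total recursive functions\<close>

text \<open>
  Functions of \<open>n\<close> arguments, given as a list.  This notion with explicit arity leads
  to the pairing function; after that, functions of one argument suffice.
\<close>

definition total_rec :: "nat \<Rightarrow> (nat list \<Rightarrow> nat) \<Rightarrow> bool"
  where "total_rec n f \<longleftrightarrow> (\<exists>F. \<forall>xs. length xs = n \<longrightarrow> recf_eval F xs (f xs))"

lemma total_rec_cong:
  assumes "total_rec n f" "\<And>xs. length xs = n \<Longrightarrow> g xs = f xs"
  shows "total_rec n g"
  using assms unfolding total_rec_def by metis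

lemma total_rec_zero: "total_rec n (\<lambda>xs. 0)"
  unfolding total_rec_def by (blast intro: recf_eval.Zero)

lemma total_rec_proj: "i < n \<Longrightarrow> total_rec n (\<lambda>xs. xs ! i)"
  unfolding total_rec_def by (blast intro: recf_eval.Proj)

lemma total_rec_comp1:
  assumes "total_rec 1 f" "total_rec n g"
  shows "total_rec n (\<lambda>xs. f [g xs])"
proof -
  obtain F G where "\<forall>xs. length xs = 1 \<longrightarrow> recf_eval F xs (f xs)"
    "\<forall>xs. length xs = n \<longrightarrow> recf_eval G xs (g xs)"
    using assms unfolding total_rec_def by blast
  then have "\<forall>xs. length xs = n \<longrightarrow> recf_eval (Comp F [G]) xs (f [g xs])"
    by (auto intro!: recf_eval.Comp)
  then show ?thesis unfolding total_rec_def by blast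
qed

lemma total_rec_comp2:
  assumes "total_rec 2 f" "total_rec n g" "total_rec n h"
  shows "total_rec n (\<lambda>xs. f [g xs, h xs])"
proof -
  obtain F G H where "\<forall>xs. length xs = 2 \<longrightarrow> recf_eval F xs (f xs)"
    "\<forall>xs. length xs = n \<longrightarrow> recf_eval G xs (g xs)"
    "\<forall>xs. length xs = n \<longrightarrow> recf_eval H xs (h xs)"
    using assms unfolding total_rec_def by blast
  then have "\<forall>xs. length xs = n \<longrightarrow> recf_eval (Comp F [G, H]) xs (f [g xs, h xs])"
    by (auto intro!: recf_eval.Comp)
  then show ?thesis unfolding total_rec_def by blast
qed

lemma total_rec_Suc:
  assumes "total_rec n g" shows "total_rec n (\<lambda>xs. Suc (g xs))"
proof -
  have "total_rec 1 (\<lambda>xs. Suc (hd xs))"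
    unfolding total_rec_def
    by (rule exI[of _ Succ]) (auto simp: length_Suc_conv intro: recf_eval.Succ)
  from total_rec_comp1[OF this assms] show ?thesis by simp
qed

lemma total_rec_const: "total_rec n (\<lambda>xs. c)"
  by (induction c) (auto intro: total_rec_zero total_rec_Suc)

lemma total_rec_primrec:
  assumes f: "total_rec n f" and g: "total_rec (Suc (Suc n)) g" and t: "total_rec n t"
  shows "total_rec n (\<lambda>xs. rec_nat (f xs) (\<lambda>i acc. g (i # acc # xs)) (t xs))"
proof -
  obtain F G T where F: "\<forall>xs. length xs = n \<longrightarrow> recf_eval F xs (f xs)"
    and G: "\<forall>xs. length xs = Suc (Suc n) \<longrightarrow> recf_eval G xs (g xs)"
    and T: "\<forall>xs. length xs = n \<longrightarrow> recf_eval T xs (t xs)"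
    using f g t unfolding total_rec_def by blast
  have P: "recf_eval (PrimRec F G) (m # xs) (rec_nat (f xs) (\<lambda>i acc. g (i # acc # xs)) m)"
    if "length xs = n" for m xs
    by (induction m) (use F G that in \<open>auto intro!: recf_eval.PrimRec_0 recf_eval.PrimRec_Suc\<close>)
  have "recf_eval (Comp (PrimRec F G) (T # map Proj [0..<n])) xs
          (rec_nat (f xs) (\<lambda>i acc. g (i # acc # xs)) (t xs))" if "length xs = n" for xs
  proof (rule recf_eval.Comp)
    show "list_all2 (\<lambda>g y. recf_eval g xs y) (T # map Proj [0..<n]) (t xs # xs)"
      using T that by (auto simp: list_all2_conv_all_nth nth_Cons' intro: recf_eval.Proj)
  qed (rule P[OF that])
  then show ?thesis unfolding total_rec_def by blast
qed

lemma rec_nat_add: "rec_nat a (\<lambda>i acc. Suc acc) b = a + b" by (induction b) auto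
lemma rec_nat_pred: "rec_nat 0 (\<lambda>i acc. i) b = b - 1" by (cases b) auto
lemma rec_nat_monus: "rec_nat a (\<lambda>i acc. acc - 1) b = a - b" by (induction b) auto
lemma rec_nat_times: "rec_nat 0 (\<lambda>i acc. acc + a) b = a * b" by (induction b) auto
lemma rec_nat_triangle: "rec_nat 0 (\<lambda>i acc. acc + Suc i) b = triangle b" by (induction b) auto

lemma total_rec_add:
  assumes "total_rec n f" "total_rec n g" shows "total_rec n (\<lambda>xs. f xs + g xs)"
  using total_rec_primrec[OF assms(1) total_rec_Suc[OF total_rec_proj[of 1]] assms(2)]
  by (simp add: rec_nat_add)

lemma total_rec_monus:
  assumes "total_rec n f" "total_rec n g" shows "total_rec n (\<lambda>xs. f xs - g xs)"
proof -
  have "total_rec m (\<lambda>xs. h xs - 1)" if "total_rec m h" for m h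
    using total_rec_primrec[OF total_rec_zero total_rec_proj[of 0] that]
    by (simp add: rec_nat_pred)
  from total_rec_primrec[OF assms(1) this[OF total_rec_proj[of 1]] assms(2)]
  show ?thesis by (simp only: nth_Cons_0 nth_Cons_Suc One_nat_def rec_nat_monus[unfolded One_nat_def])
qed

lemma total_rec_times:
  assumes "total_rec n f" "total_rec n g" shows "total_rec n (\<lambda>xs. f xs * g xs)"
proof -
  have "total_rec 2 (\<lambda>ys. rec_nat 0 (\<lambda>i acc. acc + ys ! 0) (ys ! 1))"
    using total_rec_primrec[OF total_rec_zero
      total_rec_add[OF total_rec_proj[of 1] total_rec_proj[of 2]] total_rec_proj[of 1 2]]
    by simp
  from total_rec_comp2[OF this assms] show ?thesis by (simp add: rec_nat_times)
qed

lemma total_rec_triangle: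
  assumes "total_rec n f" shows "total_rec n (\<lambda>xs. triangle (f xs))"
  using total_rec_primrec[OF total_rec_zero
      total_rec_add[OF total_rec_proj[of 1] total_rec_Suc[OF total_rec_proj[of 0]]] assms]
  by (simp add: rec_nat_triangle del: add_Suc_right)

lemma total_rec_Mu:
  assumes f: "total_rec (Suc n) f" and ex: "\<And>xs. length xs = n \<Longrightarrow> \<exists>m. f (m # xs) = 0"
  shows "total_rec n (\<lambda>xs. LEAST m. f (m # xs) = 0)"
proof -
  obtain F where F: "\<forall>xs. length xs = Suc n \<longrightarrow> recf_eval F xs (f xs)"
    using f unfolding total_rec_def by blast
  have "recf_eval (Mu F) xs (LEAST m. f (m # xs) = 0)" if l: "length xs = n" for xs
  proof (rule recf_eval.Mu)
    have "f ((LEAST m. f (m # xs) = 0) # xs) = 0"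
      by (rule LeastI_ex) (rule ex[OF l])
    then show "recf_eval F ((LEAST m. f (m # xs) = 0) # xs) 0"
      using F l by (metis length_Cons)
    show "\<forall>j < (LEAST m. f (m # xs) = 0). \<exists>y. recf_eval F (j # xs) (Suc y)"
    proof (intro allI impI)
      fix j assume "j < (LEAST m. f (m # xs) = 0)"
      then have "f (j # xs) \<noteq> 0" by (rule not_less_Least)
      then show "\<exists>y. recf_eval F (j # xs) (Suc y)"
        using F l by (metis length_Cons not0_implies_Suc)
    qed
  qed
  then show ?thesis unfolding total_rec_def by blast
qed

definition pair :: "nat \<Rightarrow> nat \<Rightarrow> nat" where "pair a b = prod_encode (a, b)"
definition pfst :: "nat \<Rightarrow> nat" where "pfst z = fst (prod_decode z)"
definition psnd :: "nat \<Rightarrow> nat" where "psnd z = snd (prod_decode z)"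

lemma pfst_pair [simp]: "pfst (pair a b) = a"
  and psnd_pair [simp]: "psnd (pair a b) = b"
  and pair_pfst_psnd [simp]: "pair (pfst z) (psnd z) = z"
  by (simp_all add: pair_def pfst_def psnd_def)

lemma ex_pair: "(\<exists>c. Q (pfst c) (psnd c)) \<longleftrightarrow> (\<exists>a b. Q a b)"
  by (metis pfst_pair psnd_pair)

lemma pair_eq_triangle: "pair a b = triangle (a + b) + a"
  by (simp add: pair_def prod_encode_def)

lemma triangle_mono: "m \<le> n \<Longrightarrow> triangle m \<le> triangle n"
  by (induction n) (auto simp: le_Suc_eq)

text \<open>
  The code \<open>pair a b\<close> lies on the diagonal \<open>s = a + b\<close>, which is the first
  one whose successor starts beyond the code.  This makes the projections computable by a search.
\<close>

lemma pfst_psnd_sum: "(LEAST s. Suc z - triangle (Suc s) = 0) = pfst z + psnd z"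
proof (rule Least_equality)
  have z: "z = triangle (pfst z + psnd z) + pfst z"
    using pair_eq_triangle[of "pfst z" "psnd z"] by simp
  then show "Suc z - triangle (Suc (pfst z + psnd z)) = 0" by simp
  fix y assume y: "Suc z - triangle (Suc y) = 0"
  show "pfst z + psnd z \<le> y"
  proof (rule ccontr)
    assume "\<not> ?thesis"
    then have "triangle (Suc y) \<le> triangle (pfst z + psnd z)"
      by (intro triangle_mono) simp
    with y z show False by linarith
  qed
qed

lemma total_rec_pfst_psnd_sum: "total_rec n f \<Longrightarrow> total_rec n (\<lambda>xs. pfst (f xs) + psnd (f xs))"
proof -
  assume f: "total_rec n f"
  have "\<exists>s. Suc z - triangle (Suc s) = 0" for z
  proof -
    have "s \<le> triangle s" for s by (induction s) auto
    from this[of "Suc z"] show ?thesis by (intro exI[of _ z]) simp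
  qed
  then have "total_rec 1 (\<lambda>xs. LEAST m. (\<lambda>ys. Suc (ys ! 1) - triangle (Suc (ys ! 0))) (m # xs) = 0)"
    by (intro total_rec_Mu total_rec_monus total_rec_Suc total_rec_triangle total_rec_proj) auto
  from total_rec_comp1[OF this f] show ?thesis by (simp only: nth_Cons_0 nth_Cons_Suc One_nat_def pfst_psnd_sum)
qed

lemma total_rec_pfst: assumes "total_rec n f" shows "total_rec n (\<lambda>xs. pfst (f xs))"
proof -
  have "pfst z = z - triangle (pfst z + psnd z)" for z
    using pair_eq_triangle[of "pfst z" "psnd z"] by simp
  then show ?thesis
    using total_rec_monus[OF assms total_rec_triangle[OF total_rec_pfst_psnd_sum[OF assms]]]
    by (rule_tac total_rec_cong) auto
qed

lemma total_rec_psnd: assumes "total_rec n f" shows "total_rec n (\<lambda>xs. psnd (f xs))"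
  using total_rec_monus[OF total_rec_pfst_psnd_sum[OF assms] total_rec_pfst[OF assms]] by simp

lemma total_rec_pair:
  "\<lbrakk>total_rec n f; total_rec n g\<rbrakk> \<Longrightarrow> total_rec n (\<lambda>xs. pair (f xs) (g xs))"
  by (simp add: pair_eq_triangle total_rec_add total_rec_triangle)

text \<open>
  An environment of several variables is packed into one number by \<open>pair\<close>, so the
  closure properties below are stated for one variable and compose by unification.
\<close>

definition computable :: "(nat \<Rightarrow> nat) \<Rightarrow> bool"
  where "computable f \<longleftrightarrow> (\<exists>F. \<forall>x. recf_eval F [x] (f x))"

lemma computable_total_rec: "computable f \<longleftrightarrow> total_rec 1 (\<lambda>xs. f (xs ! 0))"
proof -
  have "(\<forall>x. recf_eval F [x] (f x)) \<longleftrightarrow> (\<forall>xs. length xs = 1 \<longrightarrow> recf_eval F xs (f (xs ! 0)))" for F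
    by (auto simp: length_Suc_conv)
  then show ?thesis unfolding computable_def total_rec_def by simp
qed

lemma computable_comp:
  assumes "computable f" "computable g" shows "computable (\<lambda>x. f (g x))"
  using total_rec_comp1[of "\<lambda>xs. f (xs ! 0)" 1 "\<lambda>xs. g (xs ! 0)"] assms
  by (simp add: computable_total_rec)

lemma computable_id: "computable (\<lambda>x. x)"
  by (simp add: computable_total_rec total_rec_proj)

lemma computable_const: "computable (\<lambda>x. c)"
  by (simp add: computable_total_rec total_rec_const)

lemma computable_Suc: "computable f \<Longrightarrow> computable (\<lambda>x. Suc (f x))"
  by (simp add: computable_total_rec total_rec_Suc)

lemma computable_add: "\<lbrakk>computable f; computable g\<rbrakk> \<Longrightarrow> computable (\<lambda>x. f x + g x)"
  by (simp add: computable_total_rec total_rec_add)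

lemma computable_monus: "\<lbrakk>computable f; computable g\<rbrakk> \<Longrightarrow> computable (\<lambda>x. f x - g x)"
  by (simp add: computable_total_rec total_rec_monus)

lemma computable_times: "\<lbrakk>computable f; computable g\<rbrakk> \<Longrightarrow> computable (\<lambda>x. f x * g x)"
  by (simp add: computable_total_rec total_rec_times)

lemma computable_pair: "\<lbrakk>computable f; computable g\<rbrakk> \<Longrightarrow> computable (\<lambda>x. pair (f x) (g x))"
  by (simp add: computable_total_rec total_rec_pair)

lemma computable_pfst: "computable f \<Longrightarrow> computable (\<lambda>x. pfst (f x))"
  by (simp add: computable_total_rec total_rec_pfst)

lemma computable_psnd: "computable f \<Longrightarrow> computable (\<lambda>x. psnd (f x))"
  by (simp add: computable_total_rec total_rec_psnd)

lemmas computable_basic = computable_const computable_id computable_Suc computable_add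
  computable_monus computable_times computable_pair computable_pfst computable_psnd

definition computable2 :: "(nat \<Rightarrow> nat \<Rightarrow> nat) \<Rightarrow> bool"
  where "computable2 f \<longleftrightarrow> computable (\<lambda>z. f (pfst z) (psnd z))"

definition computable3 :: "(nat \<Rightarrow> nat \<Rightarrow> nat \<Rightarrow> nat) \<Rightarrow> bool"
  where "computable3 f \<longleftrightarrow> computable (\<lambda>z. f (pfst z) (pfst (psnd z)) (psnd (psnd z)))"

lemma computable2_comp:
  assumes "computable2 f" "computable a" "computable b"
  shows "computable (\<lambda>x. f (a x) (b x))"
  using computable_comp[OF assms(1)[unfolded computable2_def] computable_pair[OF assms(2,3)]]
  by simp

lemma computable3_comp:
  assumes "computable3 f" "computable a" "computable b" "computable c"
  shows "computable (\<lambda>x. f (a x) (b x) (c x))"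
  using computable_comp[OF assms(1)[unfolded computable3_def]
      computable_pair[OF assms(2) computable_pair[OF assms(3,4)]]]
  by simp

text \<open>
  The three arguments of the step are the counter, the accumulator and the environment.
\<close>

lemma computable_rec_nat:
  assumes a: "computable a" and h: "computable3 h" and t: "computable t"
  shows "computable (\<lambda>x. rec_nat (a x) (\<lambda>i acc. h i acc x) (t x))"
proof -
  have "total_rec 3 (\<lambda>xs. h (xs ! 0) (xs ! 1) (xs ! 2))"
    using total_rec_comp1[OF h[unfolded computable3_def computable_total_rec], of 3
        "\<lambda>xs. pair (xs ! 0) (pair (xs ! 1) (xs ! 2))"]
    by (simp add: total_rec_pair total_rec_proj)
  then have "total_rec (Suc (Suc 1)) (\<lambda>xs. h (xs ! 0) (xs ! 1) (xs ! 2))"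
    by (simp add: numeral_3_eq_3)
  from total_rec_primrec[OF _ this] a t show ?thesis
    by (simp add: computable_total_rec numeral_2_eq_2)
qed

lemma computable_If:
  assumes "computable t" "computable f" "computable g"
  shows "computable (\<lambda>x. if t x = 0 then f x else g x)"
proof -
  have "computable (\<lambda>x. rec_nat (f x) (\<lambda>i acc. g x) (t x))"
    by (rule computable_rec_nat[OF assms(2) _ assms(1)])
      (auto simp: computable3_def intro!: computable_comp[OF assms(3)] computable_basic)
  moreover have "rec_nat (f x) (\<lambda>i acc. g x) (t x) = (if t x = 0 then f x else g x)" for x
    by (cases "t x") auto
  ultimately show ?thesis by simp
qed

lemma computable_mod2: assumes "computable f" shows "computable (\<lambda>x. f x mod 2)"
proof -
  have "computable (\<lambda>x. rec_nat 0 (\<lambda>i acc. 1 - acc) x)"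
    by (intro computable_rec_nat) (auto simp only: computable3_def intro!: computable_basic)
  moreover have "rec_nat 0 (\<lambda>i acc. 1 - acc) x = x mod 2" for x :: nat
    by (induction x) (auto simp: mod_Suc)
  ultimately show ?thesis using computable_comp[OF _ assms] by simp
qed

lemma computable_div2: assumes "computable f" shows "computable (\<lambda>x. f x div 2)"
proof -
  have "computable (\<lambda>x. rec_nat 0 (\<lambda>i acc. acc + i mod 2) x)"
    by (intro computable_rec_nat)
      (auto simp only: computable3_def intro!: computable_basic computable_mod2)
  moreover have "rec_nat 0 (\<lambda>i acc. acc + i mod 2) x = x div 2" for x :: nat
    by (induction x) (auto, presburger)
  ultimately show ?thesis using computable_comp[OF _ assms] by simp
qed

lemma computable_sum_less:
  assumes h: "computable2 h" and t: "computable t"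
  shows "computable (\<lambda>x. \<Sum>i<t x. h i x)"
proof -
  have "computable (\<lambda>x. rec_nat 0 (\<lambda>i acc. acc + h i x) (t x))"
    by (rule computable_rec_nat[OF computable_const _ t])
      (unfold computable3_def, intro computable_basic computable2_comp[OF h])
  moreover have "rec_nat 0 (\<lambda>i acc. acc + h i x) m = (\<Sum>i<m. h i x)" for x m
    by (induction m) (auto simp: add.commute)
  ultimately show ?thesis by simp
qed

definition computable_list :: "(nat \<Rightarrow> nat list) \<Rightarrow> bool"
  where "computable_list f \<longleftrightarrow> computable (\<lambda>x. list_encode (f x))"

lemma computable_list_const: "computable_list (\<lambda>x. c)"
  by (simp add: computable_list_def computable_const)

lemma computable_list_decode: "computable f \<Longrightarrow> computable_list (\<lambda>x. list_decode (f x))"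
  by (simp add: computable_list_def)

lemma computable_list_encode: "computable_list f \<Longrightarrow> computable (\<lambda>x. list_encode (f x))"
  by (simp add: computable_list_def)

lemma computable_list_Cons:
  "\<lbrakk>computable a; computable_list f\<rbrakk> \<Longrightarrow> computable_list (\<lambda>x. a x # f x)"
  unfolding computable_list_def list_encode.simps pair_def[symmetric]
  by (intro computable_basic)

lemma length_le_list_encode: "length xs \<le> list_encode xs"
proof (induction xs)
  case (Cons a xs)
  then show ?case using le_prod_encode_2[of "list_encode xs" a] by simp
qed simp

text \<open>
  One step of a left fold on a state that pairs the accumulator with the code of the remaining list.
  The code of the empty list is 0.
\<close>

definition fold_step :: "(nat \<Rightarrow> nat \<Rightarrow> nat \<Rightarrow> nat) \<Rightarrow> nat \<Rightarrow> nat \<Rightarrow> nat"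
  where "fold_step h x s = (if psnd s = 0 then s
    else pair (h (pfst s) (pfst (psnd s - 1)) x) (psnd (psnd s - 1)))"

lemma fold_step_iter:
  "rec_nat (pair a (list_encode xs)) (\<lambda>i s. fold_step h x s) n =
     pair (foldl (\<lambda>acc l. h acc l x) a (take n xs)) (list_encode (drop n xs))"
proof (induction n)
  case (Suc n)
  show ?case
  proof (cases "n < length xs")
    case True
    then have "drop n xs = xs ! n # drop (Suc n) xs" by (simp add: Cons_nth_drop_Suc)
    with Suc True show ?thesis
      by (simp add: fold_step_def pair_def[symmetric] take_Suc_conv_app_nth)
  qed (use Suc in \<open>simp add: fold_step_def\<close>)
qed simp

text \<open>
  The code of a list bounds its length, so iterating the step that many times reaches the end of the
  list, where the state rests.
\<close>

lemma computable_foldl: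
  assumes h: "computable3 h" and a: "computable a" and l: "computable_list ls"
  shows "computable (\<lambda>x. foldl (\<lambda>acc l. h acc l x) (a x) (ls x))"
proof -
  have "computable (\<lambda>x. pfst (rec_nat (pair (a x) (list_encode (ls x)))
      (\<lambda>i s. fold_step h x s) (list_encode (ls x))))"
    using l unfolding computable_list_def
    by (intro computable_basic computable_rec_nat a)
      (auto simp only: computable3_def fold_step_def intro!: computable_If computable_basic
        computable3_comp[OF h])
  then show ?thesis
    by (simp add: fold_step_iter length_le_list_encode)
qed

lemma computable_list_foldl:
  assumes h: "computable_list (\<lambda>z. h (list_decode (pfst z)) (pfst (psnd z)) (psnd (psnd z)))"
    and a: "computable_list a" and l: "computable_list ls"
  shows "computable_list (\<lambda>x. foldl (\<lambda>acc l. h acc l x) (a x) (ls x))"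
proof -
  have "computable (\<lambda>x. foldl (\<lambda>acc l. list_encode (h (list_decode acc) l x)) (list_encode (a x)) (ls x))"
    by (rule computable_foldl[OF _ _ l]) (use a h in \<open>simp_all add: computable_list_def computable3_def\<close>)
  moreover have "foldl (\<lambda>acc l. list_encode (h (list_decode acc) l x)) (list_encode b) xs
      = list_encode (foldl (\<lambda>acc l. h acc l x) b xs)" for b xs x
    by (induction xs arbitrary: b) auto
  ultimately show ?thesis by (simp add: computable_list_def)
qed

lemma computable_list_rev:
  assumes "computable_list f" shows "computable_list (\<lambda>x. rev (f x))"
proof -
  have "computable_list (\<lambda>x. foldl (\<lambda>acc l. l # acc) [] (f x))"
    by (rule computable_list_foldl[OF _ computable_list_const assms])
      (intro computable_list_Cons computable_basic computable_list_decode)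
  then show ?thesis by (simp add: foldl_conv_fold fold_Cons_rev)
qed

lemma computable_list_append:
  assumes "computable_list f" "computable_list g" shows "computable_list (\<lambda>x. f x @ g x)"
proof -
  have "computable_list (\<lambda>x. foldl (\<lambda>acc l. l # acc) (g x) (rev (f x)))"
    by (rule computable_list_foldl[OF _ assms(2) computable_list_rev[OF assms(1)]])
      (intro computable_list_Cons computable_basic computable_list_decode)
  then show ?thesis by (simp add: foldl_conv_fold fold_Cons_rev)
qed

lemmas computable_list_basic = computable_list_const computable_list_decode computable_list_Cons
  computable_list_rev computable_list_append

lemma computable_list_comp:
  assumes "computable_list f" "computable t" shows "computable_list (\<lambda>x. f (t x))"
  using assms computable_comp unfolding computable_list_def by blast

lemma computable_list_If:
  assumes "computable t" "computable_list f" "computable_list g"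
  shows "computable_list (\<lambda>x. if t x = 0 then f x else g x)"
  using computable_If[OF assms(1) assms(2,3)[unfolded computable_list_def]]
  by (simp add: computable_list_def if_distrib)

text \<open>The default 0 is also the code of the empty list.\<close>

definition nth0 :: "nat list \<Rightarrow> nat \<Rightarrow> nat"
  where "nth0 xs i = (if i < length xs then xs ! i else 0)"

lemma computable_nth0:
  assumes "computable_list f" "computable t" shows "computable (\<lambda>x. nth0 (f x) (t x))"
proof -
  define tl' where "tl' c = psnd (c - 1)" for c :: nat
  have z: "psnd 0 = 0" "pfst 0 = 0"
    by (simp_all add: psnd_def pfst_def prod_decode_def prod_decode_aux.simps)
  have tl': "tl' (list_encode xs) = list_encode (tl xs)" for xs
    by (cases xs) (auto simp: tl'_def z pair_def[symmetric])
  have "rec_nat (list_encode xs) (\<lambda>i acc. tl' acc) n = list_encode (drop n xs)" for xs n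
    by (induction n) (auto simp: tl' drop_Suc tl_drop)
  moreover have "pfst (list_encode (drop n xs) - 1) = nth0 xs n" for xs n
  proof (cases "n < length xs")
    case True
    then have "drop n xs = xs ! n # drop (Suc n) xs" by (simp add: Cons_nth_drop_Suc)
    then show ?thesis using True by (simp add: nth0_def pair_def[symmetric])
  qed (simp add: nth0_def z)
  moreover have "computable (\<lambda>x. pfst (rec_nat (list_encode (f x)) (\<lambda>i acc. tl' acc) (t x) - 1))"
    using assms(1) unfolding computable_list_def
    by (intro computable_basic computable_rec_nat assms)
      (auto simp only: computable3_def tl'_def intro!: computable_basic)
  ultimately show ?thesis by simp
qed

section \<open>Semidecidable predicates\<close>

text \<open>
  Semidecidable predicates in normal form: a total computable function checks certificates, and
  accepts with the value 0.
\<close>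

definition sigma :: "(nat \<Rightarrow> bool) \<Rightarrow> bool"
  where "sigma P \<longleftrightarrow> (\<exists>f. computable2 f \<and> (\<forall>x. P x \<longleftrightarrow> (\<exists>c. f c x = 0)))"

lemma sigma_comp: assumes "sigma P" "computable t" shows "sigma (\<lambda>x. P (t x))"
proof -
  obtain f where f: "computable2 f" "\<forall>x. P x \<longleftrightarrow> (\<exists>c. f c x = 0)"
    using assms(1) unfolding sigma_def by blast
  then show ?thesis unfolding sigma_def
    by (intro exI[of _ "\<lambda>c x. f c (t x)"])
      (auto simp only: computable2_def intro!: computable2_comp[OF f(1)] computable_comp[OF assms(2)] computable_basic)
qed

lemma sigma_zero: assumes "computable f" shows "sigma (\<lambda>x. f x = 0)"
  unfolding sigma_def
  by (intro exI[of _ "\<lambda>c x. f x"])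
    (auto simp: computable2_def intro!: computable_comp[OF assms] computable_basic)

lemma sigma_eq: assumes "computable f" "computable g" shows "sigma (\<lambda>x. f x = g x)"
proof -
  have "(f x = g x) \<longleftrightarrow> (f x - g x) + (g x - f x) = 0" for x by auto
  then show ?thesis
    by (simp only:) (intro sigma_zero computable_basic assms)
qed

lemma sigma_less: assumes "computable f" "computable g" shows "sigma (\<lambda>x. f x < g x)"
proof -
  have "(f x < g x) \<longleftrightarrow> Suc (f x) - g x = 0" for x by auto
  then show ?thesis
    by (simp only:) (intro sigma_zero computable_basic assms)
qed

lemma sigma_list_eq:
  assumes "computable_list f" "computable_list g" shows "sigma (\<lambda>x. f x = g x)"
proof -
  have "(f x = g x) \<longleftrightarrow> list_encode (f x) = list_encode (g x)" for x by (simp add: list_encode_eq)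
  then show ?thesis using assms sigma_eq by (simp add: computable_list_def)
qed

lemma sigma_conj: assumes "sigma P" "sigma Q" shows "sigma (\<lambda>x. P x \<and> Q x)"
proof -
  obtain f g where f: "computable2 f" "\<forall>x. P x \<longleftrightarrow> (\<exists>c. f c x = 0)"
    and g: "computable2 g" "\<forall>x. Q x \<longleftrightarrow> (\<exists>c. g c x = 0)"
    using assms unfolding sigma_def by blast
  have "P x \<and> Q x \<longleftrightarrow> (\<exists>c. f (pfst c) x + g (psnd c) x = 0)" for x
    using f(2) g(2) ex_pair[of "\<lambda>c d. f c x + g d x = 0"] by simp
  moreover have "computable2 (\<lambda>c x. f (pfst c) x + g (psnd c) x)"
    unfolding computable2_def
    by (intro computable2_comp[OF f(1)] computable2_comp[OF g(1)] computable_basic)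
  ultimately show ?thesis unfolding sigma_def by blast
qed

text \<open>The product accepts a certificate that either factor accepts.\<close>

lemma sigma_disj: assumes "sigma P" "sigma Q" shows "sigma (\<lambda>x. P x \<or> Q x)"
proof -
  obtain f g where f: "computable2 f" "\<forall>x. P x \<longleftrightarrow> (\<exists>c. f c x = 0)"
    and g: "computable2 g" "\<forall>x. Q x \<longleftrightarrow> (\<exists>c. g c x = 0)"
    using assms unfolding sigma_def by blast
  have "P x \<or> Q x \<longleftrightarrow> (\<exists>c. f c x * g c x = 0)" for x
    using f(2) g(2) by auto
  moreover have "computable2 (\<lambda>c x. f c x * g c x)"
    unfolding computable2_def
    by (intro computable2_comp[OF f(1)] computable2_comp[OF g(1)] computable_basic)
  ultimately show ?thesis unfolding sigma_def by blast
qed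

lemma sigma_const: "sigma (\<lambda>x. b)"
proof -
  have "sigma (\<lambda>x. (if b then 0 else 1) = (0::nat))" by (intro sigma_eq computable_const)
  then show ?thesis by (simp split: if_splits)
qed

lemma sigma_ex:
  assumes "sigma (\<lambda>z. P (pfst z) (psnd z))" shows "sigma (\<lambda>x. \<exists>y. P y x)"
proof -
  obtain f where f: "computable2 f" "\<forall>z. P (pfst z) (psnd z) \<longleftrightarrow> (\<exists>c. f c z = 0)"
    using assms unfolding sigma_def by blast
  have "P y x \<longleftrightarrow> (\<exists>c. f c (pair y x) = 0)" for y x
    using f(2)[rule_format, of "pair y x"] by simp
  then have "(\<exists>y. P y x) \<longleftrightarrow> (\<exists>c. f (pfst c) (pair (psnd c) x) = 0)" for x
    using ex_pair[of "\<lambda>c y. f c (pair y x) = 0"] by (simp only:) blast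
  moreover have "computable2 (\<lambda>c x. f (pfst c) (pair (psnd c) x))"
    unfolding computable2_def by (intro computable2_comp[OF f(1)] computable_basic)
  ultimately show ?thesis unfolding sigma_def by blast
qed

lemma sigma_ex_list:
  assumes "sigma (\<lambda>z. P (list_decode (pfst z)) (psnd z))" shows "sigma (\<lambda>x. \<exists>w. P w x)"
proof -
  have "(\<exists>w. P w x) \<longleftrightarrow> (\<exists>c. P (list_decode c) x)" for x 
    using list_encode_inverse[of w for w] by (auto intro: exI[of _ "list_encode _"])
  then show ?thesis using sigma_ex[of "\<lambda>c. P (list_decode c)"] assms by simp
qed

text \<open>
  The certificates of the finitely many instances are put into one list, and the sum of the checks
  vanishes if and only if all of them accept.
\<close>

lemma sigma_all_less:
  assumes P: "sigma (\<lambda>z. P (pfst z) (psnd z))" and t: "computable t"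
  shows "sigma (\<lambda>x. \<forall>i<t x. P i x)"
proof -
  obtain f where f: "computable2 f" "\<forall>z. P (pfst z) (psnd z) \<longleftrightarrow> (\<exists>c. f c z = 0)"
    using P unfolding sigma_def by blast
  have f': "P i x \<longleftrightarrow> (\<exists>c. f c (pair i x) = 0)" for i x
    using f(2)[rule_format, of "pair i x"] by simp
  have "(\<forall>i<t x. P i x) \<longleftrightarrow> (\<exists>p. (\<Sum>i<t x. f (nth0 (list_decode p) i) (pair i x)) = 0)" for x
  proof
    assume "\<forall>i<t x. P i x"
    then have "\<forall>i. \<exists>c. i < t x \<longrightarrow> f c (pair i x) = 0" using f' by blast
    then obtain c where c: "\<forall>i. i < t x \<longrightarrow> f (c i) (pair i x) = 0" by (rule choice[THEN exE])
    show "\<exists>p. (\<Sum>i<t x. f (nth0 (list_decode p) i) (pair i x)) = 0"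
      by (rule exI[of _ "list_encode (map c [0..<t x])"]) (use c in \<open>auto simp: nth0_def\<close>)
  next
    assume "\<exists>p. (\<Sum>i<t x. f (nth0 (list_decode p) i) (pair i x)) = 0"
    then show "\<forall>i<t x. P i x" using f' by auto
  qed
  moreover have "computable2 (\<lambda>p x. \<Sum>i<t x. f (nth0 (list_decode p) i) (pair i x))"
    unfolding computable2_def
  proof (rule computable_sum_less[where h = "\<lambda>i z. f (nth0 (list_decode (pfst z)) i) (pair i (psnd z))"])
    show "computable2 (\<lambda>i z. f (nth0 (list_decode (pfst z)) i) (pair i (psnd z)))"
      unfolding computable2_def
      by (intro computable2_comp[OF f(1)] computable_basic computable_nth0 computable_list_decode)
  qed (intro computable_comp[OF t] computable_basic)
  ultimately show ?thesis unfolding sigma_def by blast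
qed

lemma sigma_all_set:
  assumes "\<And>a. a \<in> set as \<Longrightarrow> sigma (\<lambda>x. P a x)" shows "sigma (\<lambda>x. \<forall>a\<in>set as. P a x)"
  using assms
proof (induction as)
  case (Cons a as)
  have "(\<lambda>x. \<forall>b\<in>set (a # as). P b x) = (\<lambda>x. P a x \<and> (\<forall>b\<in>set as. P b x))" by auto
  then show ?case using Cons by (simp add: sigma_conj)
qed (simp add: sigma_const)

lemma sigma_ex_set:
  assumes "\<And>a. a \<in> set as \<Longrightarrow> sigma (\<lambda>x. P a x)" shows "sigma (\<lambda>x. \<exists>a\<in>set as. P a x)"
  using assms
proof (induction as)
  case (Cons a as)
  have "(\<lambda>x. \<exists>b\<in>set (a # as). P b x) = (\<lambda>x. P a x \<or> (\<exists>b\<in>set as. P b x))" by auto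
  then show ?case using Cons by (simp add: sigma_disj)
qed (simp add: sigma_const)

lemma rtranclp_iff_path:
  "R\<^sup>*\<^sup>* a b \<longleftrightarrow> (\<exists>p n. p 0 = a \<and> p n = b \<and> (\<forall>i<n. R (p i) (p (Suc i))))"
proof
  assume "R\<^sup>*\<^sup>* a b"
  then show "\<exists>p n. p 0 = a \<and> p n = b \<and> (\<forall>i<n. R (p i) (p (Suc i)))"
  proof (induction rule: rtranclp_induct)
    case base
    then show ?case by (intro exI[of _ "\<lambda>_. a"] exI[of _ 0]) auto
  next
    case (step y z)
    then obtain p n where "p 0 = a" "p n = y" "\<forall>i<n. R (p i) (p (Suc i))" by auto
    with step show ?case
      by (intro exI[of _ "p(Suc n := z)"] exI[of _ "Suc n"]) (auto simp: less_Suc_eq)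
  qed
next
  assume "\<exists>p n. p 0 = a \<and> p n = b \<and> (\<forall>i<n. R (p i) (p (Suc i)))"
  then obtain p n where p: "p 0 = a" "p n = b" "\<forall>i<n. R (p i) (p (Suc i))" by auto
  have "m \<le> n \<Longrightarrow> R\<^sup>*\<^sup>* a (p m)" for m
    by (induction m) (use p in \<open>auto intro: rtranclp.rtrancl_into_rtrancl\<close>)
  with p show "R\<^sup>*\<^sup>* a b" by auto
qed

text \<open>The certificate is the list of the intermediate results of a derivation.\<close>

lemma sigma_rtranclp:
  assumes R: "sigma (\<lambda>z. R (pfst z) (psnd z))" and a: "computable a" and b: "computable b"
  shows "sigma (\<lambda>x. R\<^sup>*\<^sup>* (a x) (b x))"
proof -
  have "R\<^sup>*\<^sup>* u v \<longleftrightarrow> (\<exists>w n. nth0 w 0 = u \<and> nth0 w n = v \<and> (\<forall>i<n. R (nth0 w i) (nth0 w (Suc i))))"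
    (is "_ \<longleftrightarrow> ?Q u v") for u v
  proof
    assume "R\<^sup>*\<^sup>* u v"
    then obtain p n where p: "p 0 = u" "p n = v" "\<forall>i<n. R (p i) (p (Suc i))"
      unfolding rtranclp_iff_path by auto
    then show "?Q u v"
      by (intro exI[of _ "map p [0..<Suc n]"] exI[of _ n]) (simp add: nth0_def del: upt_Suc)
  next
    assume "?Q u v"
    then obtain w n where "nth0 w 0 = u \<and> nth0 w n = v \<and> (\<forall>i<n. R (nth0 w i) (nth0 w (Suc i)))"
      by (elim exE)
    then show "R\<^sup>*\<^sup>* u v" unfolding rtranclp_iff_path by (intro exI[of _ "nth0 w"] exI[of _ n])
  qed
  moreover have "sigma (\<lambda>x. ?Q (a x) (b x))"
  proof -
    have R': "sigma (\<lambda>z. R (s z) (t z))" if "computable s" "computable t" for s t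
      using sigma_comp[OF R computable_pair[OF that]] by simp
    show ?thesis
      by (rule sigma_ex_list, rule sigma_ex, rule sigma_conj, rule sigma_eq,
          (intro computable_basic computable_nth0 computable_list_decode computable_comp[OF a])+)
        (rule sigma_conj, rule sigma_eq,
          (intro computable_basic computable_nth0 computable_list_decode computable_comp[OF b])+,
         rule sigma_all_less, rule R',
          (intro computable_basic computable_nth0 computable_list_decode)+)
  qed
  ultimately show ?thesis by (simp only:)
qed

text \<open>
  Minimisation finds the least pair of an output and a certificate for it, and the output is
  projected from this pair.
\<close>

lemma recf_of_sigma_graph:
  assumes "sigma (\<lambda>z. P (pfst z) (psnd z))"
  shows "\<exists>alg. \<forall>x v. P v x \<longrightarrow> (\<forall>v'. P v' x \<longrightarrow> v' = v) \<longrightarrow> recf_eval alg [x] v"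
proof -
  obtain f where f: "computable2 f" "\<forall>z. P (pfst z) (psnd z) \<longleftrightarrow> (\<exists>c. f c z = 0)"
    using assms unfolding sigma_def by blast
  define g where "g c x = f (pfst c) (pair (psnd c) x)" for c x
  have "computable2 g"
    unfolding computable2_def g_def by (intro computable2_comp[OF f(1)] computable_basic)
  then have "total_rec 2 (\<lambda>xs. g (xs ! 0) (xs ! 1))"
    using total_rec_comp1[of "\<lambda>xs. g (pfst (xs ! 0)) (psnd (xs ! 0))" 2 "\<lambda>xs. pair (xs ! 0) (xs ! 1)"]
    by (simp add: computable2_def computable_total_rec total_rec_pair total_rec_proj)
  then obtain G where "\<forall>xs. length xs = 2 \<longrightarrow> recf_eval G xs (g (xs ! 0) (xs ! 1))"
    unfolding total_rec_def by blast
  from spec[OF this, of "[_, _]"] have G: "recf_eval G [c, x] (g c x)" for c x by simp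
  obtain S where S: "recf_eval S [x] (psnd x)" for x
    using computable_psnd[OF computable_id] unfolding computable_def by blast
  have "recf_eval (Comp S [Mu G]) [x] v" if v: "P v x" "\<forall>v'. P v' x \<longrightarrow> v' = v" for x v
  proof -
    define c where "c = (LEAST c. g c x = 0)"
    have "\<exists>c d. f c (pair d x) = 0" using f(2)[rule_format, of "pair v x"] v(1) by auto
    then have "\<exists>c. g c x = 0" unfolding g_def using ex_pair[of "\<lambda>c d. f c (pair d x) = 0"] by blast
    then have c: "g c x = 0" unfolding c_def by (rule LeastI_ex)
    then have "P (psnd c) x"
      using f(2)[rule_format, of "pair (psnd c) x"] unfolding g_def by auto
    then have "psnd c = v" using v by blast
    have "recf_eval (Mu G) [x] c"
    proof (rule recf_eval.Mu)
      show "recf_eval G [c, x] 0" using G[of c x] c by simp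
      show "\<forall>j<c. \<exists>y. recf_eval G [j, x] (Suc y)"
      proof (intro allI impI)
        fix j assume "j < c"
        then have "g j x \<noteq> 0" unfolding c_def by (rule not_less_Least)
        then show "\<exists>y. recf_eval G [j, x] (Suc y)" using G[of j x] by (metis not0_implies_Suc)
      qed
    qed
    then show ?thesis using S[of c] \<open>psnd c = v\<close> by (auto intro!: recf_eval.Comp)
  qed
  then show ?thesis by blast
qed

section \<open>Ranks of finitely generated abelian groups\<close>

text \<open>Gaussian elimination; multiplication by the pivot takes the place of division.\<close>

lemma integer_kernel_vector:
  fixes M :: "'j \<Rightarrow> 'i \<Rightarrow> int"
  assumes "finite I" "finite J" "card I < card J"
  shows "\<exists>e. (\<exists>j\<in>J. e j \<noteq> 0) \<and> (\<forall>i\<in>I. (\<Sum>j\<in>J. e j * M j i) = 0)"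
  using assms
proof (induction I arbitrary: J M rule: finite_induct)
  case empty
  then obtain j where "j \<in> J" by fastforce
  then show ?case by (intro exI[of _ "\<lambda>_. 1"]) auto
next
  case (insert i0 I)
  show ?case
  proof (cases "\<forall>j\<in>J. M j i0 = 0")
    case True
    from insert obtain e where "\<exists>j\<in>J. e j \<noteq> 0" "\<forall>i\<in>I. (\<Sum>j\<in>J. e j * M j i) = 0"
      by (metis card_insert_disjoint less_SucI not_less_eq)
    with True show ?thesis by (intro exI[of _ e]) auto
  next
    case False
    then obtain j0 where j0: "j0 \<in> J" "M j0 i0 \<noteq> 0" by blast
    define p where "p = M j0 i0"
    define J' where "J' = J - {j0}"
    have J': "finite J'" "J = insert j0 J'" "j0 \<notin> J'" "card I < card J'"
      using insert j0 by (auto simp: J'_def)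
    from insert.IH[OF J'(1,4), of "\<lambda>j i. p * M j i - M j i0 * M j0 i"] obtain e
      where e: "\<exists>j\<in>J'. e j \<noteq> 0"
        "\<forall>i\<in>I. (\<Sum>j\<in>J'. e j * (p * M j i - M j i0 * M j0 i)) = 0" by blast
    define s where "s = (\<Sum>j\<in>J'. e j * M j i0)"
    define e' where "e' j = (if j = j0 then - s else p * e j)" for j
    have sum: "(\<Sum>j\<in>J. e' j * M j i) = p * (\<Sum>j\<in>J'. e j * M j i) - s * M j0 i" for i
    proof -
      have "(\<Sum>j\<in>J. e' j * M j i) = - s * M j0 i + (\<Sum>j\<in>J'. e' j * M j i)"
        using J' by (simp add: e'_def)
      also have "(\<Sum>j\<in>J'. e' j * M j i) = (\<Sum>j\<in>J'. p * (e j * M j i))"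
        using J'(3) by (intro sum.cong) (auto simp: e'_def)
      finally show ?thesis by (simp add: sum_distrib_left)
    qed
    show ?thesis
    proof (intro exI[of _ e'] conjI ballI)
      show "\<exists>j\<in>J. e' j \<noteq> 0" using e(1) J' j0 by (auto simp: e'_def p_def)
      fix i assume i: "i \<in> insert i0 I"
      show "(\<Sum>j\<in>J. e' j * M j i) = 0"
      proof (cases "i = i0")
        case True
        then show ?thesis by (simp add: sum s_def p_def)
      next
        case False
        with i e(2) have "(\<Sum>j\<in>J'. e j * (p * M j i - M j i0 * M j0 i)) = 0" by blast
        then show ?thesis
          by (simp add: sum s_def sum_distrib_left sum_distrib_right sum_subtractf algebra_simps)
      qed
    qed
  qed
qed

context comm_group
begin

abbreviation monomial :: "('i \<Rightarrow> 'a) \<Rightarrow> ('i \<Rightarrow> int) \<Rightarrow> 'i set \<Rightarrow> 'a"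
  where "monomial x e J \<equiv> finprod G (\<lambda>j. x j [^] e j) J"

lemma monomial_closed: "x ` J \<subseteq> carrier G \<Longrightarrow> monomial x e J \<in> carrier G"
  by (intro finprod_closed) auto

lemma monomial_insert:
  "\<lbrakk>finite J; j \<notin> J; x ` insert j J \<subseteq> carrier G\<rbrakk> \<Longrightarrow>
    monomial x e (insert j J) = x j [^] e j \<otimes> monomial x e J"
  by (subst finprod_insert) auto

lemma monomial_add:
  assumes "finite J" "x ` J \<subseteq> carrier G"
  shows "monomial x (\<lambda>j. e j + f j) J = monomial x e J \<otimes> monomial x f J"
proof -
  have "monomial x (\<lambda>j. e j + f j) J = finprod G (\<lambda>j. x j [^] e j \<otimes> x j [^] f j) J"
    by (intro finprod_cong') (use assms in \<open>auto simp: int_pow_mult\<close>)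
  also have "\<dots> = monomial x e J \<otimes> monomial x f J"
    by (intro finprod_multf) (use assms in auto)
  finally show ?thesis .
qed

lemma monomial_scale:
  assumes "finite J" "x ` J \<subseteq> carrier G"
  shows "monomial x (\<lambda>j. e j * c) J = monomial x e J [^] (c :: int)"
  using assms
proof (induction J rule: finite_induct)
  case (insert j J)
  then show ?case
    by (simp add: monomial_insert int_pow_pow int_pow_distrib monomial_closed del: finprod_insert)
qed simp

lemma monomial_cong:
  assumes "x ` J \<subseteq> carrier G" "\<And>j. j \<in> J \<Longrightarrow> x j [^] e j = y j [^] f j" "y ` J \<subseteq> carrier G"
  shows "monomial x e J = monomial y f J"
  by (intro finprod_cong') (use assms in auto)

lemma monomial_single:
  assumes "finite J" "b \<in> J" "x ` J \<subseteq> carrier G"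
  shows "monomial x (\<lambda>j. if j = b then c else 0) J = x b [^] (c :: int)"
proof -
  have "monomial x (\<lambda>j. if j = b then c else 0) J = finprod G (\<lambda>j. if b = j then x j [^] c else \<one>) J"
    by (intro finprod_cong') (use assms in auto)
  also have "\<dots> = x b [^] c"
    by (subst finprod_singleton) (use assms in auto)
  finally show ?thesis .
qed

text \<open>Substitution of monomials multiplies the exponent vector by a matrix.\<close>

lemma monomial_substitute:
  assumes "finite J" "finite I" "b ` I \<subseteq> carrier G" "x ` J \<subseteq> carrier G"
    and "\<And>j. j \<in> J \<Longrightarrow> x j [^] n j = monomial b (m j) I"
  shows "monomial x (\<lambda>j. n j * e j) J = monomial b (\<lambda>i. \<Sum>j\<in>J. e j * m j i) I"
  using assms(1,4,5)
proof (induction J rule: finite_induct)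
  case empty
  then show ?case by simp
next
  case (insert j J)
  have "monomial x (\<lambda>j. n j * e j) (insert j J) = x j [^] (n j * e j) \<otimes> monomial x (\<lambda>j. n j * e j) J"
    using insert by (intro monomial_insert) auto
  also have "x j [^] (n j * e j) = (x j [^] n j) [^] e j"
    using insert.prems(1) by (simp add: int_pow_pow)
  also have "\<dots> = monomial b (\<lambda>i. m j i * e j) I"
    unfolding insert.prems(2)[OF insertI1] by (rule monomial_scale[symmetric]) (use assms in auto)
  also have "monomial x (\<lambda>j. n j * e j) J = monomial b (\<lambda>i. \<Sum>j\<in>J. e j * m j i) I"
    using insert by auto
  also have "monomial b (\<lambda>i. m j i * e j) I \<otimes> \<dots> =
      monomial b (\<lambda>i. m j i * e j + (\<Sum>j\<in>J. e j * m j i)) I"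
    using assms by (simp add: monomial_add)
  finally show ?case using insert by (simp add: mult.commute)
qed

text \<open>
  The preimage of the rational span of \<open>B\<close> under the map that kills torsion.
\<close>

definition tors_span :: "'a set \<Rightarrow> 'a set"
  where "tors_span B = {a \<in> carrier G. \<exists>n>0. \<exists>m. a [^] (n :: int) = monomial (\<lambda>b. b) m B}"

lemma tors_spanI:
  "\<lbrakk>a \<in> carrier G; n > 0; a [^] (n :: int) = monomial (\<lambda>b. b) m B\<rbrakk> \<Longrightarrow> a \<in> tors_span B"
  unfolding tors_span_def by (intro CollectI conjI exI)

text \<open>
  Powers of the \<open>x j\<close> have exponent vectors over \<open>B\<close>, and an integral
  relation between these vectors gives a relation between the \<open>x j\<close>.
\<close>

lemma dependent_if_card_less:
  assumes "finite B" "B \<subseteq> carrier G" "finite J" "card B < card J" "x ` J \<subseteq> tors_span B"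
  shows "\<exists>e. (\<exists>j\<in>J. e j \<noteq> 0) \<and> monomial x e J = \<one>"
proof -
  have "\<forall>j\<in>J. \<exists>n m. n > 0 \<and> x j [^] (n :: int) = monomial (\<lambda>b. b) m B"
    using assms(5) unfolding tors_span_def by blast
  from bchoice[OF this] obtain n where
    "\<forall>j\<in>J. \<exists>m. n j > 0 \<and> x j [^] (n j :: int) = monomial (\<lambda>b. b) m B" by blast
  from bchoice[OF this] obtain m where
    nm: "\<forall>j\<in>J. n j > (0::int) \<and> x j [^] n j = monomial (\<lambda>b. b) (m j) B" by blast
  obtain e where e: "\<exists>j\<in>J. e j \<noteq> 0" "\<forall>i\<in>B. (\<Sum>j\<in>J. e j * m j i) = 0"
    using integer_kernel_vector[OF assms(1,3,4), of m] by blast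
  have "monomial x (\<lambda>j. n j * e j) J = monomial (\<lambda>b. b) (\<lambda>i. \<Sum>j\<in>J. e j * m j i) B"
    by (rule monomial_substitute) (use assms nm in \<open>auto simp: tors_span_def\<close>)
  also have "\<dots> = \<one>"
    using e(2) by (intro finprod_one_eqI) auto
  finally have "monomial x (\<lambda>j. n j * e j) J = \<one>" .
  moreover obtain j where "j \<in> J" "e j \<noteq> 0" using e(1) by blast
  moreover have "n j > 0" using nm \<open>j \<in> J\<close> by blast
  ultimately show ?thesis
    by (intro exI[of _ "\<lambda>j. n j * e j"] conjI bexI[of _ j]) simp_all
qed

definition indep :: "('i \<Rightarrow> 'a) \<Rightarrow> 'i set \<Rightarrow> bool"
  where "indep x J \<longleftrightarrow> (\<forall>e. monomial x e J = \<one> \<longrightarrow> (\<forall>j\<in>J. e j = 0))"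

lemma indepD: "\<lbrakk>indep x J; monomial x e J = \<one>; j \<in> J\<rbrakk> \<Longrightarrow> e j = 0"
  unfolding indep_def by blast

text \<open>
  The relation is solved for \<open>x j0\<close>; if its exponent is negative, the relation is
  inverted first.
\<close>

lemma tors_span_relation:
  assumes J: "finite J" "x ` J \<subseteq> carrier G" "j0 \<in> J" and e: "monomial x e J = \<one>" "e j0 \<noteq> 0"
  shows "\<exists>n>0. \<exists>m. x j0 [^] (n :: int) = monomial x m (J - {j0})"
proof -
  have rel: "x j0 [^] f j0 = monomial x (\<lambda>j. - f j) (J - {j0})"
    if "monomial x f J = \<one>" for f
  proof -
    have c: "monomial x f (J - {j0}) \<in> carrier G" "x j0 \<in> carrier G"
      using J by (auto intro!: monomial_closed)
    have "monomial x f (insert j0 (J - {j0})) = x j0 [^] f j0 \<otimes> monomial x f (J - {j0})"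
      using J by (intro monomial_insert) auto
    then have "x j0 [^] f j0 \<otimes> monomial x f (J - {j0}) = \<one>"
      using that J(3) by (simp add: insert_absorb)
    then have "x j0 [^] f j0 = inv (monomial x f (J - {j0}))"
      using c by (metis int_pow_closed inv_equality inv_inv inv_closed)
    also have "\<dots> = monomial x f (J - {j0}) [^] (-1 :: int)"
      using c by (simp add: int_pow_neg)
    also have "\<dots> = monomial x (\<lambda>j. f j * -1) (J - {j0})"
      using J by (subst monomial_scale) auto
    finally show ?thesis by simp
  qed
  show ?thesis
  proof (cases "e j0 > 0")
    case True
    then show ?thesis using rel[OF e(1)] by (intro exI[of _ "e j0"] conjI exI)
  next
    case False
    have "monomial x (\<lambda>j. e j * -1) J = \<one>"
      using J e(1) by (subst monomial_scale) auto
    from rel[OF this] have "x j0 [^] (- e j0) = monomial x e (J - {j0})" by simp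
    with False e(2) show ?thesis by (intro exI[of _ "- e j0"] conjI exI) auto
  qed
qed

lemma tors_span_generate:
  assumes B: "finite B" "B \<subseteq> carrier G" and S: "S \<subseteq> tors_span B"
  shows "generate G S \<subseteq> tors_span B"
proof
  fix a assume "a \<in> generate G S"
  then show "a \<in> tors_span B"
  proof induction
    case one
    then show ?case by (intro tors_spanI[of _ 1 "\<lambda>_. 0"]) auto
  next
    case (incl h)
    with S show ?case by blast
  next
    case (inv h)
    with S obtain n m where nm: "h \<in> carrier G" "n > 0" "h [^] (n::int) = monomial (\<lambda>b. b) m B"
      unfolding tors_span_def by blast
    have "inv h [^] n = (h [^] n) [^] (-1::int)"
      using nm(1) by (simp add: int_pow_inv int_pow_neg)
    also have "\<dots> = monomial (\<lambda>b. b) (\<lambda>b. m b * -1) B"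
      unfolding nm(3) using B by (subst monomial_scale) auto
    finally show ?case by (intro tors_spanI[of _ n]) (use nm in auto)
  next
    case (eng h1 h2)
    then obtain n1 m1 n2 m2 where
      1: "h1 \<in> carrier G" "n1 > 0" "h1 [^] (n1::int) = monomial (\<lambda>b. b) m1 B" and
      2: "h2 \<in> carrier G" "n2 > 0" "h2 [^] (n2::int) = monomial (\<lambda>b. b) m2 B"
      unfolding tors_span_def by blast
    have "(h1 \<otimes> h2) [^] (n1 * n2) = (h1 [^] n1) [^] n2 \<otimes> (h2 [^] n2) [^] n1"
      using 1(1) 2(1) by (simp add: int_pow_distrib int_pow_pow mult.commute)
    also have "\<dots> = monomial (\<lambda>b. b) (\<lambda>b. m1 b * n2 + m2 b * n1) B"
      unfolding 1 2 using B by (simp add: monomial_add monomial_scale)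
    finally show ?case by (intro tors_spanI[of _ "n1 * n2"]) (use 1 2 in auto)
  qed
qed

text \<open>
  A maximal independent subset of the generators works: in a relation that involves one more
  generator \<open>y\<close>, the exponent of \<open>y\<close> is nonzero by independence, and so
  \<open>y\<close> is in the torsion span.
\<close>

lemma maximal_independent_set:
  assumes S: "finite S" "generate G S = carrier G"
  obtains B where "finite B" "B \<subseteq> carrier G" "indep (\<lambda>b. b) B" "tors_span B = carrier G"
proof -
  have "S \<subseteq> generate G S" by (auto intro: generate.incl)
  then have Sc: "S \<subseteq> carrier G" by (simp add: S(2))
  let ?P = "\<lambda>B. B \<subseteq> S \<and> indep (\<lambda>b. b) B"
  have "?P {}" by (simp add: indep_def)
  moreover have "\<And>B. ?P B \<Longrightarrow> card B < Suc (card S)"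
    using S(1) by (meson card_mono le_imp_less_Suc)
  ultimately obtain B where B: "?P B" and max: "\<And>B'. ?P B' \<Longrightarrow> card B' \<le> card B"
    using ex_has_greatest_nat[of ?P "{}" card "Suc (card S)"] by auto
  have fB: "finite B" "B \<subseteq> carrier G" using B S Sc finite_subset by auto
  have "y \<in> tors_span B" if y: "y \<in> S" for y
  proof (cases "y \<in> B")
    case True
    then have "y [^] (1::int) = monomial (\<lambda>b. b) (\<lambda>j. if j = y then 1 else 0) B"
      using fB by (subst monomial_single) auto
    then show ?thesis using y Sc by (intro tors_spanI[of _ 1]) auto
  next
    case False
    then have "\<not> ?P (insert y B)"
      using max[of "insert y B"] fB by auto
    then obtain e where e: "monomial (\<lambda>b. b) e (insert y B) = \<one>" "\<exists>j\<in>insert y B. e j \<noteq> 0"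
      using y B unfolding indep_def by auto
    have c: "insert y B \<subseteq> carrier G" using y Sc fB by auto
    have "e y \<noteq> 0"
    proof
      assume "e y = 0"
      then have "monomial (\<lambda>b. b) e B = \<one>"
        using e(1) monomial_insert[of B y "\<lambda>b. b" e] fB False c monomial_closed[of "\<lambda>b. b" B e]
        by (auto simp del: finprod_insert)
      then have "\<forall>j\<in>B. e j = 0" using B unfolding indep_def by blast
      with e(2) \<open>e y = 0\<close> show False by blast
    qed
    then obtain n m where "n > 0" "y [^] (n::int) = monomial (\<lambda>b. b) m (insert y B - {y})"
      using tors_span_relation[of "insert y B" "\<lambda>b. b" y e] e(1) fB c by auto
    moreover have "insert y B - {y} = B" using False by auto
    ultimately show ?thesis using c by (intro tors_spanI[of _ n m]) auto
  qed
  then have "carrier G \<subseteq> tors_span B"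
    using tors_span_generate[OF fB, of S] S(2) by blast
  then have "tors_span B = carrier G" unfolding tors_span_def by blast
  with that B fB show ?thesis by blast
qed

text \<open>
  In the possibly noncommutative group \<open>M\<close> the factors are multiplied in some order,
  which the images in \<open>G\<close> do not see.
\<close>

lemma monomial_lift:
  assumes M: "group M" and h: "q \<in> hom M G" "p \<in> hom M G" and J: "finite J" "x ` J \<subseteq> carrier M"
  shows "\<exists>u\<in>carrier M. q u = monomial (\<lambda>j. q (x j)) e J \<and> p u = monomial (\<lambda>j. p (x j)) e J"
  using J
proof (induction J rule: finite_induct)
  interpret M: group M by fact
  interpret q: group_hom M G q using h(1) by unfold_locales
  interpret p: group_hom M G p using h(2) by unfold_locales
  {
    case empty
    show ?case by (intro bexI[of _ "\<one>\<^bsub>M\<^esub>"]) auto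
  next
    case (insert j J)
    then obtain u where u: "u \<in> carrier M" "q u = monomial (\<lambda>j. q (x j)) e J"
      "p u = monomial (\<lambda>j. p (x j)) e J" by auto
    have "monomial (\<lambda>j. q (x j)) e (insert j J) = q (x j) [^] e j \<otimes> monomial (\<lambda>j. q (x j)) e J"
      "monomial (\<lambda>j. p (x j)) e (insert j J) = p (x j) [^] e j \<otimes> monomial (\<lambda>j. p (x j)) e J"
      using insert by (intro monomial_insert; force)+
    with u insert show ?case
      by (intro bexI[of _ "x j [^]\<^bsub>M\<^esub> e j \<otimes>\<^bsub>M\<^esub> u"]) (auto simp: q.hom_int_pow p.hom_int_pow simp del: finprod_insert)
  }
qed

text \<open>
  With \<open>G\<close> as the quotient of \<open>M\<close> by the kernel of \<open>q\<close>, the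
  map \<open>p\<close> is an endomorphism of \<open>G\<close> that is read off from representatives.
  Both parts compare ranks by means of a maximal independent set \<open>B\<close>.  If the cokernel
  is torsion, then powers of the elements of \<open>B\<close> have preimages under \<open>p\<close>;
  their images under \<open>q\<close> and that of a kernel element outnumber the rank, so they
  satisfy a relation, and applying \<open>p\<close> shows that only the kernel element occurs in it.
  If the kernel is torsion, then the images of \<open>B\<close> under \<open>p\<close> are
  independent, so together with any \<open>a\<close> they satisfy a relation in which
  \<open>a\<close> occurs.
\<close>

lemma
  assumes M: "group M" and h: "q \<in> hom M G" "p \<in> hom M G" and onto: "q ` carrier M = carrier G"
    and ker: "\<And>x. \<lbrakk>x \<in> carrier M; q x = \<one>\<rbrakk> \<Longrightarrow> p x = \<one>"
    and S: "finite S" "generate G S = carrier G"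
  shows kernel_torsion_if_cokernel_torsion:
    "\<lbrakk>\<And>a. a \<in> carrier G \<Longrightarrow> \<exists>n>0. \<exists>x\<in>carrier M. a [^] (n::int) = p x; v \<in> carrier M; p v = \<one>\<rbrakk>
      \<Longrightarrow> \<exists>n>0. q v [^] (n::int) = \<one>"
  and cokernel_torsion_if_kernel_torsion:
    "\<lbrakk>\<And>x. \<lbrakk>x \<in> carrier M; p x = \<one>\<rbrakk> \<Longrightarrow> \<exists>n>0. q x [^] (n::int) = \<one>; a \<in> carrier G\<rbrakk>
      \<Longrightarrow> \<exists>n>0. \<exists>x\<in>carrier M. a [^] (n::int) = p x"
proof -
  interpret M: group M by fact
  interpret q: group_hom M G q using h(1) by unfold_locales
  interpret p: group_hom M G p using h(2) by unfold_locales
  obtain B where B: "finite B" "B \<subseteq> carrier G" "indep (\<lambda>b. b) B" "tors_span B = carrier G"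
    by (rule maximal_independent_set[OF S])
  \<comment> \<open>The index \<open>None\<close> stands for the element that exceeds the rank.\<close>
  let ?J = "insert None (Some ` B)"
  have J: "finite ?J" "card B < card ?J" "None \<notin> Some ` B"
    using B(1) by (auto simp: card_image)
  have dep: "\<exists>e. (\<exists>j\<in>?J. e j \<noteq> 0) \<and> monomial x e ?J = \<one>" if "x ` ?J \<subseteq> carrier G" for x
    by (rule dependent_if_card_less[OF B(1,2) J(1,2)]) (use that B(4) in simp)
  {
    assume cok: "\<And>a. a \<in> carrier G \<Longrightarrow> \<exists>n>0. \<exists>x\<in>carrier M. a [^] (n::int) = p x"
      and v: "v \<in> carrier M" "p v = \<one>"
    have "\<forall>b\<in>B. \<exists>n x. n > 0 \<and> x \<in> carrier M \<and> b [^] (n::int) = p x"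
      using cok B(2) by blast
    from bchoice[OF this] obtain n where "\<forall>b\<in>B. \<exists>x. n b > 0 \<and> x \<in> carrier M \<and> b [^] (n b::int) = p x"
      by blast
    from bchoice[OF this] obtain x where
      nx: "\<forall>b\<in>B. n b > (0::int) \<and> x b \<in> carrier M \<and> b [^] n b = p (x b)"
      by blast
    define y where "y j = (case j of None \<Rightarrow> v | Some b \<Rightarrow> x b)" for j
    have y: "y ` ?J \<subseteq> carrier M" using nx v by (auto simp: y_def)
    have qy: "(\<lambda>j. q (y j)) ` ?J \<subseteq> carrier G" and py: "(\<lambda>j. p (y j)) ` ?J \<subseteq> carrier G"
      using y by (auto simp: image_subset_iff)
    obtain e where e: "\<exists>j\<in>?J. e j \<noteq> 0" "monomial (\<lambda>j. q (y j)) e ?J = \<one>"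
      using dep[OF qy] by blast
    obtain u where u: "u \<in> carrier M" "q u = monomial (\<lambda>j. q (y j)) e ?J"
        "p u = monomial (\<lambda>j. p (y j)) e ?J"
      using monomial_lift[OF M h J(1) y] by blast
    have "\<one> = monomial (\<lambda>j. p (y j)) e ?J" using u e(2) ker by simp
    also have "\<dots> = p (y None) [^] e None \<otimes> monomial (\<lambda>j. p (y j)) e (Some ` B)"
      using J py by (intro monomial_insert) auto
    also have "\<dots> = monomial (\<lambda>j. p (y j)) e (Some ` B)"
      using v py monomial_closed[of "\<lambda>j. p (y j)" "Some ` B" e] by (simp add: y_def)
    also have "\<dots> = monomial (\<lambda>b. p (x b)) (\<lambda>b. e (Some b)) B"
      using nx by (subst finprod_reindex) (auto simp: y_def)
    also have "\<dots> = monomial (\<lambda>b. b) (\<lambda>b. n b * e (Some b)) B"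
      using nx B(2) by (intro monomial_cong) (auto simp: int_pow_pow[symmetric])
    finally have "monomial (\<lambda>b. b) (\<lambda>b. n b * e (Some b)) B = \<one>" by (rule sym)
    from indepD[OF B(3) this] have z: "\<forall>j\<in>Some ` B. e j = 0" using nx by fastforce
    with e(1) have "e None \<noteq> 0" by blast
    then obtain t m where t: "t > 0" "q (y None) [^] (t::int) = monomial (\<lambda>j. q (y j)) m (?J - {None})"
      using tors_span_relation[OF J(1) qy insertI1 e(2)] by blast
    have "monomial (\<lambda>j. q (y j)) e ?J = q (y None) [^] e None \<otimes> monomial (\<lambda>j. q (y j)) e (Some ` B)"
      using J qy by (intro monomial_insert) auto
    also have "monomial (\<lambda>j. q (y j)) e (Some ` B) = \<one>"
      using z by (intro finprod_one_eqI) auto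
    finally have "q v [^] e None = \<one>" using e(2) v by (simp add: y_def)
    then have "q v [^] \<bar>e None\<bar> = \<one>" using v by (auto simp: abs_if int_pow_neg)
    with \<open>e None \<noteq> 0\<close> show "\<exists>n>0. q v [^] (n::int) = \<one>"
      by (intro exI[of _ "\<bar>e None\<bar>"]) auto
  }
  {
    assume kt: "\<And>x. \<lbrakk>x \<in> carrier M; p x = \<one>\<rbrakk> \<Longrightarrow> \<exists>n>0. q x [^] (n::int) = \<one>"
      and a: "a \<in> carrier G"
    have "\<forall>b\<in>B. \<exists>x. x \<in> carrier M \<and> q x = b"
      using B(2) by (auto simp flip: onto)
    from bchoice[OF this] obtain x where x: "\<forall>b\<in>B. x b \<in> carrier M \<and> q (x b) = b"
      by (rule exE)
    define y where "y j = (case j of None \<Rightarrow> a | Some b \<Rightarrow> p (x b))" for j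
    have y: "y ` ?J \<subseteq> carrier G" using x a by (auto simp: y_def)
    obtain e where e: "\<exists>j\<in>?J. e j \<noteq> 0" "monomial y e ?J = \<one>"
      using dep[OF y] by blast
    have xB: "x ` B \<subseteq> carrier M" using x by auto
    have img: "\<exists>u\<in>carrier M. q u = monomial (\<lambda>b. b) f B \<and> p u = monomial (\<lambda>b. p (x b)) f B" for f
    proof -
      have "monomial (\<lambda>b. q (x b)) f B = monomial (\<lambda>b. b) f B"
        using x B(2) by (intro monomial_cong) auto
      then show ?thesis using monomial_lift[OF M h B(1) xB, of f] by simp
    qed
    have Sm: "monomial y f (Some ` B) = monomial (\<lambda>b. p (x b)) (\<lambda>b. f (Some b)) B" for f
      using x by (subst finprod_reindex) (auto simp: y_def)
    have "e None \<noteq> 0"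
    proof
      assume e0: "e None = 0"
      have "monomial y e ?J = y None [^] e None \<otimes> monomial y e (Some ` B)"
        using J y by (intro monomial_insert) auto
      then have "monomial y e (Some ` B) = \<one>"
        using e(2) e0 y monomial_closed[of y "Some ` B" e] by (simp del: finprod_insert)
      then obtain u where u: "u \<in> carrier M" "q u = monomial (\<lambda>b. b) (\<lambda>b. e (Some b)) B" "p u = \<one>"
        using img[of "\<lambda>b. e (Some b)"] by (auto simp: Sm)
      from kt[OF u(1,3)] obtain t where t: "t > 0" "q u [^] (t::int) = \<one>" by blast
      have "monomial (\<lambda>b. b) (\<lambda>b. e (Some b) * t) B = \<one>"
        using t u B by (subst monomial_scale) auto
      from indepD[OF B(3) this] t have "\<forall>j\<in>Some ` B. e j = 0" by auto
      with e0 e(1) show False by blast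
    qed
    then obtain t m where t: "t > 0" "y None [^] (t::int) = monomial y m (?J - {None})"
      using tors_span_relation[OF J(1) y insertI1 e(2)] by blast
    moreover have "?J - {None} = Some ` B" by auto
    ultimately have "a [^] t = monomial (\<lambda>b. p (x b)) (\<lambda>b. m (Some b)) B"
      by (simp add: Sm) (simp add: y_def)
    moreover obtain u where "u \<in> carrier M" "p u = monomial (\<lambda>b. p (x b)) (\<lambda>b. m (Some b)) B"
      using img[of "\<lambda>b. m (Some b)"] by blast
    ultimately show "\<exists>n>0. \<exists>x\<in>carrier M. a [^] (n::int) = p x"
      using t(1) by (intro exI[of _ t] conjI bexI[of _ u]) simp_all
  }
qed

end

section \<open>Central series with finitely generated terms\<close>

text \<open>
  The operations of a quotient group stay folded, so that group laws and homomorphism laws apply to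
  them.
\<close>

declare mult_FactGroup [simp del] one_FactGroup [simp del]

context group
begin

lemma cancel_left: "\<lbrakk>x \<in> carrier G; y \<in> carrier G\<rbrakk> \<Longrightarrow> x \<otimes> (inv x \<otimes> y) = y"
  and cancel_left': "\<lbrakk>x \<in> carrier G; y \<in> carrier G\<rbrakk> \<Longrightarrow> inv x \<otimes> (x \<otimes> y) = y"
  by (simp_all flip: m_assoc)

lemmas group_norm = m_assoc inv_mult_group cancel_left cancel_left'

lemma ex_nat_pow:
  assumes "\<exists>n>0. P (x [^] (n :: int))" shows "\<exists>n>0. P (x [^] (n :: nat))"
proof -
  obtain n where "n > 0" "P (x [^] (n :: int))" using assms by blast
  then show ?thesis by (intro exI[of _ "nat n"]) (simp flip: int_pow_int)
qed

text \<open>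
  Powers of \<open>y\<close> can be collected on the left, because they normalise the subgroup
  generated by \<open>K\<close>.
\<close>

lemma generate_insert_normalized:
  assumes K: "K \<subseteq> carrier G" and y: "y \<in> carrier G"
    and norm: "\<And>n h. h \<in> generate G K \<Longrightarrow> inv (y [^] (n::int)) \<otimes> h \<otimes> y [^] n \<in> generate G K"
    and a: "a \<in> generate G (insert y K)"
  shows "\<exists>n. \<exists>h\<in>generate G K. a = y [^] (n::int) \<otimes> h"
  using a
proof induction
  have gc: "h \<in> carrier G" if "h \<in> generate G K" for h using generate_in_carrier[OF K that] .
  have sg: "subgroup (generate G K) G" by (rule generate_is_subgroup[OF K])
  {
    case one
    show ?case using sg by (intro exI[of _ 0] bexI[of _ \<one>]) (auto intro: subgroup.one_closed)
  next
    case (incl h)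
    show ?case
    proof (cases "h = y")
      case True
      then show ?thesis using sg y by (intro exI[of _ 1] bexI[of _ \<one>]) (auto intro: subgroup.one_closed)
    next
      case False
      then show ?thesis using incl gc generate.incl[of h K]
        by (intro exI[of _ 0] bexI[of _ h]) auto
    qed
  next
    case (inv h)
    show ?case
    proof (cases "h = y")
      case True
      then show ?thesis using sg y
        by (intro exI[of _ "-1"] bexI[of _ \<one>]) (auto intro: subgroup.one_closed simp: int_pow_neg)
    next
      case False
      then show ?thesis using inv gc generate.inv[of h K]
        by (intro exI[of _ 0] bexI[of _ "inv h"]) auto
    qed
  next
    case (eng h1 h2)
    then obtain n1 l1 n2 l2 where
      1: "l1 \<in> generate G K" "h1 = y [^] (n1::int) \<otimes> l1" and
      2: "l2 \<in> generate G K" "h2 = y [^] (n2::int) \<otimes> l2" by blast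
    have "h1 \<otimes> h2 = y [^] (n1 + n2) \<otimes> ((inv (y [^] n2) \<otimes> l1 \<otimes> y [^] n2) \<otimes> l2)"
      using 1 2 y gc by (simp add: group_norm int_pow_mult)
    moreover have "(inv (y [^] n2) \<otimes> l1 \<otimes> y [^] n2) \<otimes> l2 \<in> generate G K"
      using norm[OF 1(1)] 2(1) by (rule generate.eng)
    ultimately show ?case by blast
  }
qed

fun box :: "nat \<Rightarrow> 'a list \<Rightarrow> 'a set" where
  "box m [] = {\<one>}"
| "box m (y # ys) = {y [^] e \<otimes> v | e v. e < m \<and> v \<in> box m ys}"

lemma box_Cons: "box m (y # ys) = (\<lambda>(e, v). y [^] e \<otimes> v) ` ({..<m} \<times> box m ys)"
  by auto

lemma finite_box: "finite (box m ys)"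
  by (induction ys) (simp_all add: box_Cons del: box.simps(2))

lemma box_closed: "set ys \<subseteq> carrier G \<Longrightarrow> box m ys \<subseteq> carrier G"
  by (induction ys) auto

lemma box_append:
  assumes "set xs \<subseteq> carrier G" "set ys \<subseteq> carrier G" "u \<in> box m xs" "v \<in> box m ys"
  shows "u \<otimes> v \<in> box m (xs @ ys)"
  using assms(1,3)
proof (induction xs arbitrary: u)
  case Nil
  then show ?case using assms box_closed[of ys m] by auto
next
  case (Cons x xs)
  then obtain e w where u: "u = x [^] e \<otimes> w" "e < m" "w \<in> box m xs" by auto
  have "w \<in> carrier G" "v \<in> carrier G" using u Cons.prems box_closed assms by auto
  then have "u \<otimes> v = x [^] e \<otimes> (w \<otimes> v)" using u Cons.prems by (simp add: m_assoc)
  moreover have "w \<otimes> v \<in> box m (xs @ ys)" using Cons u by auto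
  ultimately show ?case using u(2) by auto
qed

end

lemma common_multiple:
  assumes "finite A" "\<And>a. a \<in> A \<Longrightarrow> \<exists>n>0. Q a (n::nat)" "\<And>a n c. Q a n \<Longrightarrow> Q a (n * c)"
  shows "\<exists>m>0. \<forall>a\<in>A. Q a m"
  using assms(1,2)
proof (induction A rule: finite_induct)
  case (insert a A)
  then obtain m n where "m > 0" "\<forall>a\<in>A. Q a m" "n > 0" "Q a n" by (meson insert_iff)
  then show ?case using assms(3)
    by (intro exI[of _ "n * m"]) (auto, metis mult.commute)
qed (rule exI[of _ 1], simp)

text \<open>
  A series that is merely central, instead of the lower central series itself, is inherited by
  quotients.
\<close>

locale fg_central_series = group G for G (structure) +
  fixes \<gamma> :: "nat \<Rightarrow> 'a set" and k :: nat
  assumes top: "\<gamma> 0 = carrier G" and bottom: "\<gamma> k = {\<one>}"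
    and term_subgroup: "subgroup (\<gamma> i) G"
    and term_Suc: "\<gamma> (Suc i) \<subseteq> \<gamma> i"
    and commutator: "\<lbrakk>x \<in> \<gamma> i; y \<in> carrier G\<rbrakk> \<Longrightarrow> x \<otimes> y \<otimes> inv x \<otimes> inv y \<in> \<gamma> (Suc i)"
    and term_fg: "\<exists>S. finite S \<and> generate G S = \<gamma> i"
begin

lemma term_carrier: "x \<in> \<gamma> i \<Longrightarrow> x \<in> carrier G"
  using subgroup.mem_carrier[OF term_subgroup] .

lemma term_antimono: "i \<le> j \<Longrightarrow> \<gamma> j \<subseteq> \<gamma> i"
  by (rule lift_Suc_antimono_le[of \<gamma>]) (rule term_Suc)

lemma term_normal: "\<gamma> i \<lhd> G"
proof (rule normal_invI[OF term_subgroup])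
  fix x h assume x: "x \<in> carrier G" and h: "h \<in> \<gamma> i"
  have hc: "h \<in> carrier G" using term_carrier[OF h] .
  have "inv (h \<otimes> x \<otimes> inv h \<otimes> inv x) \<in> \<gamma> i"
    using subgroup.m_inv_closed[OF term_subgroup commutator[OF h x]] term_Suc by blast
  from subgroup.m_closed[OF term_subgroup this h]
  show "x \<otimes> h \<otimes> inv x \<in> \<gamma> i" using x hc by (simp add: group_norm)
qed

abbreviation q :: "nat \<Rightarrow> 'a \<Rightarrow> 'a set" where "q i x \<equiv> \<gamma> i #> x"

lemma q_hom: "group_hom G (G Mod \<gamma> i) (q i)"
proof -
  interpret normal "\<gamma> i" G by (rule term_normal)
  show ?thesis
    by (intro group_hom.intro group_hom_axioms.intro factorgroup_is_group r_coset_hom_Mod is_group)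
qed

lemma q_eq_iff:
  assumes "x \<in> carrier G" "y \<in> carrier G"
  shows "q i x = q i y \<longleftrightarrow> x \<otimes> inv y \<in> \<gamma> i"
proof -
  interpret normal "\<gamma> i" G by (rule term_normal)
  show ?thesis
    using assms rcos_module[OF is_group assms(2,1)] repr_independence[OF _ assms(2) term_subgroup]
      rcos_self[OF assms(1) term_subgroup] by metis
qed

lemma q_one_iff: "x \<in> carrier G \<Longrightarrow> q i x = \<one>\<^bsub>G Mod \<gamma> i\<^esub> \<longleftrightarrow> x \<in> \<gamma> i"
  using q_eq_iff[of x \<one> i] coset_mult_one[OF subgroup.subset[OF term_subgroup]]
  by (simp add: one_FactGroup)

lemma q_eqE:
  assumes "x \<in> carrier G" "y \<in> carrier G" "q i x = q i y"
  shows "\<exists>z\<in>\<gamma> i. x = y \<otimes> z"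
proof -
  have "x \<otimes> inv y \<in> \<gamma> i" using assms q_eq_iff by blast
  then have "inv y \<otimes> (x \<otimes> inv y) \<otimes> y \<in> \<gamma> i"
    using normal.inv_op_closed1[OF term_normal assms(2)] by blast
  then show ?thesis using assms by (intro bexI) (auto simp: group_norm)
qed

lemma q_mult_term:
  assumes "x \<in> carrier G" "z \<in> \<gamma> i" shows "q i (x \<otimes> z) = q i x"
proof -
  interpret Q: group_hom G "G Mod \<gamma> i" "q i" by (rule q_hom)
  show ?thesis
    using assms term_carrier[OF assms(2)] q_one_iff[OF term_carrier[OF assms(2)], of i] Q.hom_mult[of x z]
      Q.hom_closed[of x] by (metis Q.H.r_one)
qed

lemma q_conj:
  assumes "c \<in> \<gamma> i" "x \<in> carrier G"
  shows "q (Suc i) (x \<otimes> c \<otimes> inv x) = q (Suc i) c"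
proof -
  have c: "c \<in> carrier G" using assms term_carrier by blast
  have "inv (c \<otimes> x \<otimes> inv c \<otimes> inv x) \<in> \<gamma> (Suc i)"
    using subgroup.m_inv_closed[OF term_subgroup commutator[OF assms]] .
  then show ?thesis using assms c by (subst q_eq_iff) (auto simp: group_norm)
qed

lemma q_central:
  assumes "c \<in> \<gamma> i" "x \<in> carrier G"
  shows "q (Suc i) (c \<otimes> x) = q (Suc i) (x \<otimes> c)"
proof -
  have c: "c \<in> carrier G" using assms term_carrier by blast
  have "c \<otimes> x \<otimes> inv (x \<otimes> c) \<in> \<gamma> (Suc i)"
    using commutator[OF assms] assms(2) c by (simp add: group_norm)
  then show ?thesis using assms c by (subst q_eq_iff) auto
qed

lemma term_pow: "x \<in> \<gamma> i \<Longrightarrow> x [^] (n::nat) \<in> \<gamma> i"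
  by (induction n) (auto intro: subgroup.one_closed[OF term_subgroup] subgroup.m_closed[OF term_subgroup])

lemma term_int_pow: "x \<in> \<gamma> i \<Longrightarrow> x [^] (n::int) \<in> \<gamma> i"
  by (rule subgroup_int_pow_closed[OF term_subgroup])

text \<open>Modulo the next term, \<open>c\<close> commutes with \<open>x\<close>.\<close>

lemma pow_mult_mod_next:
  assumes x: "x \<in> carrier G" and c: "c \<in> \<gamma> i"
  shows "\<exists>z\<in>\<gamma> (Suc i). (x \<otimes> c) [^] (n::nat) = x [^] n \<otimes> c [^] n \<otimes> z"
proof -
  let ?Q = "G Mod \<gamma> (Suc i)"
  interpret Q: group_hom G ?Q "q (Suc i)" by (rule q_hom)
  have cc: "c \<in> carrier G" using c term_carrier by blast
  have "q (Suc i) ((x \<otimes> c) [^] n) = (q (Suc i) x \<otimes>\<^bsub>?Q\<^esub> q (Suc i) c) [^]\<^bsub>?Q\<^esub> n"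
    using x cc by (simp add: Q.hom_nat_pow)
  also have "\<dots> = q (Suc i) x [^]\<^bsub>?Q\<^esub> n \<otimes>\<^bsub>?Q\<^esub> q (Suc i) c [^]\<^bsub>?Q\<^esub> n"
    using q_central[OF c x] x cc by (intro Q.H.pow_mult_distrib) auto
  also have "\<dots> = q (Suc i) (x [^] n \<otimes> c [^] n)" using x cc by (simp add: Q.hom_nat_pow)
  finally show ?thesis using q_eqE[of "(x \<otimes> c) [^] n" "x [^] n \<otimes> c [^] n" "Suc i"] x cc by simp
qed

text \<open>
  A subgroup between two consecutive terms contains the commutators of its elements with the whole
  group, so it is normal.
\<close>

lemma between_conj:
  assumes H: "subgroup H G" "\<gamma> (Suc i) \<subseteq> H" "H \<subseteq> \<gamma> i" and h: "h \<in> H" and x: "x \<in> carrier G"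
  shows "inv x \<otimes> h \<otimes> x \<in> H"
proof -
  have hc: "h \<in> carrier G" using subgroup.mem_carrier[OF H(1) h] .
  have "h \<otimes> inv x \<otimes> inv h \<otimes> inv (inv x) \<in> H"
    using commutator[of h i "inv x"] H h x by blast
  then have "inv (h \<otimes> inv x \<otimes> inv h \<otimes> inv (inv x)) \<otimes> h \<in> H"
    using H(1) h by (auto intro: subgroup.m_inv_closed subgroup.m_closed)
  then show ?thesis using x hc by (simp add: group_norm)
qed

lemma between_insert:
  assumes K: "\<gamma> (Suc i) \<subseteq> generate G K" "K \<subseteq> \<gamma> i" and y: "y \<in> \<gamma> i"
    and a: "a \<in> generate G (insert y K)"
  shows "\<exists>n. \<exists>h\<in>generate G K. a = y [^] (n::int) \<otimes> h"
proof (rule generate_insert_normalized[OF _ term_carrier[OF y] _ a])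
  show Kc: "K \<subseteq> carrier G" using K(2) term_carrier by blast
  show "inv (y [^] n) \<otimes> h \<otimes> y [^] n \<in> generate G K" if "h \<in> generate G K" for n :: int and h
    by (rule between_conj[OF generate_is_subgroup[OF Kc] K(1)
        generate_subgroup_incl[OF K(2) term_subgroup] that]) (use y term_carrier in auto)
qed

text \<open>
  One generator \<open>y\<close> at a time, the exponent is reduced modulo \<open>m\<close>; the
  rest is a power of \<open>y [^] m\<close> and goes into \<open>D\<close>.
\<close>

lemma box_decomposition:
  assumes D: "subgroup D G" "\<gamma> (Suc i) \<subseteq> D" "D \<subseteq> \<gamma> i"
    and ys: "set ys \<subseteq> \<gamma> i" and m: "m > 0" "\<And>y. y \<in> set ys \<Longrightarrow> y [^] (m::nat) \<in> D"
    and a: "a \<in> generate G (set ys \<union> D)"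
  shows "\<exists>b\<in>box m ys. \<exists>d\<in>D. a = b \<otimes> d"
  using ys m(2) a
proof (induction ys arbitrary: a)
  case Nil
  then have "a \<in> D" using generate_subgroup_incl[OF _ D(1), of D] by auto
  then show ?case using D(3) term_carrier[of a i] by (intro bexI[of _ \<one>] bexI[of _ a]) auto
next
  case (Cons y ys)
  let ?K = "set ys \<union> D"
  have K: "?K \<subseteq> \<gamma> i" "\<gamma> (Suc i) \<subseteq> generate G ?K" "?K \<subseteq> carrier G"
    using Cons.prems D term_carrier by (auto intro: generate.incl)
  have "a \<in> generate G (insert y ?K)" using Cons.prems by simp
  from between_insert[OF K(2,1) _ this] Cons.prems
  obtain n h where h: "h \<in> generate G ?K" "a = y [^] (n::int) \<otimes> h" by auto
  have y: "y \<in> carrier G" using Cons.prems term_carrier by auto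
  have hc: "h \<in> carrier G" using generate_in_carrier[OF K(3) h(1)] .
  define e where "e = nat (n mod int m)"
  have e: "e < m" "int e = n mod int m" using m(1) by (auto simp: e_def nat_less_iff)
  have "y [^] n = y [^] (int e + int m * (n div int m))" by (simp add: e(2))
  also have "\<dots> = y [^] e \<otimes> (y [^] m) [^] (n div int m)"
    using y by (simp add: int_pow_mult int_pow_pow[symmetric] int_pow_int)
  finally have a: "a = y [^] e \<otimes> ((y [^] m) [^] (n div int m) \<otimes> h)"
    using h y hc by (simp add: m_assoc)
  have "(y [^] m) [^] (n div int m) \<in> D"
    using subgroup_int_pow_closed[OF D(1)] Cons.prems by simp
  then have "(y [^] m) [^] (n div int m) \<otimes> h \<in> generate G ?K"
    using h(1) by (auto intro: generate.eng generate.incl)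
  with Cons.IH[of "(y [^] m) [^] (n div int m) \<otimes> h"] Cons.prems
  obtain b d where bd: "b \<in> box m ys" "d \<in> D" "(y [^] m) [^] (n div int m) \<otimes> h = b \<otimes> d" by auto
  have "set ys \<subseteq> carrier G" using K(3) by simp
  then have "b \<in> carrier G" "d \<in> carrier G"
    using box_closed[of ys m] bd subgroup.mem_carrier[OF D(1)] by auto
  then have "a = (y [^] e \<otimes> b) \<otimes> d" using a bd y by (simp add: m_assoc)
  then show ?case using bd e(1) by auto
qed

text \<open>
  If \<open>H\<close> is normal, this means that the coset of \<open>b\<close> has infinite order in
  the quotient.
\<close>

definition aperiodic_mod :: "'a \<Rightarrow> 'a set \<Rightarrow> bool"
  where "aperiodic_mod b H \<longleftrightarrow> (\<forall>n>0. b [^] (n::nat) \<notin> H)"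

text \<open>
  Modulo the next term, the \<open>n\<close>-th power of \<open>b [^] E \<otimes> h\<close> is
  \<open>b [^] (E * n) \<otimes> h [^] n\<close>, which is not even in \<open>H\<close>.  This is
  how infinite order is recognised from an equation.
\<close>

lemma aperiodic_mod_mult:
  assumes H: "subgroup H G" "\<gamma> (Suc i) \<subseteq> H" "H \<subseteq> \<gamma> i" and b: "b \<in> \<gamma> i" "aperiodic_mod b H"
    and h: "h \<in> H" and E: "E > (0::nat)"
  shows "aperiodic_mod (b [^] E \<otimes> h) (\<gamma> (Suc i))"
  unfolding aperiodic_mod_def
proof (intro allI impI notI)
  fix n :: nat assume n: "n > 0" and *: "(b [^] E \<otimes> h) [^] n \<in> \<gamma> (Suc i)"
  have c: "b \<in> carrier G" "h \<in> carrier G" using b h H term_carrier by auto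
  obtain z where z: "z \<in> \<gamma> (Suc i)" "(b [^] E \<otimes> h) [^] n = b [^] (E * n) \<otimes> h [^] n \<otimes> z"
    using pow_mult_mod_next[of "b [^] E" h i n] c h H(3) by (auto simp: nat_pow_pow)
  have "(b [^] (E * n) \<otimes> h [^] n \<otimes> z) \<otimes> inv z \<in> H"
    by (rule subgroup.m_closed[OF H(1) _ subgroup.m_inv_closed[OF H(1)]]) (use * z H(2) in auto)
  then have "b [^] (E * n) \<otimes> h [^] n \<in> H" using c term_carrier[OF z(1)] by (simp add: m_assoc)
  moreover have hn: "h [^] n \<in> H"
    using h H(1) by (induction n) (auto intro: subgroup.one_closed subgroup.m_closed)
  ultimately have "(b [^] (E * n) \<otimes> h [^] n) \<otimes> inv (h [^] n) \<in> H"
    using H(1) by (auto intro: subgroup.m_closed subgroup.m_inv_closed)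
  then have "b [^] (E * n) \<in> H" using c by (simp add: m_assoc)
  moreover have "E * n > 0" using E n by simp
  ultimately show False using b(2) unfolding aperiodic_mod_def by blast
qed

text \<open>
  The next term together with the first \<open>j\<close> generators of \<open>\<gamma> i\<close>
  generates an ascending chain of subgroups.  Where the chain first contains a positive power of
  \<open>a\<close>, the generator that was added last occurs in this power with a nonzero exponent;
  hence no positive power of that generator belongs to the previous subgroup, because otherwise a
  power of \<open>a\<close> would.  A negative \<open>n\<close> makes the exponent \<open>E\<close>
  positive.  The pairs of a generator and a subgroup that occur here form a finite list that does
  not depend on \<open>a\<close>.
\<close>

lemma aperiodic_decomposition:
  assumes zs: "generate G (set zs) = \<gamma> (Suc i)" and ys: "generate G (set ys) = \<gamma> i"
    and a: "a \<in> \<gamma> i" "aperiodic_mod a (\<gamma> (Suc i))"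
  shows "\<exists>j<length ys. aperiodic_mod (ys ! j) (generate G (set (zs @ take j ys))) \<and>
     (\<exists>n. \<exists>E>0. \<exists>h\<in>generate G (set (zs @ take j ys)). a [^] (n::int) = (ys ! j) [^] (E::nat) \<otimes> h)"
proof -
  let ?K = "\<lambda>j. set (zs @ take j ys)"
  let ?H = "\<lambda>j. generate G (?K j)"
  have ysi: "set ys \<subseteq> \<gamma> i" using generate.incl[of _ "set ys" G] ys by auto
  have zsi: "set zs \<subseteq> \<gamma> i" using generate.incl[of _ "set zs" G] zs term_Suc by auto
  have K: "?K j \<subseteq> \<gamma> i" "?K j \<subseteq> carrier G" for j
    using ysi zsi term_carrier set_take_subset[of j ys] by auto
  have H: "subgroup (?H j) G" "\<gamma> (Suc i) \<subseteq> ?H j" "?H j \<subseteq> \<gamma> i" for j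
    using generate_is_subgroup[OF K(2)] mono_generate[of "set zs" "?K j"] zs
      generate_subgroup_incl[OF K(1) term_subgroup] by auto
  define P where "P j \<longleftrightarrow> (\<exists>n>0. a [^] (n::nat) \<in> ?H j)" for j
  have "a \<in> ?H (length ys)"
    using mono_generate[of "set ys" "?K (length ys)"] ys a(1) by auto
  then have "P (length ys)" unfolding P_def using a(1) term_carrier by (intro exI[of _ 1]) auto
  define j' where "j' = (LEAST j. P j)"
  have Pj: "P j'" and min: "\<And>l. l < j' \<Longrightarrow> \<not> P l" and le: "j' \<le> length ys"
    unfolding j'_def using \<open>P (length ys)\<close> by (auto intro: LeastI Least_le dest: not_less_Least)
  have "\<not> P 0" using a(2) zs unfolding P_def aperiodic_mod_def by auto
  with Pj obtain j where j': "j' = Suc j" by (cases j') auto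
  have jl: "j < length ys" using le j' by simp
  have Kj: "?K (Suc j) = insert (ys ! j) (?K j)" using jl by (auto simp: take_Suc_conv_app_nth)
  have b: "ys ! j \<in> \<gamma> i" using jl ysi by auto
  note b = b term_carrier[OF b]
  have ac: "a \<in> carrier G" using a term_carrier by blast
  have nP: "a [^] (n::nat) \<notin> ?H j" if "n > 0" for n
  proof -
    have "\<not> P j" by (rule min) (simp add: j')
    then show ?thesis using that unfolding P_def by blast
  qed
  obtain n where n: "n > 0" "a [^] (n::nat) \<in> ?H (Suc j)" using Pj unfolding P_def j' by blast
  then obtain E h where E: "h \<in> ?H j" "a [^] n = (ys ! j) [^] (E::int) \<otimes> h"
    using between_insert[OF H(2) K(1) b(1), of "a [^] n"] unfolding Kj by blast
  have hc: "h \<in> carrier G" using generate_in_carrier[OF K(2) E(1)] .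
  have E0: "E \<noteq> 0"
  proof
    assume "E = 0"
    then have "a [^] n \<in> ?H j" using E hc by simp
    then show False using nP n by blast
  qed
  have ap: "aperiodic_mod (ys ! j) (?H j)"
    unfolding aperiodic_mod_def
  proof (intro allI impI notI)
    fix t :: nat assume t: "t > 0" "ys ! j [^] t \<in> ?H j"
    let ?b = "ys ! j [^] E"
    have bc: "?b \<in> carrier G" "?b \<in> \<gamma> i" using b term_int_pow by auto
    have "a [^] (n * t) = (?b \<otimes> h) [^] t" using E(2) ac by (simp flip: nat_pow_pow)
    then obtain z where z: "z \<in> \<gamma> (Suc i)" "a [^] (n * t) = ?b [^] t \<otimes> h [^] t \<otimes> z"
      using pow_mult_mod_next[of ?b h i t] bc E(1) H(3) by auto
    have "?b [^] t = (ys ! j [^] t) [^] E"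
      using b(2) by (simp add: int_pow_pow mult.commute flip: int_pow_int)
    then have "?b [^] t \<in> ?H j" using subgroup_int_pow_closed[OF H(1) t(2)] by simp
    moreover have "h [^] t \<in> ?H j"
      using subgroup_int_pow_closed[OF H(1) E(1), of "int t"] by (simp add: int_pow_int)
    ultimately have "a [^] (n * t) \<in> ?H j"
      unfolding z(2) using subsetD[OF H(2) z(1)] by (intro subgroup.m_closed[OF H(1)])
    then show False using nP[of "n * t"] n t by simp
  qed
  have "\<exists>n. \<exists>E>0. \<exists>h\<in>?H j. a [^] (n::int) = (ys ! j) [^] (E::nat) \<otimes> h"
  proof (cases "E > 0")
    case True
    then show ?thesis using E
      by (intro exI[of _ "int n"] exI[of _ "nat E"] conjI bexI[of _ h]) (auto simp: int_pow_int simp flip: int_pow_int)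
  next
    case False
    let ?c = "ys ! j [^] (- E)"
    have c: "?c \<in> carrier G" "ys ! j [^] E \<in> carrier G" using b by auto
    have "a [^] (- int n) = inv (ys ! j [^] E \<otimes> h)"
      using ac E(2) by (simp add: int_pow_neg int_pow_int)
    also have "\<dots> = ?c \<otimes> (inv ?c \<otimes> inv h \<otimes> ?c)"
      using c hc b by (simp add: group_norm int_pow_neg)
    finally have "a [^] (- int n) = (ys ! j) [^] nat (- E) \<otimes> (inv ?c \<otimes> inv h \<otimes> ?c)"
      using False by (simp flip: int_pow_int)
    moreover have "inv ?c \<otimes> inv h \<otimes> ?c \<in> ?H j"
      by (rule between_conj[OF H]) (use E(1) H(1) c in \<open>auto intro: subgroup.m_inv_closed\<close>)
    ultimately show ?thesis using False E0
      by (intro exI[of _ "- int n"] exI[of _ "nat (- E)"] conjI bexI) auto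
  qed
  with ap jl show ?thesis by blast
qed

text \<open>
  The terms are finite from the bottom up.  If \<open>\<gamma> (Suc i)\<close> is finite and
  \<open>x \<in> \<gamma> i\<close>, then the commutators of \<open>x [^] n\<close> with the
  finitely many generators take finitely many values as \<open>n\<close> varies.  Two powers of
  \<open>x\<close> with the same commutators differ by a central power of \<open>x\<close>, so
  \<open>x\<close> has finite order, and \<open>\<gamma> i\<close> is finite because it is generated
  by finitely many elements of finite order modulo \<open>\<gamma> (Suc i)\<close>.
\<close>

lemma finite_if_center_torsion:
  assumes torsion: "\<And>z. \<lbrakk>z \<in> carrier G; \<And>y. y \<in> carrier G \<Longrightarrow> z \<otimes> y = y \<otimes> z\<rbrakk>
    \<Longrightarrow> \<exists>n>0. z [^] (n::nat) = \<one>"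
  shows "finite (carrier G)"
proof -
  obtain S where S: "finite S" "generate G S = carrier G" using term_fg[of 0] top by auto
  have Sc: "S \<subseteq> carrier G" using generate.incl[of _ S G] S by auto
  have "finite (\<gamma> (k - n))" for n
  proof (induction n)
    case 0
    then show ?case by (simp add: bottom)
  next
    case (Suc n)
    show ?case
    proof (cases "n < k")
      case False
      then show ?thesis using Suc by simp
    next
      case True
      define i where "i = k - Suc n"
      have F: "finite (\<gamma> (Suc i))" using Suc True by (simp add: i_def Suc_diff_Suc)
      have tors: "\<exists>t>0. x [^] (t::nat) = \<one>" if x: "x \<in> \<gamma> i" for x
      proof -
        have xc: "x \<in> carrier G" using x term_carrier by blast
        define c where "c n = (\<lambda>y\<in>S. x [^] (n::nat) \<otimes> y \<otimes> inv (x [^] n) \<otimes> inv y)" for n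
        have "range c \<subseteq> (S \<rightarrow>\<^sub>E \<gamma> (Suc i))"
          using commutator[OF term_pow[OF x]] Sc by (auto simp: c_def)
        then have "finite (range c)" by (rule finite_subset) (intro finite_PiE S F)
        then have "\<not> inj c" using finite_imageD[of c UNIV] by auto
        then obtain l1 l2 where "c l1 = c l2" "l1 \<noteq> l2" by (auto simp: inj_def)
        then obtain n1 n2 where n: "n1 < n2" "c n1 = c n2"
          by (cases "l1 < l2") (auto simp: neq_iff)
        define d where "d = n2 - n1"
        have comm: "y \<otimes> x [^] d = x [^] d \<otimes> y" if y: "y \<in> S" for y
        proof -
          have yc: "y \<in> carrier G" using y Sc by blast
          have "x [^] n1 \<otimes> y \<otimes> inv (x [^] n1) \<otimes> inv y = x [^] n2 \<otimes> y \<otimes> inv (x [^] n2) \<otimes> inv y"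
            using fun_cong[OF n(2), of y] y by (simp add: c_def)
          then have "x [^] n1 \<otimes> (y \<otimes> inv (x [^] n1)) = x [^] n2 \<otimes> (y \<otimes> inv (x [^] n2))"
            using xc yc by (simp add: m_assoc[symmetric])
          also have "x [^] n2 = x [^] n1 \<otimes> x [^] d" using n(1) xc by (simp add: d_def nat_pow_mult)
          finally have "y \<otimes> inv (x [^] n1) = x [^] d \<otimes> (y \<otimes> inv (x [^] n1 \<otimes> x [^] d))"
            using xc yc by (simp add: m_assoc)
          also have "\<dots> = x [^] d \<otimes> (y \<otimes> (inv (x [^] d) \<otimes> inv (x [^] n1)))"
            using xc by (simp add: inv_mult_group)
          finally have "y \<otimes> inv (x [^] n1) = (x [^] d \<otimes> y \<otimes> inv (x [^] d)) \<otimes> inv (x [^] n1)"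
            using xc yc by (simp add: m_assoc)
          then have "y = x [^] d \<otimes> y \<otimes> inv (x [^] d)" using xc yc by (simp add: r_cancel)
          then have "y \<otimes> x [^] d = x [^] d \<otimes> y \<otimes> inv (x [^] d) \<otimes> x [^] d" by simp
          then show ?thesis using xc yc by (simp add: m_assoc)
        qed
        have "x [^] d \<otimes> y = y \<otimes> x [^] d" if "y \<in> carrier G" for y
        proof -
          have "y \<in> generate G S" using that S(2) by simp
          then show ?thesis
          proof induction
            case (inv h)
            have hc: "h \<in> carrier G" using inv Sc by blast
            have "x [^] d \<otimes> inv h = inv h \<otimes> (h \<otimes> x [^] d) \<otimes> inv h"
              using hc xc by (simp add: group_norm)
            also have "\<dots> = inv h \<otimes> x [^] d" using comm[OF inv] hc xc by (simp add: group_norm)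
            finally show ?case .
          next
            case (eng h1 h2)
            have hc: "h1 \<in> carrier G" "h2 \<in> carrier G" using eng S(2) by auto
            have "x [^] d \<otimes> (h1 \<otimes> h2) = (x [^] d \<otimes> h1) \<otimes> h2" using hc xc by (simp add: m_assoc)
            also have "\<dots> = h1 \<otimes> (x [^] d \<otimes> h2)" using eng hc xc by (simp add: m_assoc)
            also have "\<dots> = h1 \<otimes> h2 \<otimes> x [^] d" using eng hc xc by (simp add: m_assoc)
            finally show ?case .
          qed (use comm xc in auto)
        qed
        from torsion[OF _ this] obtain t where "t > 0" "(x [^] d) [^] (t::nat) = \<one>" using xc by auto
        then show ?thesis using n(1) xc by (intro exI[of _ "d * t"]) (simp add: nat_pow_pow d_def)
      qed
      obtain Z where Z: "finite Z" "generate G Z = \<gamma> i" using term_fg by blast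
      obtain ys where ys: "set ys = Z" using finite_list[OF Z(1)] by blast
      have Zi: "Z \<subseteq> \<gamma> i" using generate.incl[of _ Z G] Z(2) by auto
      have "\<exists>m>0. \<forall>y\<in>Z. y \<in> carrier G \<and> y [^] (m::nat) = \<one>"
      proof (rule common_multiple[OF Z(1), of "\<lambda>y n. y \<in> carrier G \<and> y [^] n = \<one>"])
        show "\<exists>n>0. y \<in> carrier G \<and> y [^] (n::nat) = \<one>" if "y \<in> Z" for y
          using tors[of y] that Zi term_carrier[of y i] by blast
      qed (simp flip: nat_pow_pow)
      then obtain m where m: "m > 0" "\<forall>y\<in>Z. y [^] (m::nat) = \<one>" by blast
      have "\<gamma> i \<subseteq> (\<lambda>(b, d). b \<otimes> d) ` (box m ys \<times> \<gamma> (Suc i))"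
      proof
        fix a assume "a \<in> \<gamma> i"
        then have "a \<in> generate G (set ys \<union> \<gamma> (Suc i))"
          using mono_generate[of "set ys" "set ys \<union> \<gamma> (Suc i)"] ys Z(2) by auto
        from box_decomposition[OF term_subgroup order_refl term_Suc _ m(1) _ this]
        obtain b d where "b \<in> box m ys" "d \<in> \<gamma> (Suc i)" "a = b \<otimes> d"
          using ys Zi m(2) subgroup.one_closed[OF term_subgroup] by auto
        then show "a \<in> (\<lambda>(b, d). b \<otimes> d) ` (box m ys \<times> \<gamma> (Suc i))" by auto
      qed
      then have "finite (\<gamma> i)" by (rule finite_subset) (intro finite_imageI finite_cartesian_product finite_box F)
      then show ?thesis by (simp add: i_def)
    qed
  qed
  from this[of k] show ?thesis by (simp add: top)
qed

end

section \<open>Twisted conjugacy along a central series\<close>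

lemma (in group) twisted_conj_relI:
  "\<lbrakk>g \<in> carrier G; f \<in> carrier G; x \<in> carrier G; \<phi> x \<otimes> g = f \<otimes> x\<rbrakk> \<Longrightarrow> (g, f) \<in> twisted_conj_rel G \<phi>"
  by (auto simp: twisted_conj_rel_def)

lemma (in group) center_inv:
  assumes "z \<in> {z \<in> carrier G. \<forall>y\<in>carrier G. z \<otimes> y = y \<otimes> z}"
  shows "inv z \<in> {z \<in> carrier G. \<forall>y\<in>carrier G. z \<otimes> y = y \<otimes> z}"
proof -
  have "inv z \<otimes> y = y \<otimes> inv z" if y: "y \<in> carrier G" for y
  proof -
    have z: "z \<in> carrier G" "z \<otimes> y = y \<otimes> z" using assms y by auto
    have "inv z \<otimes> y = inv z \<otimes> (y \<otimes> z) \<otimes> inv z" using z(1) y by (simp add: m_assoc)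
    also have "\<dots> = y \<otimes> inv z" unfolding z(2)[symmetric] using z(1) y by (simp add: group_norm)
    finally show ?thesis .
  qed
  then show ?thesis using assms by blast
qed

text \<open>
  On the centre, which the surjection \<open>\<psi>\<close> preserves, the displacement is a
  homomorphism.
\<close>

lemma (in group) central_displacements_normal:
  assumes \<psi>: "\<psi> \<in> hom G G" and surj: "\<psi> ` carrier G = carrier G"
  defines "C \<equiv> {z \<in> carrier G. \<forall>y\<in>carrier G. z \<otimes> y = y \<otimes> z}"
  defines "D \<equiv> (\<lambda>z. \<psi> z \<otimes> inv z) ` C"
  shows "D \<lhd> G" and "\<psi> ` D \<subseteq> D"
proof -
  interpret \<psi>: group_hom G G \<psi> by (intro group_hom.intro group_hom_axioms.intro is_group \<psi>)
  have Cc: "z \<in> carrier G" and swap: "y \<in> carrier G \<Longrightarrow> z \<otimes> y = y \<otimes> z" if "z \<in> C" for z y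
    using that unfolding C_def by auto
  have inv: "inv z \<in> C" if "z \<in> C" for z using center_inv that unfolding C_def by blast
  have mult: "z \<otimes> z' \<in> C" if z: "z \<in> C" and z': "z' \<in> C" for z z'
  proof -
    have "z \<otimes> z' \<otimes> y = y \<otimes> (z \<otimes> z')" if y: "y \<in> carrier G" for y
    proof -
      have "z \<otimes> z' \<otimes> y = z \<otimes> y \<otimes> z'" using swap[OF z' y] Cc z z' y by (simp add: m_assoc)
      also have "\<dots> = y \<otimes> (z \<otimes> z')" using swap[OF z y] Cc z z' y by (simp add: m_assoc)
      finally show ?thesis .
    qed
    then show ?thesis using m_closed[OF Cc[OF z] Cc[OF z']] unfolding C_def by blast
  qed
  have im: "\<psi> z \<in> C" if z: "z \<in> C" for z
  proof -
    have "\<psi> z \<otimes> y = y \<otimes> \<psi> z" if "y \<in> carrier G" for y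
    proof -
      obtain y' where "y' \<in> carrier G" "y = \<psi> y'" using \<open>y \<in> carrier G\<close> surj by blast
      then show ?thesis using swap[OF z, of y'] Cc[OF z] by (metis \<psi>.hom_mult)
    qed
    then show ?thesis using \<psi>.hom_closed[OF Cc[OF z]] unfolding C_def by blast
  qed
  have DC: "D \<subseteq> C" unfolding D_def using mult im inv by blast
  have "subgroup D G"
  proof (rule subgroupI)
    show "D \<subseteq> carrier G" using DC Cc by blast
    have "\<one> \<in> C" by (simp add: C_def)
    then show "D \<noteq> {}" unfolding D_def by blast
  next
    fix a assume "a \<in> D"
    then obtain z where z: "z \<in> C" "a = \<psi> z \<otimes> inv z" unfolding D_def by blast
    have "inv a = \<psi> (inv z) \<otimes> inv (inv z)"
      using z(2) Cc[OF z(1)] swap[OF z(1), of "inv (\<psi> z)"] by (simp add: inv_mult_group)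
    then show "inv a \<in> D" unfolding D_def using inv[OF z(1)] by blast
  next
    fix a b assume "a \<in> D" "b \<in> D"
    then obtain y z where y: "y \<in> C" "a = \<psi> y \<otimes> inv y" and z: "z \<in> C" "b = \<psi> z \<otimes> inv z"
      unfolding D_def by blast
    have "a \<otimes> b = \<psi> y \<otimes> (b \<otimes> inv y)"
      using y z Cc swap[OF inv[OF y(1)], of b] by (simp add: m_assoc)
    also have "\<dots> = \<psi> (y \<otimes> z) \<otimes> inv (y \<otimes> z)" using y z Cc by (simp add: group_norm)
    finally show "a \<otimes> b \<in> D" unfolding D_def using mult[OF y(1) z(1)] by blast
  qed
  then show "D \<lhd> G"
  proof (rule normal_invI)
    fix x h assume x: "x \<in> carrier G" and h: "h \<in> D"
    have hC: "h \<in> C" using h DC by blast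
    have "x \<otimes> h \<otimes> inv x = h \<otimes> x \<otimes> inv x" using swap[OF hC x] by simp
    then show "x \<otimes> h \<otimes> inv x \<in> D" using x h Cc[OF hC] by (simp add: m_assoc)
  qed
  show "\<psi> ` D \<subseteq> D" unfolding D_def using im Cc by force
qed

locale fg_central_series_endo = fg_central_series +
  fixes \<phi>
  assumes endo: "\<phi> \<in> hom G G" and term_invariant: "\<phi> ` \<gamma> i \<subseteq> \<gamma> i"
begin

sublocale \<phi>: group_hom G G \<phi>
  by (intro group_hom.intro group_hom_axioms.intro is_group endo)

definition displace :: "'a \<Rightarrow> 'a" where "displace x = \<phi> x \<otimes> inv x"

lemma displace_closed: "x \<in> carrier G \<Longrightarrow> displace x \<in> carrier G"
  by (simp add: displace_def)

lemma displace_term: "x \<in> \<gamma> i \<Longrightarrow> displace x \<in> \<gamma> i"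
  unfolding displace_def using term_invariant
  by (auto intro!: subgroup.m_closed[OF term_subgroup] subgroup.m_inv_closed[OF term_subgroup])

text \<open>
  The displacement of a product is
  \<open>displace x \<otimes> (x \<otimes> displace y \<otimes> inv x)\<close>, and conjugation is
  the identity on \<open>\<gamma> i\<close> modulo the next term.
\<close>

lemma q_displace_mult:
  assumes x: "x \<in> carrier G" "displace x \<in> \<gamma> i" and y: "y \<in> carrier G" "displace y \<in> \<gamma> i"
  shows "q (Suc i) (displace (x \<otimes> y)) = q (Suc i) (displace x \<otimes> displace y)"
proof -
  interpret Q: group_hom G "G Mod \<gamma> (Suc i)" "q (Suc i)" by (rule q_hom)
  have "displace (x \<otimes> y) = displace x \<otimes> (x \<otimes> displace y \<otimes> inv x)"
    using x y by (simp add: displace_def group_norm)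
  then show ?thesis
    using q_conj[OF y(2) x(1)] x y displace_closed by simp
qed

lemma q_displace_pow:
  assumes x: "x \<in> carrier G" "displace x \<in> \<gamma> i"
  shows "displace (x [^] (n::nat)) \<in> \<gamma> i \<and> q (Suc i) (displace (x [^] n)) = q (Suc i) (displace x [^] n)"
proof (induction n)
  case 0
  then show ?case using subgroup.one_closed[OF term_subgroup] by (simp add: displace_def)
next
  case (Suc n)
  interpret Q: group_hom G "G Mod \<gamma> (Suc i)" "q (Suc i)" by (rule q_hom)
  have "q (Suc i) (displace (x [^] Suc n)) = q (Suc i) (displace (x [^] n) \<otimes> displace x)"
    using q_displace_mult[of "x [^] n" i x] x Suc by simp
  also have "\<dots> = q (Suc i) (displace x [^] Suc n)"
    using Suc x displace_closed by simp
  finally have e: "q (Suc i) (displace (x [^] Suc n)) = q (Suc i) (displace x [^] Suc n)" .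
  obtain z where "z \<in> \<gamma> (Suc i)" "displace (x [^] Suc n) = displace x [^] Suc n \<otimes> z"
    using q_eqE[OF _ _ e] x displace_closed by (meson nat_pow_closed)
  then have "displace (x [^] Suc n) \<in> \<gamma> i"
    using term_pow[OF x(2), of "Suc n"] term_Suc by (auto intro: subgroup.m_closed[OF term_subgroup])
  with e show ?case by blast
qed

text \<open>
  The displacement induces an endomorphism of the factor \<open>\<gamma> i\<close> modulo
  \<open>\<gamma> (Suc i)\<close>.  The following definitions describe its kernel, the preimage
  \<open>displaced i\<close> of its image, and its cokernel.
\<close>

definition ker_torsion :: "nat \<Rightarrow> bool"
  where "ker_torsion i \<longleftrightarrow>
    (\<forall>a\<in>\<gamma> i. displace a \<in> \<gamma> (Suc i) \<longrightarrow> (\<exists>n>0. a [^] (n::nat) \<in> \<gamma> (Suc i)))"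

definition displaced :: "nat \<Rightarrow> 'a set"
  where "displaced i = {displace x \<otimes> z | x z. x \<in> \<gamma> i \<and> z \<in> \<gamma> (Suc i)}"

definition coker_torsion :: "nat \<Rightarrow> bool"
  where "coker_torsion i \<longleftrightarrow> (\<forall>a\<in>\<gamma> i. \<exists>n>0. a [^] (n::nat) \<in> displaced i)"

lemma mem_displaced_iff:
  assumes "a \<in> carrier G"
  shows "a \<in> displaced i \<longleftrightarrow> (\<exists>x\<in>\<gamma> i. q (Suc i) a = q (Suc i) (displace x))"
proof
  assume "a \<in> displaced i"
  then show "\<exists>x\<in>\<gamma> i. q (Suc i) a = q (Suc i) (displace x)"
    unfolding displaced_def using q_mult_term[of _ _ "Suc i"] displace_closed term_carrier by blast
next
  assume "\<exists>x\<in>\<gamma> i. q (Suc i) a = q (Suc i) (displace x)"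
  then obtain x where x: "x \<in> \<gamma> i" "q (Suc i) a = q (Suc i) (displace x)" by blast
  from q_eqE[OF assms _ x(2)] show "a \<in> displaced i"
    unfolding displaced_def using x(1) displace_closed term_carrier by blast
qed

lemma displaced_subset: "displaced i \<subseteq> \<gamma> i"
  unfolding displaced_def using displace_term term_Suc
  by (auto intro!: subgroup.m_closed[OF term_subgroup])

lemma term_Suc_displaced: "\<gamma> (Suc i) \<subseteq> displaced i"
proof
  fix z assume z: "z \<in> \<gamma> (Suc i)"
  have "z = displace \<one> \<otimes> z" using term_carrier[OF z] by (simp add: displace_def)
  then show "z \<in> displaced i"
    unfolding displaced_def using z subgroup.one_closed[OF term_subgroup] by blast
qed

lemma q_displace_hom: "(\<lambda>x. q (Suc i) (displace x)) \<in> hom (G\<lparr>carrier := \<gamma> i\<rparr>) (G Mod \<gamma> (Suc i))"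
proof -
  interpret Q: group_hom G "G Mod \<gamma> (Suc i)" "q (Suc i)" by (rule q_hom)
  have "q (Suc i) (displace (x \<otimes> y)) =
      q (Suc i) (displace x) \<otimes>\<^bsub>G Mod \<gamma> (Suc i)\<^esub> q (Suc i) (displace y)"
    if "x \<in> \<gamma> i" "y \<in> \<gamma> i" for x y
    using q_displace_mult[of x i y] that displace_term displace_closed term_carrier by simp
  then show ?thesis using displace_closed term_carrier by (auto simp: hom_def)
qed

lemma displaced_subgroup: "subgroup (displaced i) G"
proof -
  interpret Q: group_hom G "G Mod \<gamma> (Suc i)" "q (Suc i)" by (rule q_hom)
  interpret M: group "G\<lparr>carrier := \<gamma> i\<rparr>"
    by (rule subgroup.subgroup_is_group[OF term_subgroup is_group])
  interpret p: group_hom "G\<lparr>carrier := \<gamma> i\<rparr>" "G Mod \<gamma> (Suc i)" "\<lambda>x. q (Suc i) (displace x)"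
    by (intro group_hom.intro group_hom_axioms.intro M.is_group Q.H.is_group q_displace_hom)
  show ?thesis
  proof (rule subgroupI)
    show "displaced i \<subseteq> carrier G" using displaced_subset term_carrier by blast
    show "displaced i \<noteq> {}" using term_Suc_displaced subgroup.one_closed[OF term_subgroup] by blast
  next
    fix a assume a: "a \<in> displaced i"
    then have ac: "a \<in> carrier G" using displaced_subset term_carrier by blast
    obtain x where x: "x \<in> \<gamma> i" "q (Suc i) a = q (Suc i) (displace x)"
      using a mem_displaced_iff[OF ac] by blast
    have "q (Suc i) (inv a) = q (Suc i) (displace (inv\<^bsub>G\<lparr>carrier := \<gamma> i\<rparr>\<^esub> x))"
      using x ac p.hom_inv[of x] by simp
    moreover have "inv\<^bsub>G\<lparr>carrier := \<gamma> i\<rparr>\<^esub> x \<in> \<gamma> i" using M.inv_closed[of x] x by simp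
    ultimately show "inv a \<in> displaced i" using mem_displaced_iff ac by blast
  next
    fix a b assume a: "a \<in> displaced i" "b \<in> displaced i"
    then have ac: "a \<in> carrier G" "b \<in> carrier G" using displaced_subset term_carrier by blast+
    obtain x y where x: "x \<in> \<gamma> i" "q (Suc i) a = q (Suc i) (displace x)"
      and y: "y \<in> \<gamma> i" "q (Suc i) b = q (Suc i) (displace y)"
      using a mem_displaced_iff ac by metis
    have "q (Suc i) (a \<otimes> b) = q (Suc i) (displace (x \<otimes> y))"
      using x y ac p.hom_mult[of x y] by simp
    moreover have "x \<otimes> y \<in> \<gamma> i" using x y subgroup.m_closed[OF term_subgroup] by blast
    ultimately show "a \<otimes> b \<in> displaced i" using mem_displaced_iff ac by blast
  qed
qed

text \<open>
  The comparison of ranks, applied to the projection \<open>q (Suc i)\<close> of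
  \<open>\<gamma> i\<close> onto the factor and to its composition with the displacement.
\<close>

lemma ker_torsion_iff_coker_torsion: "ker_torsion i \<longleftrightarrow> coker_torsion i"
proof -
  let ?Q = "G Mod \<gamma> (Suc i)"
  let ?M = "G\<lparr>carrier := \<gamma> i\<rparr>"
  let ?A = "?Q\<lparr>carrier := q (Suc i) ` \<gamma> i\<rparr>"
  let ?p = "\<lambda>x. q (Suc i) (displace x)"
  interpret Q: group_hom G ?Q "q (Suc i)" by (rule q_hom)
  have M: "group ?M" by (rule subgroup.subgroup_is_group[OF term_subgroup is_group])
  have AQ: "subgroup (q (Suc i) ` \<gamma> i) ?Q" by (rule Q.subgroup_img_is_subgroup[OF term_subgroup])
  have Agr: "group ?A" by (rule subgroup.subgroup_is_group[OF AQ Q.H.is_group])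
  have "comm_group ?A"
  proof (rule group.group_comm_groupI[OF Agr])
    fix u v assume "u \<in> carrier ?A" "v \<in> carrier ?A"
    then obtain x y where xy: "x \<in> \<gamma> i" "y \<in> \<gamma> i" "u = q (Suc i) x" "v = q (Suc i) y" by auto
    then have "q (Suc i) (x \<otimes> y) = q (Suc i) (y \<otimes> x)" using q_central term_carrier by blast
    then show "u \<otimes>\<^bsub>?A\<^esub> v = v \<otimes>\<^bsub>?A\<^esub> u" using xy term_carrier by simp
  qed
  interpret A: comm_group ?A by fact
  have qh: "q (Suc i) \<in> hom ?M ?A"
    using term_carrier by (auto simp: hom_def)
  have ph: "?p \<in> hom ?M ?A"
    using q_displace_hom[of i] displace_term unfolding hom_def by auto
  obtain S where S: "finite S" "generate G S = \<gamma> i" using term_fg by blast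
  have Si: "S \<subseteq> \<gamma> i" using generate.incl[of _ S G] S by auto
  have Sc: "S \<subseteq> carrier G" using Si term_carrier by auto
  have gen: "generate ?A (q (Suc i) ` S) = carrier ?A"
    using Q.H.generate_consistent[OF image_mono[OF Si] AQ] Q.generate_img[OF Sc] S(2) by simp
  have oneQ: "x \<in> carrier G \<Longrightarrow> q (Suc i) x = \<one>\<^bsub>?A\<^esub> \<longleftrightarrow> x \<in> \<gamma> (Suc i)" for x
    using q_one_iff by simp
  have pq: "?p x = \<one>\<^bsub>?A\<^esub>" if x: "x \<in> carrier ?M" "q (Suc i) x = \<one>\<^bsub>?A\<^esub>" for x
    using x displace_term[of x "Suc i"] oneQ displace_closed term_carrier by auto
  have pow: "q (Suc i) a [^]\<^bsub>?A\<^esub> (n::int) = q (Suc i) (a [^] n)" if "a \<in> \<gamma> i" for a n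
    using Q.H.int_pow_consistent[OF AQ, of "q (Suc i) a" n] Q.hom_int_pow[of a n] that term_carrier by auto
  note facts = M qh ph _ pq finite_imageI[OF S(1)] gen
  show ?thesis
  proof
    assume k: "ker_torsion i"
    show "coker_torsion i" unfolding coker_torsion_def
    proof (intro ballI, rule ex_nat_pow)
      fix a assume a: "a \<in> \<gamma> i"
      have "\<exists>n>0. \<exists>x\<in>carrier ?M. q (Suc i) a [^]\<^bsub>?A\<^esub> (n::int) = ?p x"
      proof (rule A.cokernel_torsion_if_kernel_torsion[OF facts])
        fix x assume x: "x \<in> carrier ?M" "?p x = \<one>\<^bsub>?A\<^esub>"
        then have "displace x \<in> \<gamma> (Suc i)" using oneQ displace_closed term_carrier by auto
        then obtain n where n: "n > 0" "x [^] (n::nat) \<in> \<gamma> (Suc i)"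
          using k x(1) unfolding ker_torsion_def by auto
        then show "\<exists>n>0. q (Suc i) x [^]\<^bsub>?A\<^esub> (n::int) = \<one>\<^bsub>?A\<^esub>"
          using pow[of x "int n"] x(1) oneQ[of "x [^] n"] term_carrier[of x i]
          by (intro exI[of _ "int n"]) (simp add: int_pow_int)
      qed (use a in auto)
      then obtain n x where n: "n > 0" "x \<in> \<gamma> i" "q (Suc i) a [^]\<^bsub>?A\<^esub> (n::int) = ?p x" by auto
      then have "a [^] n \<in> displaced i"
        using pow[OF a, of n] mem_displaced_iff[of "a [^] n" i] a term_carrier by auto
      with n show "\<exists>n>0. a [^] (n::int) \<in> displaced i" by blast
    qed
  next
    assume c: "coker_torsion i"
    show "ker_torsion i" unfolding ker_torsion_def
    proof (intro ballI impI, rule ex_nat_pow)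
      fix v assume v: "v \<in> \<gamma> i" "displace v \<in> \<gamma> (Suc i)"
      have "\<exists>n>0. q (Suc i) v [^]\<^bsub>?A\<^esub> (n::int) = \<one>\<^bsub>?A\<^esub>"
      proof (rule A.kernel_torsion_if_cokernel_torsion[OF facts])
        fix u assume "u \<in> carrier ?A"
        then obtain a where a: "a \<in> \<gamma> i" "u = q (Suc i) a" by auto
        then obtain n where n: "n > 0" "a [^] (n::nat) \<in> displaced i"
          using c unfolding coker_torsion_def by blast
        then obtain x where "x \<in> \<gamma> i" "q (Suc i) (a [^] n) = ?p x"
          using mem_displaced_iff a term_carrier by (metis nat_pow_closed)
        then show "\<exists>n>0. \<exists>x\<in>carrier ?M. u [^]\<^bsub>?A\<^esub> (n::int) = ?p x"
          using pow[OF a(1), of "int n"] n(1) a(2)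
          by (intro exI[of _ "int n"]) (auto simp: int_pow_int)
      qed (use v oneQ[of "displace v"] displace_closed term_carrier in auto)
      then obtain n where "n > 0" "q (Suc i) v [^]\<^bsub>?A\<^esub> (n::int) = \<one>\<^bsub>?A\<^esub>" by blast
      then show "\<exists>n>0. v [^] (n::int) \<in> \<gamma> (Suc i)"
        using pow[OF v(1), of n] oneQ[of "v [^] n"] v(1) term_carrier by auto
    qed
  qed
qed

text \<open>
  A power of \<open>x\<close> in \<open>\<gamma> j\<close> is in the kernel belonging to that
  factor, so that a further power descends to \<open>\<gamma> (Suc j)\<close>.
\<close>

lemma torsion_if_displace_in_term:
  assumes ker: "\<And>j. j < i \<Longrightarrow> ker_torsion j" and x: "x \<in> carrier G" "displace x \<in> \<gamma> i"
  shows "\<exists>t>0. x [^] (t::nat) \<in> \<gamma> i"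
proof -
  have "j \<le> i \<Longrightarrow> \<exists>t>0. x [^] (t::nat) \<in> \<gamma> j" for j
  proof (induction j)
    case 0
    then show ?case using x by (intro exI[of _ 1]) (simp add: top)
  next
    case (Suc j)
    then obtain t where t: "t > 0" "x [^] (t::nat) \<in> \<gamma> j" by auto
    have "displace (x [^] t) \<in> \<gamma> (Suc j)"
      using q_displace_pow[OF x, of t] term_antimono[OF Suc.prems] by blast
    then obtain n where "n > 0" "(x [^] t) [^] (n::nat) \<in> \<gamma> (Suc j)"
      using ker[of j] t Suc.prems unfolding ker_torsion_def by auto
    then show ?case using t x by (intro exI[of _ "t * n"]) (simp add: nat_pow_pow)
  qed
  then show ?thesis by blast
qed

abbreviation T where "T \<equiv> twisted_conj_rel G \<phi>"

lemma equiv_T: "equiv (carrier G) T" by (rule equiv_twisted_conj_rel[OF endo])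

lemma T_trans: "\<lbrakk>(a, b) \<in> T; (b, c) \<in> T\<rbrakk> \<Longrightarrow> (a, c) \<in> T"
  using equiv_T unfolding equiv_def trans_def by blast

lemma T_sym: "(a, b) \<in> T \<Longrightarrow> (b, a) \<in> T"
  using equiv_T unfolding equiv_def sym_def by blast

lemma T_refl: "a \<in> carrier G \<Longrightarrow> (a, a) \<in> T"
  using equiv_T unfolding equiv_def refl_on_def by blast

text \<open>
  By pigeonhole, two different powers of \<open>w \<in> \<gamma> i\<close> are conjugate.  The
  conjugating element \<open>x\<close> has a displacement congruent to \<open>w [^] d\<close> for
  some \<open>d > 0\<close>.  By the induction hypothesis a power \<open>x [^] t\<close> lies in
  \<open>\<gamma> i\<close>, and its displacement is congruent to \<open>w [^] (d * t)\<close>; so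
  the cokernel is torsion.
\<close>

lemma ker_torsion_if_finitely_many_classes:
  assumes fin: "finite (carrier G // T)"
  shows "ker_torsion i"
proof (induction i rule: less_induct)
  case (less i)
  have "coker_torsion i" unfolding coker_torsion_def
  proof
    fix w assume w: "w \<in> \<gamma> i"
    have wc: "w \<in> carrier G" using term_carrier[OF w] .
    have "(\<lambda>n. T `` {w [^] (n::nat)}) ` UNIV \<subseteq> carrier G // T"
      using wc by (auto intro: quotientI)
    then have "finite (range (\<lambda>n. T `` {w [^] (n::nat)}))" using fin by (rule finite_subset)
    then have "\<not> inj (\<lambda>n. T `` {w [^] (n::nat)})"
      using finite_imageD[of "\<lambda>n. T `` {w [^] (n::nat)}" UNIV] by auto
    then obtain l1 l2 where l: "T `` {w [^] (l1::nat)} = T `` {w [^] (l2::nat)}" "l1 \<noteq> l2"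
      by (auto simp: inj_def)
    then have "(w [^] l1, w [^] l2) \<in> T" using eq_equiv_class[OF l(1) equiv_T] wc by simp
    then obtain n1 n2 :: nat where n: "n1 < n2" "(w [^] n1, w [^] n2) \<in> T"
      using l(2) T_sym by (metis linorder_neqE_nat)
    then obtain x where x: "x \<in> carrier G" "\<phi> x \<otimes> w [^] n1 = w [^] n2 \<otimes> x"
      by (auto simp: twisted_conj_rel_def)
    define d where "d = n2 - n1"
    have n2: "w [^] n2 = w [^] d \<otimes> w [^] n1" using n(1) wc by (simp add: d_def nat_pow_mult)
    have "\<phi> x = (\<phi> x \<otimes> w [^] n1) \<otimes> inv (w [^] n1)" using x(1) wc by (simp add: m_assoc)
    then have disp: "displace x = w [^] n2 \<otimes> (x \<otimes> inv (w [^] n1) \<otimes> inv x)"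
      unfolding x(2) displace_def using x(1) wc by (simp add: group_norm)
    interpret Q: group_hom G "G Mod \<gamma> (Suc i)" "q (Suc i)" by (rule q_hom)
    have wi: "inv (w [^] n1) \<in> \<gamma> i" by (rule subgroup.m_inv_closed[OF term_subgroup term_pow[OF w]])
    have di: "displace x \<in> \<gamma> i"
      unfolding disp
      by (rule subgroup.m_closed[OF term_subgroup term_pow[OF w] normal.inv_op_closed2[OF term_normal x(1) wi]])
    have "q (Suc i) (displace x) = q (Suc i) (w [^] n2 \<otimes> inv (w [^] n1))"
      unfolding disp using q_conj[OF wi x(1)] x(1) wc by (simp del: Q.hom_inv)
    also have "w [^] n2 \<otimes> inv (w [^] n1) = w [^] d" unfolding n2 using wc by (simp add: m_assoc)
    finally have qd: "q (Suc i) (displace x) = q (Suc i) (w [^] d)" .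
    obtain t where t: "t > 0" "x [^] (t::nat) \<in> \<gamma> i"
      using torsion_if_displace_in_term[OF less x(1) di] by blast
    have "q (Suc i) (displace (x [^] t)) = q (Suc i) (displace x [^] t)"
      using q_displace_pow[OF x(1) di] by blast
    also have "\<dots> = q (Suc i) (w [^] (d * t))"
      using qd wc displace_closed[OF x(1)] by (simp add: Q.hom_nat_pow flip: nat_pow_pow)
    finally have "w [^] (d * t) \<in> displaced i"
      using t(2) wc by (subst mem_displaced_iff) auto
    then show "\<exists>n>0. w [^] (n::nat) \<in> displaced i"
      using t(1) n(1) by (intro exI[of _ "d * t"]) (simp add: d_def)
  qed
  then show ?case by (simp add: ker_torsion_iff_coker_torsion)
qed

text \<open>
  One term of the series at a time: a remainder \<open>displace x \<otimes> z\<close> with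
  \<open>x \<in> \<gamma> i\<close> and \<open>z \<in> \<gamma> (Suc i)\<close> is removed by
  conjugating with \<open>inv x\<close>, which changes the part already in normal form only by
  elements of the next term.
\<close>

lemma every_element_conj_to_box:
  assumes Z: "\<And>i. i < k \<Longrightarrow> generate G (set (Z i)) = \<gamma> i"
    and m: "m > 0" "\<And>i y. \<lbrakk>i < k; y \<in> set (Z i)\<rbrakk> \<Longrightarrow> y [^] (m::nat) \<in> displaced i"
    and g: "g \<in> carrier G"
  shows "\<exists>b\<in>box m (concat (map Z [0..<k])). (g, b) \<in> T"
proof -
  have Zi: "set (Z i) \<subseteq> \<gamma> i" if "i < k" for i
    using Z[OF that] generate.incl[of _ "set (Z i)" G] by auto
  have Zc: "set (Z i) \<subseteq> carrier G" if "i < k" for i using Zi[OF that] term_carrier by auto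
  have "i \<le> k \<Longrightarrow> \<exists>b\<in>box m (concat (map Z [0..<i])). \<exists>a\<in>\<gamma> i. (g, b \<otimes> a) \<in> T" for i
  proof (induction i)
    case 0
    then show ?case using g T_refl by (auto simp: top)
  next
    case (Suc i)
    then obtain f a where f: "f \<in> box m (concat (map Z [0..<i]))" and a: "a \<in> \<gamma> i" "(g, f \<otimes> a) \<in> T"
      by auto
    have i: "i < k" using Suc.prems by simp
    have Zci: "set (concat (map Z [0..<i])) \<subseteq> carrier G"
    proof
      fix y assume "y \<in> set (concat (map Z [0..<i]))"
      then obtain j where "j < i" "y \<in> set (Z j)" by auto
      then show "y \<in> carrier G" using Zc[of j] i by auto
    qed
    have "a \<in> generate G (set (Z i) \<union> displaced i)"
      using mono_generate[of "set (Z i)" "set (Z i) \<union> displaced i"] Z[OF i] a(1) by auto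
    from box_decomposition[OF displaced_subgroup term_Suc_displaced displaced_subset Zi[OF i] m(1) m(2)[OF i] this]
    obtain b d where b: "b \<in> box m (Z i)" "d \<in> displaced i" "a = b \<otimes> d" by auto
    then obtain x z where x: "x \<in> \<gamma> i" "z \<in> \<gamma> (Suc i)" "d = displace x \<otimes> z"
      unfolding displaced_def by auto
    have c: "f \<in> carrier G" "b \<in> carrier G" "x \<in> carrier G" "z \<in> carrier G"
      using f b x box_closed[OF Zci, of m] box_closed[OF Zc[OF i], of m] term_carrier by auto
    define h where "h = f \<otimes> b"
    have hc: "h \<in> carrier G" using c by (simp add: h_def)
    have px: "\<phi> x \<in> \<gamma> i" using x(1) term_invariant by auto
    interpret Q: group_hom G "G Mod \<gamma> (Suc i)" "q (Suc i)" by (rule q_hom)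
    let ?g = "\<phi> (inv x) \<otimes> (h \<otimes> displace x \<otimes> z) \<otimes> x"
    have "?g = inv (\<phi> x) \<otimes> h \<otimes> \<phi> x \<otimes> (inv x \<otimes> z \<otimes> inv (inv x))"
      using c hc by (simp add: displace_def group_norm)
    also have "q (Suc i) \<dots> = q (Suc i) (inv (\<phi> x) \<otimes> h \<otimes> \<phi> x)"
      using normal.inv_op_closed1[OF term_normal c(3) x(2)] c hc by (intro q_mult_term) auto
    also have "\<dots> = q (Suc i) (inv (\<phi> x) \<otimes> (h \<otimes> \<phi> x))" using c hc by (simp add: m_assoc)
    also have "\<dots> = q (Suc i) (inv (\<phi> x)) \<otimes>\<^bsub>G Mod \<gamma> (Suc i)\<^esub> q (Suc i) (\<phi> x \<otimes> h)"
      using q_central[OF px hc] c hc by (simp del: Q.hom_inv)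
    also have "\<dots> = q (Suc i) (inv (\<phi> x) \<otimes> (\<phi> x \<otimes> h))" using c hc by (simp del: Q.hom_inv)
    also have "\<dots> = q (Suc i) h" using c hc by (simp add: cancel_left')
    finally have "q (Suc i) ?g = q (Suc i) h" .
    then obtain z' where z': "z' \<in> \<gamma> (Suc i)" "?g = h \<otimes> z'"
      using q_eqE[of ?g h "Suc i"] c hc displace_closed by auto
    have "(h \<otimes> displace x \<otimes> z, ?g) \<in> T"
      by (rule twisted_conj_relI[of _ _ "inv x"]) (use c hc displace_closed in \<open>auto simp: m_assoc\<close>)
    moreover have "f \<otimes> a = h \<otimes> displace x \<otimes> z"
      using b x c displace_closed by (simp add: h_def m_assoc)
    ultimately have "(g, h \<otimes> z') \<in> T" using a(2) z'(2) T_trans by metis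
    moreover have "h \<in> box m (concat (map Z [0..<Suc i]))"
      using box_append[OF Zci Zc[OF i] f b(1)] by (simp add: h_def)
    ultimately show ?case using z'(1) by blast
  qed
  from this[of k] obtain b where b: "b \<in> box m (concat (map Z [0..<k]))" "(g, b \<otimes> \<one>) \<in> T"
    by (auto simp: bottom)
  moreover have "set (concat (map Z [0..<k])) \<subseteq> carrier G" using Zc by fastforce
  then have "b \<in> carrier G" using b(1) box_closed[of "concat (map Z [0..<k])" m] by blast
  ultimately show ?thesis by auto
qed

lemma common_exponent_if_coker_torsion:
  assumes "\<And>i. i < k \<Longrightarrow> coker_torsion i" and Z: "\<And>i. i < k \<Longrightarrow> set (Z i) \<subseteq> \<gamma> i"
  shows "\<exists>m>0. \<forall>i<k. \<forall>y\<in>set (Z i). y [^] (m::nat) \<in> displaced i"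
proof -
  let ?A = "Sigma {..<k} (\<lambda>i. set (Z i))"
  let ?Q = "\<lambda>(i, y) n. y \<in> carrier G \<and> y [^] (n::nat) \<in> displaced i"
  have "\<exists>m>0. \<forall>a\<in>?A. ?Q a m"
  proof (rule common_multiple)
    show "finite ?A" by auto
    show "\<exists>n>0. ?Q a n" if "a \<in> ?A" for a
    proof -
      obtain i y where a: "a = (i, y)" "i < k" "y \<in> set (Z i)" using \<open>a \<in> ?A\<close> by auto
      then have y: "y \<in> \<gamma> i" using Z by blast
      then obtain n where "n > 0" "y [^] (n::nat) \<in> displaced i"
        using assms(1)[OF a(2)] unfolding coker_torsion_def by blast
      then show ?thesis using a(1) term_carrier[OF y] by auto
    qed
    show "?Q a (n * c)" if "?Q a n" for a n c
    proof -
      obtain i y where a: "a = (i, y)" by (cases a)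
      have "y [^] (n * c) = (y [^] n) [^] int c"
        using that a by (simp add: nat_pow_pow int_pow_int)
      then show ?thesis using that a subgroup_int_pow_closed[OF displaced_subgroup, of "y [^] n" i "int c"] by simp
    qed
  qed
  then show ?thesis by auto
qed

end

locale fg_central_series_surj = fg_central_series_endo +
  assumes surj: "\<phi> ` carrier G = carrier G"
begin

lemma quotient_series:
  assumes K: "K \<lhd> G" "\<phi> ` K \<subseteq> K"
  obtains \<psi> where "fg_central_series_endo (G Mod K) (\<lambda>i. (#>) K ` \<gamma> i) k \<psi>"
    and "\<And>x. x \<in> carrier G \<Longrightarrow> \<psi> (K #> x) = K #> \<phi> x"
proof -
  interpret K: normal K G by fact
  interpret P: group_hom G "G Mod K" "(#>) K"
    by (intro group_hom.intro group_hom_axioms.intro K.factorgroup_is_group K.r_coset_hom_Mod is_group)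
  have h: "(\<lambda>x. K #> \<phi> x) \<in> hom G (G Mod K)"
    by (auto simp: hom_def)
  have wd: "K #> \<phi> x = K #> \<phi> y" if "x \<in> carrier G" "y \<in> carrier G" "K #> x = K #> y" for x y
  proof -
    have "x \<in> K #> y" using that rcos_self[OF _ K.is_subgroup] by blast
    then obtain u where u: "u \<in> K" "x = u \<otimes> y" by (auto simp: r_coset_def)
    then have "\<phi> x = \<phi> u \<otimes> \<phi> y" "\<phi> u \<in> K" using K that by auto
    then have "\<phi> x \<in> K #> \<phi> y" by (auto simp: r_coset_def)
    from repr_independence[OF this _ K.is_subgroup] that show ?thesis by simp
  qed
  obtain \<psi> where \<psi>: "\<psi> \<in> hom (G Mod K) (G Mod K)" "\<And>x. x \<in> carrier G \<Longrightarrow> \<psi> (K #> x) = K #> \<phi> x"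
    using FactGroup_universal[OF h K(1) wd] by blast
  have "fg_central_series_endo (G Mod K) (\<lambda>i. (#>) K ` \<gamma> i) k \<psi>"
  proof (intro fg_central_series_endo.intro fg_central_series.intro P.H.group_axioms
      fg_central_series_axioms.intro fg_central_series_endo_axioms.intro)
    show "(#>) K ` \<gamma> 0 = carrier (G Mod K)" by (simp add: top carrier_FactGroup)
    show "(#>) K ` \<gamma> k = {\<one>\<^bsub>G Mod K\<^esub>}" by (simp add: bottom)
    show "subgroup ((#>) K ` \<gamma> i) (G Mod K)" for i
      by (rule P.subgroup_img_is_subgroup[OF term_subgroup])
    show "(#>) K ` \<gamma> (Suc i) \<subseteq> (#>) K ` \<gamma> i" for i using term_Suc by blast
    show "\<exists>S. finite S \<and> generate (G Mod K) S = (#>) K ` \<gamma> i" for i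
    proof -
      obtain S where S: "finite S" "generate G S = \<gamma> i" using term_fg by blast
      have "S \<subseteq> carrier G" using generate.incl[of _ S G] S(2) term_carrier by blast
      from P.generate_img[OF this] S show ?thesis by (intro exI[of _ "(#>) K ` S"]) auto
    qed
    show "\<psi> ` (#>) K ` \<gamma> i \<subseteq> (#>) K ` \<gamma> i" for i
      using \<psi>(2) term_carrier term_invariant[of i] by (auto simp: image_iff) (metis imageI subsetD)
    show "x \<otimes>\<^bsub>G Mod K\<^esub> y \<otimes>\<^bsub>G Mod K\<^esub> inv\<^bsub>G Mod K\<^esub> x \<otimes>\<^bsub>G Mod K\<^esub> inv\<^bsub>G Mod K\<^esub> y \<in> (#>) K ` \<gamma> (Suc i)"
      if xy: "x \<in> (#>) K ` \<gamma> i" "y \<in> carrier (G Mod K)" for x y i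
    proof -
      obtain a b where ab: "a \<in> \<gamma> i" "x = K #> a" "b \<in> carrier G" "y = K #> b"
        using xy by (auto simp: carrier_FactGroup)
      then have "K #> (a \<otimes> b \<otimes> inv a \<otimes> inv b) \<in> (#>) K ` \<gamma> (Suc i)" using commutator by blast
      then show ?thesis using ab term_carrier by simp
    qed
  qed (rule \<psi>(1))
  then show ?thesis using that \<psi>(2) by blast
qed

text \<open>
  Let \<open>K\<close> be maximal among the invariant normal subgroups whose cosets lie within
  classes.  In the quotient by \<open>K\<close>, the displacements of central elements form an
  invariant normal subgroup whose preimage has the same property, so by maximality they are trivial:
  the induced map fixes the centre.  The quotient has finitely many classes as well, so all its
  kernels are torsion, and therefore its fixed elements have finite order.  Its centre being
  torsion, the quotient is finite.
\<close>

lemma finite_index_normal_subgroup_within_classes: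
  assumes fin: "finite (carrier G // T)"
  shows "\<exists>K. K \<lhd> G \<and> finite (rcosets K) \<and> (\<forall>g\<in>carrier G. \<forall>h\<in>K. (h \<otimes> g, g) \<in> T)"
proof -
  define Ks where "Ks = {K. K \<lhd> G \<and> \<phi> ` K \<subseteq> K \<and> (\<forall>g\<in>carrier G. \<forall>h\<in>K. (h \<otimes> g, g) \<in> T)}"
  have "\<exists>K\<in>Ks. \<forall>L\<in>Ks. K \<subseteq> L \<longrightarrow> L = K"
  proof (rule subset_Zorn_nonempty)
    have "{\<one>} \<in> Ks" using one_is_normal T_refl by (auto simp: Ks_def)
    then show "Ks \<noteq> {}" by blast
  next
    fix C assume C: "C \<noteq> {}" "subset.chain Ks C"
    have CK: "A \<lhd> G" "\<phi> ` A \<subseteq> A" "\<forall>g\<in>carrier G. \<forall>h\<in>A. (h \<otimes> g, g) \<in> T" if "A \<in> C" for A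
      using C(2) that unfolding subset.chain_def Ks_def by blast+
    have sub: "subgroup A G" if "A \<in> C" for A using CK(1)[OF that] normal_imp_subgroup by blast
    have "subgroup (\<Union>C) G"
    proof (rule subgroupI)
      show "\<Union>C \<subseteq> carrier G" using subgroup.subset[OF sub] by blast
      obtain A where "A \<in> C" using C(1) by blast
      then show "\<Union>C \<noteq> {}" using subgroup.one_closed[OF sub] by blast
      show "inv a \<in> \<Union>C" if a: "a \<in> \<Union>C" for a
      proof -
        obtain A where "A \<in> C" "a \<in> A" using a by blast
        then show ?thesis using subgroup.m_inv_closed[OF sub] by blast
      qed
      show "a \<otimes> b \<in> \<Union>C" if ab: "a \<in> \<Union>C" "b \<in> \<Union>C" for a b
      proof -
        obtain A B where "A \<in> C" "B \<in> C" "a \<in> A" "b \<in> B" using ab by blast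
        moreover from this have "A \<subseteq> B \<or> B \<subseteq> A"
          using C(2) unfolding subset.chain_def by blast
        ultimately obtain D where "D \<in> C" "a \<in> D" "b \<in> D" by blast
        then show ?thesis using subgroup.m_closed[OF sub] by blast
      qed
    qed
    then have "\<Union>C \<lhd> G"
    proof (rule normal_invI)
      fix x h assume "x \<in> carrier G" "h \<in> \<Union>C"
      then show "x \<otimes> h \<otimes> inv x \<in> \<Union>C" using normal_invE(2)[OF CK(1)] by blast
    qed
    then show "\<Union>C \<in> Ks" unfolding Ks_def using CK(2,3) by blast
  qed
  then obtain K where K: "K \<in> Ks" and max: "\<And>A. \<lbrakk>A \<in> Ks; K \<subseteq> A\<rbrakk> \<Longrightarrow> A = K" by blast
  have Kn: "K \<lhd> G" and K\<phi>: "\<phi> ` K \<subseteq> K" and KT: "\<And>g h. \<lbrakk>g \<in> carrier G; h \<in> K\<rbrakk> \<Longrightarrow> (h \<otimes> g, g) \<in> T"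
    using K unfolding Ks_def by blast+
  interpret K: normal K G by fact
  obtain \<psi> where "fg_central_series_endo (G Mod K) (\<lambda>i. (#>) K ` \<gamma> i) k \<psi>"
    and \<psi>: "\<And>x. x \<in> carrier G \<Longrightarrow> \<psi> (K #> x) = K #> \<phi> x"
    using quotient_series[OF Kn K\<phi>] by blast
  then interpret Q: fg_central_series_endo "G Mod K" "\<lambda>i. (#>) K ` \<gamma> i" k \<psi> by blast
  interpret P: group_hom G "G Mod K" "(#>) K"
    by (intro group_hom.intro group_hom_axioms.intro Q.is_group K.r_coset_hom_Mod is_group)
  have Kc: "carrier (G Mod K) = (#>) K ` carrier G" by (rule carrier_FactGroup)
  \<comment> \<open>Projection maps the classes onto the classes of the quotient.\<close>
  have "finite (carrier (G Mod K) // Q.T)"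
  proof (rule finite_subset)
    show "carrier (G Mod K) // Q.T \<subseteq> (\<lambda>C. Q.T `` {K #> (SOME g. g \<in> C)}) ` (carrier G // T)"
    proof
      fix D assume "D \<in> carrier (G Mod K) // Q.T"
      then obtain g where g: "g \<in> carrier G" "D = Q.T `` {K #> g}" by (auto simp: quotient_def Kc)
      define h where "h = (SOME h. h \<in> T `` {g})"
      have "g \<in> T `` {g}" using T_refl g by blast
      then have "h \<in> T `` {g}" unfolding h_def by (rule someI)
      then obtain x where x: "h \<in> carrier G" "x \<in> carrier G" "\<phi> x \<otimes> g = h \<otimes> x"
        by (auto simp: twisted_conj_rel_def)
      have "\<psi> (K #> x) \<otimes>\<^bsub>G Mod K\<^esub> (K #> g) = K #> (\<phi> x \<otimes> g)" using g x(1,2) \<psi> by simp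
      also have "\<dots> = (K #> h) \<otimes>\<^bsub>G Mod K\<^esub> (K #> x)" unfolding x(3) using x(1,2) by simp
      finally have "(K #> g, K #> h) \<in> Q.T"
        using g x by (intro Q.twisted_conj_relI[of _ _ "K #> x"]) auto
      then have "D = Q.T `` {K #> h}" unfolding g(2) by (rule equiv_class_eq[OF Q.equiv_T])
      moreover have "T `` {g} \<in> carrier G // T" using g by (auto intro: quotientI)
      ultimately show "D \<in> (\<lambda>C. Q.T `` {K #> (SOME g. g \<in> C)}) ` (carrier G // T)"
        unfolding h_def by blast
    qed
  qed (use fin in blast)
  then have ker: "Q.ker_torsion i" for i by (rule Q.ker_torsion_if_finitely_many_classes)
  \<comment> \<open>The candidate \<open>L\<close> that maximality is applied to: the preimage of the displacements of the centre.\<close>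
  let ?Q = "G Mod K"
  define C where "C = {z \<in> carrier ?Q. \<forall>y\<in>carrier ?Q. z \<otimes>\<^bsub>?Q\<^esub> y = y \<otimes>\<^bsub>?Q\<^esub> z}"
  define D where "D = (\<lambda>z. \<psi> z \<otimes>\<^bsub>?Q\<^esub> inv\<^bsub>?Q\<^esub> z) ` C"
  have \<psi>surj: "\<psi> ` carrier ?Q = carrier ?Q"
  proof -
    have "\<psi> ` (#>) K ` carrier G = (#>) K ` \<phi> ` carrier G" using \<psi> by force
    then show ?thesis by (simp add: Kc surj)
  qed
  note D = Q.central_displacements_normal[OF Q.endo \<psi>surj, folded C_def, folded D_def]
  interpret D: normal D ?Q by (rule D(1))
  define L where "L = {h \<in> carrier G. K #> h \<in> D}"
  have "L \<in> Ks" unfolding Ks_def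
  proof (intro CollectI conjI ballI)
    have "subgroup L G"
      by (rule subgroupI) (use D.one_closed in \<open>auto simp: L_def intro: exI[of _ \<one>]\<close>)
    then show "L \<lhd> G" by (rule normal_invI) (auto simp: L_def D.inv_op_closed2)
    show "\<phi> ` L \<subseteq> L" using D(2) by (auto simp: L_def simp flip: \<psi>)
  next
    fix g h assume g: "g \<in> carrier G" and "h \<in> L"
    then obtain z where h: "h \<in> carrier G" and zC: "K #> z \<in> C" and z: "z \<in> carrier G"
      and eq: "K #> h = \<psi> (K #> z) \<otimes>\<^bsub>?Q\<^esub> inv\<^bsub>?Q\<^esub> (K #> z)"
      by (auto simp: L_def D_def C_def Kc)
    let ?f = "\<phi> z \<otimes> g \<otimes> inv z"
    have swap: "inv\<^bsub>?Q\<^esub> (K #> z) \<otimes>\<^bsub>?Q\<^esub> (K #> g) = (K #> g) \<otimes>\<^bsub>?Q\<^esub> inv\<^bsub>?Q\<^esub> (K #> z)"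
      using Q.center_inv[of "K #> z"] zC g unfolding C_def by auto
    have "K #> (h \<otimes> g) = K #> ?f"
      using h g z swap by (simp add: eq \<psi> Q.m_assoc)
    then have "h \<otimes> g \<in> K #> ?f" using rcos_self[OF _ K.is_subgroup, of "h \<otimes> g"] h g by simp
    then obtain u where u: "u \<in> K" "h \<otimes> g = u \<otimes> ?f" by (auto simp: r_coset_def)
    have "(h \<otimes> g, ?f) \<in> T" unfolding u(2) using KT[OF _ u(1)] z g by simp
    moreover have "(g, ?f) \<in> T"
      by (rule twisted_conj_relI[of _ _ z]) (use z g in \<open>auto simp: m_assoc\<close>)
    ultimately show "(h \<otimes> g, g) \<in> T" using T_trans T_sym by blast
  qed
  moreover have "K \<subseteq> L"
  proof
    fix h assume h: "h \<in> K"
    then have "K #> h = \<one>\<^bsub>?Q\<^esub>" using coset_join2[OF _ K.is_subgroup h] K.subset by (auto simp: one_FactGroup)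
    then show "h \<in> L" unfolding L_def using h K.subset D.one_closed by auto
  qed
  ultimately have LK: "L = K" by (rule max)
  have "finite (carrier ?Q)"
  proof (rule Q.finite_if_center_torsion)
    fix Z assume Z: "Z \<in> carrier ?Q" "\<And>y. y \<in> carrier ?Q \<Longrightarrow> Z \<otimes>\<^bsub>?Q\<^esub> y = y \<otimes>\<^bsub>?Q\<^esub> Z"
    then obtain z where z: "z \<in> carrier G" "Z = K #> z" by (auto simp: Kc)
    have "\<psi> Z \<otimes>\<^bsub>?Q\<^esub> inv\<^bsub>?Q\<^esub> Z \<in> D" unfolding D_def C_def using Z by blast
    then have "displace z \<in> L" unfolding L_def using z \<psi> displace_closed by (simp add: displace_def)
    then have "K #> displace z = \<one>\<^bsub>?Q\<^esub>"
      using coset_join2[OF displace_closed[OF z(1)] K.is_subgroup] LK by (simp add: one_FactGroup)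
    then have "Q.displace Z \<in> (#>) K ` \<gamma> k"
      unfolding Q.bottom Q.displace_def z(2) using z \<psi> by (simp add: displace_def)
    from Q.torsion_if_displace_in_term[OF ker Z(1) this]
    show "\<exists>n>0. Z [^]\<^bsub>?Q\<^esub> (n::nat) = \<one>\<^bsub>?Q\<^esub>" by (simp add: Q.bottom)
  qed
  then have "finite (rcosets K)" by (simp add: FactGroup_def)
  then show ?thesis using Kn KT by blast
qed

end

section \<open>The lower central series\<close>

declare lower_central.simps(2) [simp del]

context group
begin

definition comm :: "'a \<Rightarrow> 'a \<Rightarrow> 'a" where "comm x y = x \<otimes> y \<otimes> inv x \<otimes> inv y"

lemma comm_closed: "\<lbrakk>x \<in> carrier G; y \<in> carrier G\<rbrakk> \<Longrightarrow> comm x y \<in> carrier G"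
  by (simp add: comm_def)

lemma lower_central_Suc: "lower_central G (Suc i) = generate G {comm x y | x y. x \<in> lower_central G i \<and> y \<in> carrier G}"
proof -
  have "(\<Union>x\<in>lower_central G i. \<Union>y\<in>carrier G. {x \<otimes> y \<otimes> inv x \<otimes> inv y}) =
      {comm x y | x y. x \<in> lower_central G i \<and> y \<in> carrier G}"
    unfolding comm_def by blast
  then show ?thesis by (simp add: lower_central.simps(2))
qed

lemma lower_central_normal_and_decreasing:
  "lower_central G i \<lhd> G \<and> lower_central G (Suc i) \<subseteq> lower_central G i"
proof (induction i)
  case 0
  have "generate G {comm x y | x y. x \<in> lower_central G 0 \<and> y \<in> carrier G} \<subseteq> carrier G"
    by (rule generate_incl) (auto intro: comm_closed)
  then show ?case unfolding lower_central_Suc using normal_self by simp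
next
  case (Suc i)
  let ?A = "lower_central G i"
  have An: "?A \<lhd> G" and AA: "lower_central G (Suc i) \<subseteq> ?A" using Suc by auto
  have Ac: "?A \<subseteq> carrier G" using normal_imp_subgroup[OF An] subgroup.subset by blast
  have n: "lower_central G (Suc i) \<lhd> G"
    unfolding lower_central_Suc
  proof (rule normal_generateI)
    show "{comm x y | x y. x \<in> ?A \<and> y \<in> carrier G} \<subseteq> carrier G" using Ac comm_closed by blast
    fix h g assume "h \<in> {comm x y | x y. x \<in> ?A \<and> y \<in> carrier G}" and g: "g \<in> carrier G"
    then obtain x y where h: "h = comm x y" "x \<in> ?A" "y \<in> carrier G" by blast
    have "g \<otimes> h \<otimes> inv g = comm (g \<otimes> x \<otimes> inv g) (g \<otimes> y \<otimes> inv g)"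
      using h Ac g by (auto simp: comm_def group_norm)
    moreover have "g \<otimes> x \<otimes> inv g \<in> ?A" using normal_invE(2)[OF An g h(2)] .
    ultimately show "g \<otimes> h \<otimes> inv g \<in> {comm x y | x y. x \<in> ?A \<and> y \<in> carrier G}" using h g by blast
  qed
  moreover have "lower_central G (Suc (Suc i)) \<subseteq> lower_central G (Suc i)"
    by (subst (1 2) lower_central_Suc, rule mono_generate) (use AA in blast)
  ultimately show ?case by blast
qed

lemmas lower_central_normal = lower_central_normal_and_decreasing[THEN conjunct1]
lemmas lower_central_decreasing = lower_central_normal_and_decreasing[THEN conjunct2]
lemmas lower_central_subgroup = normal_imp_subgroup[OF lower_central_normal]

lemma lower_central_commutator:
  "\<lbrakk>x \<in> lower_central G i; y \<in> carrier G\<rbrakk> \<Longrightarrow> comm x y \<in> lower_central G (Suc i)"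
  unfolding lower_central_Suc by (rule generate.incl) blast

lemma lower_central_hom_image:
  assumes \<phi>: "\<phi> \<in> hom G G"
  shows "\<phi> ` lower_central G i \<subseteq> lower_central G i"
proof (induction i)
  interpret \<phi>: group_hom G G \<phi> by (intro group_hom.intro group_hom_axioms.intro is_group \<phi>)
  {
    case 0
    show ?case by auto
  next
    case (Suc i)
    let ?A = "{comm x y | x y. x \<in> lower_central G i \<and> y \<in> carrier G}"
    have Lc: "lower_central G i \<subseteq> carrier G" using lower_central_subgroup subgroup.subset by blast
    then have Ac: "?A \<subseteq> carrier G" using comm_closed by blast
    have "\<phi> ` ?A \<subseteq> ?A"
    proof
      fix u assume "u \<in> \<phi> ` ?A"
      then obtain x y where u: "u = \<phi> (comm x y)" "x \<in> lower_central G i" "y \<in> carrier G" by blast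
      then have "u = comm (\<phi> x) (\<phi> y)" using Lc by (auto simp: comm_def)
      moreover have "\<phi> x \<in> lower_central G i" "\<phi> y \<in> carrier G" using u Suc by auto
      ultimately show "u \<in> ?A" by blast
    qed
    then show ?case
      unfolding lower_central_Suc \<phi>.generate_img[OF Ac, symmetric] by (rule mono_generate)
  }
qed

text \<open>
  Modulo the next term but one, the commutator is multiplicative in both arguments, so the
  commutators of generators generate.  This is shown in the second argument first, for a fixed
  generator in the first one.
\<close>

lemma lower_central_fg_mod_next:
  assumes S: "finite S" "generate G S = carrier G"
  shows "\<exists>U. finite U \<and> U \<subseteq> lower_central G i \<and> lower_central G i \<subseteq> generate G (U \<union> lower_central G (Suc i))"
proof (induction i)
  case 0
  have "S \<subseteq> carrier G" using generate.incl[of _ S G] S by auto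
  then show ?case using S mono_generate[of S "S \<union> lower_central G (Suc 0)"]
    by (intro exI[of _ S]) auto
next
  case (Suc i)
  let ?L = "lower_central G"
  obtain U where U: "finite U" "U \<subseteq> ?L i" "?L i \<subseteq> generate G (U \<union> ?L (Suc i))" using Suc by blast
  have Lc: "?L j \<subseteq> carrier G" for j using lower_central_subgroup subgroup.subset by blast
  have Sc: "S \<subseteq> carrier G" using generate.incl[of _ S G] S by auto
  define V where "V = (\<lambda>(u, s). comm u s) ` (U \<times> S)"
  have V: "finite V" "V \<subseteq> ?L (Suc i)"
    unfolding V_def using U(1) S(1) subsetD[OF U(2)] subsetD[OF Sc] lower_central_commutator[of _ i] by auto
  let ?H = "generate G (V \<union> ?L (Suc (Suc i)))"
  have Hc: "V \<union> ?L (Suc (Suc i)) \<subseteq> carrier G" using V(2) Lc by blast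
  have H: "subgroup ?H G" by (rule generate_is_subgroup[OF Hc])
  have HL: "?H \<subseteq> ?L (Suc i)"
    by (rule generate_subgroup_incl[OF _ lower_central_subgroup]) (use V(2) lower_central_decreasing in blast)
  have conj: "x \<otimes> c \<otimes> inv x \<in> ?H" if c: "c \<in> ?H" and x: "x \<in> carrier G" for c x
  proof -
    have cc: "c \<in> carrier G" using c subgroup.mem_carrier[OF H] by blast
    have "comm c x \<in> ?H"
      using lower_central_commutator[of c "Suc i" x] c HL x by (auto intro: generate.incl)
    then have "inv (comm c x) \<otimes> c \<in> ?H" using c by (intro subgroup.m_closed[OF H] subgroup.m_inv_closed[OF H])
    then show ?thesis using cc x by (simp add: comm_def group_norm)
  qed
  have second: "comm x y \<in> ?H"
    if x: "x \<in> carrier G" and base: "\<And>s. s \<in> S \<Longrightarrow> comm x s \<in> ?H" and y: "y \<in> carrier G" for x y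
  proof -
    have "y \<in> generate G S" using y S by simp
    then show ?thesis
    proof induction
      case one
      then show ?case using x subgroup.one_closed[OF H] by (simp add: comm_def)
    next
      case (incl h)
      then show ?case by (rule base)
    next
      case (inv h)
      have hc: "h \<in> carrier G" using inv Sc by blast
      have "comm x (inv h) = inv h \<otimes> inv (comm x h) \<otimes> inv (inv h)"
        using x hc by (simp add: comm_def group_norm)
      then show ?case using conj[OF subgroup.m_inv_closed[OF H base[OF inv]] inv_closed[OF hc]] by metis
    next
      case (eng h1 h2)
      have hc: "h1 \<in> carrier G" "h2 \<in> carrier G" using eng S(2) by auto
      have "comm x (h1 \<otimes> h2) = comm x h1 \<otimes> (h1 \<otimes> comm x h2 \<otimes> inv h1)"
        using x hc by (simp add: comm_def group_norm)
      then show ?case using conj[OF eng.IH(2) hc(1)] eng.IH(1) subgroup.m_closed[OF H] by simp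
    qed
  qed
  have first: "comm x y \<in> ?H" if x: "x \<in> ?L i" and y: "y \<in> carrier G" for x y
  proof -
    have base: "comm h y \<in> ?H" if "h \<in> U \<union> ?L (Suc i)" for h
      using that
    proof
      assume h: "h \<in> U"
      have "comm h s \<in> ?H" if "s \<in> S" for s
        by (rule generate.incl) (use h that in \<open>auto simp: V_def\<close>)
      then show ?thesis using second[of h y] h U(2) Lc y by blast
    next
      assume "h \<in> ?L (Suc i)"
      then show ?thesis using lower_central_commutator[of h "Suc i" y] y by (auto intro: generate.incl)
    qed
    have "x \<in> generate G (U \<union> ?L (Suc i))" using x U(3) by blast
    then show ?thesis
    proof induction
      case one
      then show ?case using y subgroup.one_closed[OF H] by (simp add: comm_def)
    next
      case (incl h)
      then show ?case by (rule base)
    next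
      case (inv h)
      have hc: "h \<in> carrier G" using inv U(2) Lc by blast
      have "comm h y \<in> ?H" by (rule base[OF inv])
      moreover have "comm (inv h) y = inv h \<otimes> inv (comm h y) \<otimes> inv (inv h)"
        using y hc by (simp add: comm_def group_norm)
      ultimately show ?case using conj[OF subgroup.m_inv_closed[OF H] inv_closed[OF hc], of "comm h y"] by metis
    next
      case (eng h1 h2)
      have "U \<union> ?L (Suc i) \<subseteq> carrier G" using U(2) Lc by blast
      then have hc: "h1 \<in> carrier G" "h2 \<in> carrier G" using eng generate_in_carrier by blast+
      have "comm (h1 \<otimes> h2) y = (h1 \<otimes> comm h2 y \<otimes> inv h1) \<otimes> comm h1 y"
        using y hc by (simp add: comm_def group_norm)
      then show ?case using conj[OF eng.IH(2) hc(1)] eng.IH(1) subgroup.m_closed[OF H] by simp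
    qed
  qed
  have "?L (Suc i) \<subseteq> ?H" unfolding lower_central_Suc[of i]
    by (rule generate_subgroup_incl[OF _ H]) (use first in blast)
  with V show ?case by blast
qed

text \<open>Generators of the terms are collected from the bottom of the series upwards.\<close>

lemma lower_central_fg_central_series:
  assumes S: "finite S" "generate G S = carrier G" and k: "lower_central G k = {\<one>}"
  shows "fg_central_series G (lower_central G) k"
proof -
  let ?L = "lower_central G"
  have mono: "i \<le> j \<Longrightarrow> ?L j \<subseteq> ?L i" for i j
    by (rule lift_Suc_antimono_le[of ?L]) (rule lower_central_decreasing)
  have triv: "?L i = {\<one>}" if "k \<le> i" for i
    using mono[OF that] k subgroup.one_closed[OF lower_central_subgroup[of i]] by auto
  have fg0: "\<exists>U. finite U \<and> generate G U = ?L (k - n)" for n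
  proof (induction n)
    case 0
    show ?case using generate_empty k by (intro exI[of _ "{}"]) simp
  next
    case (Suc n)
    show ?case
    proof (cases "n < k")
      case False
      then show ?thesis using Suc by simp
    next
      case True
      define i where "i = k - Suc n"
      have i: "Suc i = k - n" using True by (simp add: i_def)
      obtain U where U: "finite U" "U \<subseteq> ?L i" "?L i \<subseteq> generate G (U \<union> ?L (Suc i))"
        using lower_central_fg_mod_next[OF S] by blast
      obtain V where V: "finite V" "generate G V = ?L (Suc i)" using Suc i by auto
      have Vi: "V \<subseteq> ?L i" using generate.incl[of _ V G] V(2) lower_central_decreasing by blast
      have UV: "U \<union> V \<subseteq> ?L i" using U(2) Vi by blast
      have c: "U \<union> V \<subseteq> carrier G" using UV subgroup.subset[OF lower_central_subgroup] by blast
      have "U \<union> ?L (Suc i) \<subseteq> generate G (U \<union> V)"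
        using mono_generate[of V "U \<union> V"] V(2) by (auto intro: generate.incl)
      from generate_subgroup_incl[OF this generate_is_subgroup[OF c]]
      have "?L i \<subseteq> generate G (U \<union> V)" using U(3) by blast
      moreover have "generate G (U \<union> V) \<subseteq> ?L i"
        by (rule generate_subgroup_incl[OF UV lower_central_subgroup])
      ultimately show ?thesis using U(1) V(1) unfolding i_def[symmetric] by (intro exI[of _ "U \<union> V"]) auto
    qed
  qed
  have fg: "\<exists>U. finite U \<and> generate G U = ?L i" for i
  proof (cases "i < k")
    case True
    then show ?thesis using fg0[of "k - i"] by simp
  next
    case False
    then show ?thesis using fg0[of 0] triv[of i] k by simp
  qed
  show ?thesis
  proof (intro fg_central_series.intro is_group fg_central_series_axioms.intro)
    show "x \<otimes> y \<otimes> inv x \<otimes> inv y \<in> ?L (Suc i)" if "x \<in> ?L i" "y \<in> carrier G" for x y i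
      using lower_central_commutator[OF that] by (simp only: comm_def)
  qed (use k lower_central_subgroup lower_central_decreasing fg in auto)
qed

end

section \<open>Words over the generators\<close>

text \<open>
  Exchanges the codes \<open>2 * i\<close> and \<open>2 * i + 1\<close> of a generator and its
  inverse.
\<close>

definition flip_letter :: "nat \<Rightarrow> nat" where "flip_letter l = (if l mod 2 = 0 then Suc l else l - 1)"

lemma flip_letter_div: "flip_letter l div 2 = l div 2"
  unfolding flip_letter_def by (auto elim!: oddE simp: mod2_eq_if split: if_splits)

lemma flip_letter_even: "even (flip_letter l) \<longleftrightarrow> odd l"
  unfolding flip_letter_def by (auto simp: mod2_eq_if)

definition flip_word :: "nat list \<Rightarrow> nat list" where "flip_word w = rev (map flip_letter w)"

definition repeat_word :: "nat list \<Rightarrow> nat \<Rightarrow> nat list" where "repeat_word w e = concat (replicate e w)"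

definition subst_letter :: "nat list \<Rightarrow> nat \<Rightarrow> nat list"
  where "subst_letter zs l = (if l mod 2 = 0 then list_decode (nth0 zs (l div 2))
     else flip_word (list_decode (nth0 zs (l div 2))))"

text \<open>
  This applies an automorphism that is given by words, and it also enumerates the subgroup generated
  by a list of words.
\<close>

definition subst_word :: "nat list \<Rightarrow> nat list \<Rightarrow> nat list"
  where "subst_word zs w = concat (map (subst_letter zs) w)"

lemma computable_flip_letter: "computable f \<Longrightarrow> computable (\<lambda>x. flip_letter (f x))"
  unfolding flip_letter_def by (intro computable_If computable_basic computable_mod2)

lemma computable_flip_word: assumes "computable_list f" shows "computable_list (\<lambda>x. flip_word (f x))"
proof -
  have "foldl (\<lambda>acc l. flip_letter l # acc) acc w = flip_word w @ acc" for w acc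
    by (induction w arbitrary: acc) (auto simp: flip_word_def)
  moreover have "computable_list (\<lambda>x. foldl (\<lambda>acc l. flip_letter l # acc) [] (f x))"
    by (rule computable_list_foldl[OF _ computable_list_const assms])
      (intro computable_list_basic computable_basic computable_flip_letter)
  ultimately show ?thesis by simp
qed

lemma computable_repeat_word:
  assumes "computable_list f" "computable e" shows "computable_list (\<lambda>x. repeat_word (f x) (e x))"
proof -
  have "computable (\<lambda>x. rec_nat 0 (\<lambda>i acc. list_encode (f x @ list_decode acc)) (e x))"
    by (rule computable_rec_nat[OF computable_const _ assms(2)], unfold computable3_def,
       intro computable_list_encode computable_list_basic computable_basic computable_list_comp[OF assms(1)])
  moreover have "rec_nat 0 (\<lambda>i acc. list_encode (w @ list_decode acc)) n = list_encode (repeat_word w n)" for w n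
    by (induction n) (auto simp: repeat_word_def)
  ultimately show ?thesis by (simp add: computable_list_def)
qed

lemma computable_subst_word:
  assumes "computable_list zs" "computable_list f"
  shows "computable_list (\<lambda>x. subst_word (zs x) (f x))"
proof -
  have "foldl (\<lambda>acc l. acc @ subst_letter z l) acc w = acc @ subst_word z w" for w z acc
    by (induction w arbitrary: acc) (auto simp: subst_word_def)
  moreover have "computable_list (\<lambda>x. foldl (\<lambda>acc l. acc @ subst_letter (zs x) l) [] (f x))"
    by (rule computable_list_foldl[OF _ computable_list_const assms(2)], unfold subst_letter_def,
       intro computable_list_append computable_list_If computable_flip_word computable_list_decode
         computable_nth0 computable_list_comp[OF assms(1)] computable_mod2 computable_div2 computable_basic)
  ultimately show ?thesis by simp
qed

lemmas computable_words = computable_flip_word computable_repeat_word computable_subst_word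

context group
begin

text \<open>
  Codes beyond the generators have the value \<open>\<one>\<close>, so that every list of numbers is
  a word.
\<close>

definition letter_value :: "'a list \<Rightarrow> nat \<Rightarrow> 'a"
  where "letter_value gs l = (if l div 2 < length gs
     then (if even l then gs ! (l div 2) else inv (gs ! (l div 2))) else \<one>)"

definition wval :: "'a list \<Rightarrow> nat list \<Rightarrow> 'a"
  where "wval gs w = foldr (\<lambda>l a. letter_value gs l \<otimes> a) w \<one>"

lemma wval_Nil [simp]: "wval gs [] = \<one>"
  and wval_Cons: "wval gs (l # w) = letter_value gs l \<otimes> wval gs w"
  by (simp_all add: wval_def)

lemma nth_carrier: "\<lbrakk>set gs \<subseteq> carrier G; i < length gs\<rbrakk> \<Longrightarrow> gs ! i \<in> carrier G"
  using nth_mem[of i gs] by blast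

lemma letter_value_closed: "set gs \<subseteq> carrier G \<Longrightarrow> letter_value gs l \<in> carrier G"
  by (simp add: letter_value_def nth_carrier)

lemma letter_value_bad: assumes "2 * length gs \<le> l" shows "letter_value gs l = \<one>"
proof -
  have "\<not> l div 2 < length gs" using assms by linarith
  then show ?thesis by (simp add: letter_value_def)
qed

lemma wval_closed: "set gs \<subseteq> carrier G \<Longrightarrow> wval gs w \<in> carrier G"
  by (induction w) (auto simp: wval_Cons letter_value_closed)

lemma wval_append: "set gs \<subseteq> carrier G \<Longrightarrow> wval gs (u @ v) = wval gs u \<otimes> wval gs v"
  by (induction u) (auto simp: wval_Cons wval_closed letter_value_closed m_assoc)

lemma letter_value_flip: "set gs \<subseteq> carrier G \<Longrightarrow> letter_value gs (flip_letter l) = inv (letter_value gs l)"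
  by (simp add: letter_value_def flip_letter_div flip_letter_even nth_carrier)

lemma wval_flip_word: "set gs \<subseteq> carrier G \<Longrightarrow> wval gs (flip_word w) = inv (wval gs w)"
  by (induction w)
    (auto simp: flip_word_def wval_Cons wval_append wval_closed letter_value_closed letter_value_flip inv_mult_group)

lemma wval_repeat_word: "set gs \<subseteq> carrier G \<Longrightarrow> wval gs (repeat_word w e) = wval gs w [^] e"
proof (induction e)
  case (Suc e)
  then show ?case using nat_pow_Suc2[OF wval_closed[OF Suc.prems], of w e]
    by (simp add: repeat_word_def wval_append)
qed (simp add: repeat_word_def)

lemma wval_subst_letter:
  assumes "set gs \<subseteq> carrier G"
  shows "wval gs (subst_letter zs l) = letter_value (map (\<lambda>c. wval gs (list_decode c)) zs) l"
proof -
  have "flip_word [] = []" by (simp add: flip_word_def)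
  then show ?thesis using assms
    by (auto simp: subst_letter_def letter_value_def nth0_def wval_flip_word mod2_eq_if)
qed

lemma wval_subst_word:
  assumes "set gs \<subseteq> carrier G"
  shows "wval gs (subst_word zs w) = wval (map (\<lambda>c. wval gs (list_decode c)) zs) w"
  using assms by (induction w) (auto simp: subst_word_def wval_Cons wval_append wval_subst_letter)

lemma range_wval:
  assumes gs: "set gs \<subseteq> carrier G" shows "range (wval gs) = generate G (set gs)"
proof
  have "letter_value gs l \<in> generate G (set gs)" for l
    using nth_mem[of "l div 2" gs] by (auto simp: letter_value_def intro: generate.intros)
  then have "wval gs w \<in> generate G (set gs)" for w
    by (induction w) (auto simp: wval_Cons intro: generate.intros)
  then show "range (wval gs) \<subseteq> generate G (set gs)" by blast
  show "generate G (set gs) \<subseteq> range (wval gs)"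
  proof
    fix a assume "a \<in> generate G (set gs)"
    then show "a \<in> range (wval gs)"
    proof induction
      case one
      then show ?case using wval_Nil by (metis rangeI)
    next
      case (incl h)
      then obtain i where i: "i < length gs" "h = gs ! i" by (auto simp: in_set_conv_nth)
      then have "wval gs [2 * i] = h" using gs by (simp add: wval_Cons letter_value_def nth_carrier)
      then show ?case by (metis rangeI)
    next
      case (inv h)
      then obtain i where i: "i < length gs" "h = gs ! i" by (auto simp: in_set_conv_nth)
      then have "wval gs [2 * i + 1] = inv h" using gs by (simp add: wval_Cons letter_value_def nth_carrier)
      then show ?case by (metis rangeI)
    next
      case (eng h1 h2)
      then obtain u v where "h1 = wval gs u" "h2 = wval gs v" by blast
      then have "h1 \<otimes> h2 = wval gs (u @ v)" using gs by (simp add: wval_append)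
      then show ?case by blast
    qed
  qed
qed

lemma hom_wval:
  assumes \<phi>: "\<phi> \<in> hom G G" and gs: "set gs \<subseteq> carrier G"
  shows "\<phi> (wval gs w) = wval (map \<phi> gs) w"
proof -
  interpret \<phi>: group_hom G G \<phi> by (intro group_hom.intro group_hom_axioms.intro is_group \<phi>)
  have "\<phi> (letter_value gs l) = letter_value (map \<phi> gs) l" for l
    using gs by (simp add: letter_value_def nth_carrier)
  then show ?thesis using gs
    by (induction w) (auto simp: wval_Cons letter_value_closed wval_closed)
qed

lemma letter_value_code:
  "fst l < length gs \<Longrightarrow> letter_value gs (letter_code l) = (if snd l then gs ! fst l else inv (gs ! fst l))"
  by (auto simp: letter_value_def letter_code_def)

lemma wval_code:
  "w \<in> words_over (length gs) \<Longrightarrow> wval gs (map letter_code w) = word_value G gs w"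
  by (induction w) (auto simp: words_over_def wval_Cons letter_value_code)

end

text \<open>
  The lists of numbers form a presentation of the group if the codes without a generator may be
  deleted in addition.
\<close>

definition deletable :: "nat \<Rightarrow> nat list list \<Rightarrow> nat list \<Rightarrow> bool"
  where "deletable n R r \<longleftrightarrow> r \<in> set R \<or> (\<exists>l. r = [l, flip_letter l]) \<or> (\<exists>l. 2 * n \<le> l \<and> r = [l])"

definition delete_step :: "nat \<Rightarrow> nat list list \<Rightarrow> nat list \<Rightarrow> nat list \<Rightarrow> bool"
  where "delete_step n R a b \<longleftrightarrow> (\<exists>u v r. a = u @ r @ v \<and> b = u @ v \<and> deletable n R r)"

lemma rtranclp_map:
  assumes "\<And>a b. R a b \<Longrightarrow> S (f a) (f b)" "R\<^sup>*\<^sup>* a b" shows "S\<^sup>*\<^sup>* (f a) (f b)"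
  using assms(2) by induction (auto intro: assms(1) rtranclp.rtrancl_into_rtrancl)

lemma equivclp_map:
  assumes "\<And>a b. R a b \<Longrightarrow> S (f a) (f b)" "equivclp R a b" shows "equivclp S (f a) (f b)"
  using assms(2) unfolding equivclp_def
  by (rule rtranclp_map[rotated]) (auto simp: symclp_def assms(1))

lemma delete_bad_letters: "equivclp (delete_step n R) (u @ w) (u @ filter (\<lambda>l. l < 2 * n) w)"
proof (induction w arbitrary: u)
  case (Cons l w)
  show ?case
  proof (cases "l < 2 * n")
    case True
    then show ?thesis using Cons[of "u @ [l]"] by simp
  next
    case False
    then have "delete_step n R (u @ l # w) (u @ w)"
      unfolding delete_step_def deletable_def
      by (intro exI[of _ u] exI[of _ w] exI[of _ "[l]"]) auto
    then have "equivclp (delete_step n R) (u @ l # w) (u @ w)" by (rule r_into_equivclp)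
    then show ?thesis using Cons[of u] False by (auto intro: equivclp_trans)
  qed
qed simp

context group
begin

text \<open>
  Deletion preserves the value.  Conversely, both lists are reduced to words over the generators,
  for which the given presentation describes equality by the same deletions.
\<close>

lemma wval_eq_iff_equivclp:
  assumes fp: "finite_presentation G gens rels"
  shows "wval gens a = wval gens b \<longleftrightarrow>
    equivclp (delete_step (length gens) (map (map letter_code) rels)) a b"
proof -
  let ?n = "length gens" and ?R = "map (map letter_code) rels"
  have gc: "set gens \<subseteq> carrier G" and rw: "set rels \<subseteq> words_over ?n"
    and iso: "\<And>u v. \<lbrakk>u \<in> words_over ?n; v \<in> words_over ?n\<rbrakk> \<Longrightarrow>
      word_value G gens u = word_value G gens v \<longleftrightarrow> equivclp (cancel_or_relator ?n (set rels)) u v"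
    using fp unfolding finite_presentation_def by auto
  have nil: "[] \<in> words_over ?n" by (simp add: words_over_def)
  have rel1: "wval gens (map letter_code r) = \<one>" if r: "r \<in> set rels" for r
  proof -
    have "cancel_or_relator ?n (set rels) ([] @ r @ []) ([] @ [])"
      using r nil by (intro cancel_or_relator.relator)
    then have "word_value G gens r = word_value G gens []"
      using iso[of r "[]"] rw r nil by auto
    then show ?thesis using wval_code[of r gens] rw r by auto
  qed
  have del1: "wval gens r = \<one>" if "deletable ?n ?R r" for r
  proof -
    have "wval gens [l, flip_letter l] = \<one>" for l
      using gc by (simp add: wval_Cons letter_value_closed letter_value_flip)
    moreover have "wval gens [l] = \<one>" if "2 * ?n \<le> l" for l
      using that by (simp add: wval_Cons letter_value_bad)
    ultimately show ?thesis using that rel1 unfolding deletable_def by auto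
  qed
  have step: "wval gens a = wval gens b" if "delete_step ?n ?R a b" for a b
    using that gc del1 by (auto simp: delete_step_def wval_append wval_closed)
  show ?thesis
  proof
    assume "equivclp (delete_step ?n ?R) a b"
    then show "wval gens a = wval gens b"
      by (induction rule: equivclp_induct) (auto dest: step)
  next
    assume eq: "wval gens a = wval gens b"
    let ?f = "filter (\<lambda>l. l < 2 * ?n)"
    have ex: "\<exists>u\<in>words_over ?n. ?f w = map letter_code u" for w
    proof -
      define u where "u = map (\<lambda>l. (l div 2, even l)) (?f w)"
      have "u \<in> words_over ?n" by (auto simp: u_def words_over_def less_mult_imp_div_less mult.commute)
      moreover have "letter_code (l div 2, even l) = l" for l
        by (auto simp: letter_code_def elim!: oddE)
      then have "map letter_code u = ?f w" by (simp add: u_def comp_def)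
      ultimately show ?thesis by metis
    qed
    obtain u v where u: "u \<in> words_over ?n" "?f a = map letter_code u"
      and v: "v \<in> words_over ?n" "?f b = map letter_code v" using ex by meson
    have filt: "wval gens (?f w) = wval gens w" for w
      by (induction w) (use gc in \<open>auto simp: wval_Cons letter_value_bad wval_closed\<close>)
    have "word_value G gens u = word_value G gens v"
      using eq filt[of a] filt[of b] u v by (simp add: wval_code)
    then have uv: "equivclp (cancel_or_relator ?n (set rels)) u v" using iso u v by blast
    have flip: "letter_code (i, \<not> b) = flip_letter (letter_code (i, b))" for i b
      by (auto simp: letter_code_def flip_letter_def)
    have "equivclp (delete_step ?n ?R) (map letter_code u) (map letter_code v)"
    proof (rule equivclp_map[OF _ uv])
      fix a b assume "cancel_or_relator ?n (set rels) a b"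
      then show "delete_step ?n ?R (map letter_code a) (map letter_code b)"
      proof cases
        case (cancel u v i c)
        then show ?thesis unfolding delete_step_def deletable_def
          by (intro exI[of _ "map letter_code u"] exI[of _ "map letter_code v"]
              exI[of _ "[letter_code (i, c), letter_code (i, \<not> c)]"]) (auto simp: flip)
      next
        case (relator u v r)
        then show ?thesis unfolding delete_step_def deletable_def
          by (intro exI[of _ "map letter_code u"] exI[of _ "map letter_code v"]
              exI[of _ "map letter_code r"]) auto
      qed
    qed
    then have "equivclp (delete_step ?n ?R) (?f a) (?f b)" using u v by simp
    moreover have "equivclp (delete_step ?n ?R) a (?f a)" "equivclp (delete_step ?n ?R) b (?f b)"
      using delete_bad_letters[of ?n ?R "[]"] by simp_all
    ultimately show "equivclp (delete_step ?n ?R) a b"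
      by (meson equivclp_sym equivclp_trans)
  qed
qed

end

lemma sigma_deletable:
  assumes "computable_list f" shows "sigma (\<lambda>x. deletable n R (f x))"
proof -
  have "sigma (\<lambda>x. (\<exists>r\<in>set R. f x = r) \<or> (\<exists>l. f x = [l, flip_letter l]) \<or> (\<exists>l. \<not> l < 2 * n \<and> f x = [l]))"
  proof (intro sigma_disj sigma_ex_set)
    show "sigma (\<lambda>x. f x = r)" for r by (intro sigma_list_eq assms computable_list_const)
    show "sigma (\<lambda>x. \<exists>l. f x = [l, flip_letter l])"
      by (rule sigma_ex, intro sigma_list_eq computable_list_comp[OF assms] computable_list_basic
          computable_basic computable_flip_letter)
    have "sigma (\<lambda>x. \<exists>l. 2 * n < Suc l \<and> f x = [l])"
      by (rule sigma_ex, intro sigma_conj sigma_less sigma_list_eq computable_list_comp[OF assms]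
          computable_list_basic computable_basic)
    then show "sigma (\<lambda>x. \<exists>l. \<not> l < 2 * n \<and> f x = [l])" by (simp add: less_Suc_eq_le not_less)
  qed
  then show ?thesis unfolding deletable_def by (simp add: not_less eq_commute)
qed

lemma sigma_delete_step:
  assumes "computable_list f" "computable_list g"
  shows "sigma (\<lambda>x. delete_step n R (f x) (g x))"
  unfolding delete_step_def
  by (rule sigma_ex_list, rule sigma_ex_list, rule sigma_ex_list,
      intro sigma_conj sigma_list_eq sigma_deletable computable_list_comp[OF assms(1)]
        computable_list_comp[OF assms(2)] computable_list_basic computable_basic)

lemma sigma_equivclp_delete_step:
  assumes "computable_list f" "computable_list g"
  shows "sigma (\<lambda>x. equivclp (delete_step n R) (f x) (g x))"
proof -
  let ?S = "\<lambda>c d. symclp (delete_step n R) (list_decode c) (list_decode d)"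
  have "equivclp (delete_step n R) a b \<longleftrightarrow> ?S\<^sup>*\<^sup>* (list_encode a) (list_encode b)" for a b
    unfolding equivclp_def
  proof
    assume "(symclp (delete_step n R))\<^sup>*\<^sup>* a b"
    then show "?S\<^sup>*\<^sup>* (list_encode a) (list_encode b)" by (rule rtranclp_map[rotated]) simp
  next
    assume "?S\<^sup>*\<^sup>* (list_encode a) (list_encode b)"
    then have "(symclp (delete_step n R))\<^sup>*\<^sup>* (list_decode (list_encode a)) (list_decode (list_encode b))"
      by (rule rtranclp_map[rotated])
    then show "(symclp (delete_step n R))\<^sup>*\<^sup>* a b" by simp
  qed
  moreover have "sigma (\<lambda>x. ?S\<^sup>*\<^sup>* (list_encode (f x)) (list_encode (g x)))"
    by (rule sigma_rtranclp, unfold symclp_def,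
      intro sigma_disj sigma_delete_step computable_list_decode computable_basic,
      intro computable_list_encode assms, intro computable_list_encode assms)
  ultimately show ?thesis by simp
qed

lemma (in group) sigma_wval_eq:
  assumes "finite_presentation G gens rels" "computable_list f" "computable_list g"
  shows "sigma (\<lambda>x. wval gens (f x) = wval gens (g x))"
  unfolding wval_eq_iff_equivclp[OF assms(1)] by (rule sigma_equivclp_delete_step[OF assms(2,3)])

section \<open>Coloured coset tables\<close>

text \<open>
  The last letter acts first, as left multiplication requires, and codes beyond the generators act
  trivially.
\<close>

definition word_act :: "nat \<Rightarrow> (nat \<Rightarrow> nat \<Rightarrow> nat) \<Rightarrow> nat list \<Rightarrow> nat \<Rightarrow> nat"
  where "word_act n a w q = foldr (\<lambda>l q. if l < 2 * n then a l q else q) w q"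

text \<open>
  The points below \<open>M\<close> stand for the cosets of a normal subgroup, and \<open>b\<close>
  stands for the subgroup itself; \<open>a l\<close> is left multiplication by the letter
  \<open>l\<close>, and \<open>\<rho> i\<close> is right multiplication by the \<open>i\<close>-th
  generator.
\<close>

definition coset_table :: "nat \<Rightarrow> nat list list \<Rightarrow> (nat \<Rightarrow> nat \<Rightarrow> nat) \<Rightarrow> (nat \<Rightarrow> nat \<Rightarrow> nat) \<Rightarrow> nat \<Rightarrow> nat \<Rightarrow> bool"
  where "coset_table n R a \<rho> M b \<longleftrightarrow> b < M \<and>
    (\<forall>l<2 * n. \<forall>q<M. a l q < M \<and> a (flip_letter l) (a l q) = q) \<and>
    (\<forall>r\<in>set R. \<forall>q<M. word_act n a r q = q) \<and>
    (\<forall>i<n. \<rho> i b = a (2 * i) b \<and> (\<forall>q<M. \<rho> i q < M \<and> (\<forall>l<2 * n. a l (\<rho> i q) = \<rho> i (a l q))))"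

text \<open>
  The word \<open>W i\<close> denotes the image of the generator \<open>g\<close> number
  \<open>i\<close>, and \<open>\<phi> g \<otimes> x\<close> is twisted conjugate to
  \<open>x \<otimes> g\<close> by \<open>g\<close>.
\<close>

definition invariant_colouring ::
    "nat \<Rightarrow> (nat \<Rightarrow> nat \<Rightarrow> nat) \<Rightarrow> (nat \<Rightarrow> nat \<Rightarrow> nat) \<Rightarrow> nat \<Rightarrow> (nat \<Rightarrow> nat list) \<Rightarrow> (nat \<Rightarrow> nat) \<Rightarrow> bool"
  where "invariant_colouring n a \<rho> M W col \<longleftrightarrow>
    (\<forall>i<n. \<forall>q<M. col (word_act n a (W i) q) = col (\<rho> i q))"

lemma word_act_Nil [simp]: "word_act n a [] q = q"
  and word_act_Cons: "word_act n a (l # w) q = (if l < 2 * n then a l (word_act n a w q) else word_act n a w q)"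
  and word_act_append: "word_act n a (u @ v) q = word_act n a u (word_act n a v q)"
  by (simp_all add: word_act_def)

lemma flip_letter_flip [simp]: "flip_letter (flip_letter l) = l"
  unfolding flip_letter_def by (auto simp: mod2_eq_if odd_pos)

lemma flip_letter_less: "flip_letter l < 2 * n \<longleftrightarrow> l < 2 * n"
  unfolding flip_letter_def by (auto simp: mod2_eq_if elim!: evenE oddE)

context group
begin

text \<open>
  Since the relators act trivially, the colour \<open>c g\<close> of the point reached from
  \<open>b\<close> by a word for \<open>g\<close> is well defined.  The equation
  \<open>c (\<phi> x \<otimes> h) = c (h \<otimes> x)\<close> holds for generators \<open>x\<close>,
  because \<open>\<rho>\<close> commutes with the action, and passes to products and inverses.  So
  \<open>c\<close> is constant on classes.
\<close>

lemma classes_lower_bound: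
  assumes fp: "finite_presentation G gens rels" and \<phi>: "\<phi> \<in> hom G G"
    and W: "\<And>i. i < length gens \<Longrightarrow> wval gens (W i) = \<phi> (gens ! i)"
    and ct: "coset_table (length gens) (map (map letter_code) rels) a \<rho> M b"
    and ic: "invariant_colouring (length gens) a \<rho> M W col"
    and hit: "\<And>j. j < r \<Longrightarrow> \<exists>w. col (word_act (length gens) a w b) = j"
    and fin: "finite (carrier G // twisted_conj_rel G \<phi>)"
  shows "r \<le> card (carrier G // twisted_conj_rel G \<phi>)"
proof -
  interpret \<phi>: group_hom G G \<phi> by (intro group_hom.intro group_hom_axioms.intro is_group \<phi>)
  let ?n = "length gens" and ?R = "map (map letter_code) rels" and ?T = "twisted_conj_rel G \<phi>"
  have gc: "set gens \<subseteq> carrier G" and gen: "generate G (set gens) = carrier G"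
    using fp unfolding finite_presentation_def by auto
  note eqT = equiv_twisted_conj_rel[OF \<phi>]
  let ?act = "word_act ?n a"
  have b: "b < M" and inb: "\<And>l q. \<lbrakk>l < 2 * ?n; q < M\<rbrakk> \<Longrightarrow> a l q < M"
    and inv: "\<And>l q. \<lbrakk>l < 2 * ?n; q < M\<rbrakk> \<Longrightarrow> a (flip_letter l) (a l q) = q"
    and rel: "\<And>s q. \<lbrakk>s \<in> set ?R; q < M\<rbrakk> \<Longrightarrow> ?act s q = q"
    and \<rho>b: "\<And>i. i < ?n \<Longrightarrow> \<rho> i b = a (2 * i) b"
    and \<rho>: "\<And>i q. \<lbrakk>i < ?n; q < M\<rbrakk> \<Longrightarrow> \<rho> i q < M"
    and \<rho>a: "\<And>i q l. \<lbrakk>i < ?n; q < M; l < 2 * ?n\<rbrakk> \<Longrightarrow> a l (\<rho> i q) = \<rho> i (a l q)"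
    using ct unfolding coset_table_def by auto
  have act_less: "?act w q < M" if "q < M" for w q
    by (induction w) (use that inb in \<open>auto simp: word_act_Cons\<close>)
  have act_del: "?act s q = q" if "deletable ?n ?R s" "q < M" for s q
    using that(1) unfolding deletable_def
  proof (elim disjE exE conjE)
    fix l assume "s = [l, flip_letter l]"
    then show ?thesis using inv[of "flip_letter l" q] that(2) by (auto simp: word_act_Cons flip_letter_less)
  qed (use rel that(2) in \<open>auto simp: word_act_Cons\<close>)
  have act_step: "?act u q = ?act v q" if "delete_step ?n ?R u v" "q < M" for u v q
    using that act_del act_less unfolding delete_step_def by (auto simp: word_act_append)
  have act_eq: "?act u b = ?act v b" if "wval gens u = wval gens v" for u v
  proof -
    have "equivclp (delete_step ?n ?R) u v" using that wval_eq_iff_equivclp[OF fp] by simp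
    then show ?thesis by (induction rule: equivclp_induct) (use act_step b in \<open>auto\<close>)
  qed
  have act_\<rho>: "?act w (\<rho> i q) = \<rho> i (?act w q)" if "i < ?n" "q < M" for w i q
    by (induction w) (use that act_less \<rho>a in \<open>auto simp: word_act_Cons\<close>)
  have rng: "\<exists>w. wval gens w = g" if "g \<in> carrier G" for g
    using that range_wval[OF gc] gen by (metis imageE)
  define c where "c g = col (?act (SOME w. wval gens w = g) b)" for g
  have c: "c (wval gens w) = col (?act w b)" for w
  proof -
    have "wval gens (SOME w'. wval gens w' = wval gens w) = wval gens w" by (rule someI) simp
    then show ?thesis unfolding c_def using act_eq by metis
  qed
  have c_gen: "c (\<phi> (gens ! i) \<otimes> h) = c (h \<otimes> gens ! i)" if i: "i < ?n" and h: "h \<in> carrier G" for i h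
  proof -
    obtain w where w: "wval gens w = h" using rng h by blast
    have g: "wval gens [2 * i] = gens ! i" using i gc by (simp add: wval_Cons letter_value_def nth_carrier)
    have "c (\<phi> (gens ! i) \<otimes> h) = c (wval gens (W i @ w))" using W[OF i] w gc by (simp add: wval_append)
    also have "\<dots> = col (\<rho> i (?act w b))"
      using ic i act_less[OF b] unfolding c invariant_colouring_def by (simp add: word_act_append)
    also have "\<rho> i (?act w b) = ?act (w @ [2 * i]) b"
      using act_\<rho>[OF i b] \<rho>b[OF i] i by (simp add: word_act_append word_act_Cons)
    also have "col \<dots> = c (h \<otimes> gens ! i)" unfolding c[symmetric] using w g gc by (simp add: wval_append)
    finally show ?thesis .
  qed
  have c_all: "\<forall>h\<in>carrier G. c (\<phi> x \<otimes> h) = c (h \<otimes> x)" if "x \<in> generate G (set gens)" for x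
    using that
  proof induction
    case (incl x)
    then show ?case using c_gen by (auto simp: in_set_conv_nth)
  next
    case (inv x)
    then obtain i where i: "i < ?n" "x = gens ! i" by (auto simp: in_set_conv_nth)
    have xc: "x \<in> carrier G" using inv gc by blast
    show ?case
    proof
      fix h assume h: "h \<in> carrier G"
      have "c (\<phi> x \<otimes> (inv (\<phi> x) \<otimes> h \<otimes> inv x)) = c (inv (\<phi> x) \<otimes> h \<otimes> inv x \<otimes> x)"
        unfolding i(2) by (rule c_gen[OF i(1)]) (use h xc i in auto)
      then show "c (\<phi> (inv x) \<otimes> h) = c (h \<otimes> inv x)" using h xc by (simp add: group_norm)
    qed
  next
    case (eng x y)
    have xy: "x \<in> carrier G" "y \<in> carrier G" using eng gen by auto
    show ?case
    proof
      fix h assume h: "h \<in> carrier G"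
      have "c (\<phi> (x \<otimes> y) \<otimes> h) = c (\<phi> x \<otimes> (\<phi> y \<otimes> h))" using h xy by (simp add: m_assoc)
      also have "\<dots> = c (\<phi> y \<otimes> (h \<otimes> x))" using eng.IH(1) h xy by (simp add: m_assoc)
      also have "\<dots> = c (h \<otimes> (x \<otimes> y))" using eng.IH(2) h xy by (simp add: m_assoc)
      finally show "c (\<phi> (x \<otimes> y) \<otimes> h) = c (h \<otimes> (x \<otimes> y))" .
    qed
  qed simp
  have c_T: "c g = c f" if gf: "(g, f) \<in> ?T" for g f
  proof -
    obtain x where x: "g \<in> carrier G" "f \<in> carrier G" "x \<in> carrier G" "\<phi> x \<otimes> g = f \<otimes> x"
      using gf by (auto simp: twisted_conj_rel_def)
    have "c (\<phi> x \<otimes> (g \<otimes> inv x)) = c (g \<otimes> inv x \<otimes> x)" using c_all[of x] x gen by auto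
    moreover have "\<phi> x \<otimes> (g \<otimes> inv x) = f"
      using x by (simp add: m_assoc[symmetric]) (simp add: m_assoc)
    ultimately show ?thesis using x by (simp add: m_assoc)
  qed
  obtain w where w: "\<And>j. j < r \<Longrightarrow> col (?act (w j) b) = j" using hit by metis
  have "card {..<r} \<le> card (carrier G // ?T)"
  proof (rule card_inj_on_le[OF _ _ fin])
    show "(\<lambda>j. ?T `` {wval gens (w j)}) ` {..<r} \<subseteq> carrier G // ?T"
      using wval_closed[OF gc] by (auto intro: quotientI)
    show "inj_on (\<lambda>j. ?T `` {wval gens (w j)}) {..<r}"
    proof
      fix i j assume ij: "i \<in> {..<r}" "j \<in> {..<r}" "?T `` {wval gens (w i)} = ?T `` {wval gens (w j)}"
      then have "(wval gens (w i), wval gens (w j)) \<in> ?T"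
        using eq_equiv_class[OF ij(3) eqT] wval_closed[OF gc] by simp
      from c_T[OF this] show "i = j" using c w ij by simp
    qed
  qed
  then show ?thesis by simp
qed

end

definition table :: "nat list \<Rightarrow> nat \<Rightarrow> nat \<Rightarrow> nat"
  where "table p l q = nth0 (list_decode (nth0 p l)) q"

lemma ex_table: "\<exists>p. \<forall>l<L. \<forall>q<M. table p l q = f l q"
  by (rule exI[of _ "map (\<lambda>l. list_encode (map (f l) [0..<M])) [0..<L]"]) (simp add: table_def nth0_def)

lemma ex_nth0: "\<exists>p. \<forall>q<M. nth0 p q = f q"
  by (rule exI[of _ "map f [0..<M]"]) (simp add: nth0_def)

context group
begin

text \<open>
  The table is that of the quotient by \<open>K\<close>, and the colour of a coset is the number of
  the class that contains it.
\<close>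

lemma classes_lower_bound_attained:
  assumes fp: "finite_presentation G gens rels" and \<phi>: "\<phi> \<in> hom G G"
    and W: "\<And>i. i < length gens \<Longrightarrow> wval gens (W i) = \<phi> (gens ! i)"
    and K: "K \<lhd> G" "finite (rcosets K)" "\<And>g h. \<lbrakk>g \<in> carrier G; h \<in> K\<rbrakk> \<Longrightarrow> (h \<otimes> g, g) \<in> twisted_conj_rel G \<phi>"
    and fin: "finite (carrier G // twisted_conj_rel G \<phi>)"
  shows "\<exists>ta t\<rho> M b col. coset_table (length gens) (map (map letter_code) rels) (table ta) (table t\<rho>) M b \<and>
    invariant_colouring (length gens) (table ta) (table t\<rho>) M W (nth0 col) \<and>
    (\<forall>j<card (carrier G // twisted_conj_rel G \<phi>). \<exists>w. nth0 col (word_act (length gens) (table ta) w b) = j)"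
proof -
  interpret \<phi>: group_hom G G \<phi> by (intro group_hom.intro group_hom_axioms.intro is_group \<phi>)
  interpret K: normal K G by fact
  interpret P: group_hom G "G Mod K" "(#>) K"
    by (intro group_hom.intro group_hom_axioms.intro K.factorgroup_is_group K.r_coset_hom_Mod is_group)
  let ?n = "length gens" and ?R = "map (map letter_code) rels" and ?T = "twisted_conj_rel G \<phi>"
  let ?Q = "G Mod K"
  have gc: "set gens \<subseteq> carrier G" and gen: "generate G (set gens) = carrier G"
    using fp unfolding finite_presentation_def by auto
  note wc = wval_closed[OF gc]
  note eqT = equiv_twisted_conj_rel[OF \<phi>]
  define M where "M = card (carrier ?Q)"
  have Qfin: "finite (carrier ?Q)" using K(2) by (simp add: FactGroup_def)
  obtain h where h: "bij_betw h {..<M} (carrier ?Q)"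
    using ex_bij_betw_nat_finite[OF Qfin] unfolding M_def atLeast0LessThan by blast
  define g where "g = inv_into {..<M} h"
  have hq: "h q \<in> carrier ?Q" if "q < M" for q using h that by (auto dest: bij_betwE)
  have hg: "h (g y) = y" and gM: "g y < M" if "y \<in> carrier ?Q" for y
    using bij_betw_inv_into_right[OF h that] bij_betwE[OF bij_betw_inv_into[OF h]] that
    by (auto simp: g_def)
  have hinj: "q = q'" if "q < M" "q' < M" "h q = h q'" for q q'
    using h that by (auto simp: bij_betw_def dest: inj_onD)
  define b where "b = g \<one>\<^bsub>?Q\<^esub>"
  have b: "b < M" "h b = \<one>\<^bsub>?Q\<^esub>" by (simp_all add: b_def hg gM)
  obtain ta where ta: "\<And>l q. \<lbrakk>l < 2 * ?n; q < M\<rbrakk> \<Longrightarrow> table ta l q = g ((K #> letter_value gens l) \<otimes>\<^bsub>?Q\<^esub> h q)"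
    using ex_table[of "2 * ?n" M "\<lambda>l q. g ((K #> letter_value gens l) \<otimes>\<^bsub>?Q\<^esub> h q)"] by auto
  obtain t\<rho> where t\<rho>: "\<And>i q. \<lbrakk>i < ?n; q < M\<rbrakk> \<Longrightarrow> table t\<rho> i q = g (h q \<otimes>\<^bsub>?Q\<^esub> (K #> gens ! i))"
    using ex_table[of ?n M "\<lambda>i q. g (h q \<otimes>\<^bsub>?Q\<^esub> (K #> gens ! i))"] by auto
  have lc: "letter_value gens l \<in> carrier G" for l by (rule letter_value_closed[OF gc])
  have act: "table ta l q < M" "h (table ta l q) = (K #> letter_value gens l) \<otimes>\<^bsub>?Q\<^esub> h q"
    if "l < 2 * ?n" "q < M" for l q
    using ta[OF that] gM hg hq[OF that(2)] lc by simp_all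
  have gi: "gens ! i \<in> carrier G" if "i < ?n" for i using nth_carrier[OF gc that] .
  have \<rho>: "table t\<rho> i q < M" "h (table t\<rho> i q) = h q \<otimes>\<^bsub>?Q\<^esub> (K #> gens ! i)"
    if "i < ?n" "q < M" for i q
    using t\<rho>[OF that] gM hg hq[OF that(2)] gi[OF that(1)] by simp_all
  let ?act = "word_act ?n (table ta)"
  have wact: "?act w q < M \<and> h (?act w q) = (K #> wval gens w) \<otimes>\<^bsub>?Q\<^esub> h q" if q: "q < M" for w q
  proof (induction w)
    case Nil
    then show ?case using q hq by simp
  next
    case (Cons l w)
    then show ?case using act[of l "?act w q"] hq[OF q] lc wc
      by (cases "l < 2 * ?n") (auto simp: word_act_Cons wval_Cons letter_value_bad P.H.m_assoc)
  qed
  have triv: "?act w q = q" if "wval gens w = \<one>" "q < M" for w q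
    using wact[OF that(2), of w] that hq[OF that(2)] by (intro hinj) auto
  have "coset_table ?n ?R (table ta) (table t\<rho>) M b"
    unfolding coset_table_def
  proof (intro conjI allI ballI impI)
    fix l q assume lq: "l < 2 * ?n" "q < M"
    show "table ta l q < M" using act lq by blast
    have "?act [flip_letter l, l] q = q"
      using lq gc lc by (intro triv) (simp_all add: wval_Cons letter_value_flip)
    then show "table ta (flip_letter l) (table ta l q) = q"
      using lq by (simp add: word_act_Cons flip_letter_less)
  next
    fix s q assume s: "s \<in> set ?R" "q < M"
    have "delete_step ?n ?R s []" unfolding delete_step_def deletable_def
      using s(1) by (intro exI[of _ "[]"] exI[of _ s]) auto
    then have "wval gens s = wval gens []" unfolding wval_eq_iff_equivclp[OF fp] by (rule r_into_equivclp)
    then show "?act s q = q" using s(2) by (intro triv) auto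
  next
    fix i assume i: "i < ?n"
    have "letter_value gens (2 * i) = gens ! i" using i by (simp add: letter_value_def)
    then show "table t\<rho> i b = table ta (2 * i) b"
      using i b(1) act(1)[of "2 * i" b] act(2)[of "2 * i" b] \<rho>[OF i b(1)] gi[OF i] b(2) by (intro hinj) simp_all
    fix q assume q: "q < M"
    show "table t\<rho> i q < M" using \<rho> i q by blast
    fix l assume l: "l < 2 * ?n"
    show "table ta l (table t\<rho> i q) = table t\<rho> i (table ta l q)"
      using act[OF l \<rho>(1)[OF i q]] \<rho>[OF i act(1)[OF l q]] act[OF l q] \<rho>[OF i q] hq[OF q] lc gi[OF i]
      by (intro hinj) (simp_all add: P.H.m_assoc)
  qed (rule b(1))
  moreover
  define r where "r = card (carrier G // ?T)"
  obtain e where e: "bij_betw e {..<r} (carrier G // ?T)"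
    using ex_bij_betw_nat_finite[OF fin] unfolding r_def atLeast0LessThan by blast
  define idx where "idx = inv_into {..<r} e"
  obtain col where col: "\<And>q. q < M \<Longrightarrow> nth0 col q = idx (?T `` {SOME x. x \<in> carrier G \<and> K #> x = h q})"
    using ex_nth0[of M "\<lambda>q. idx (?T `` {SOME x. x \<in> carrier G \<and> K #> x = h q})"] by auto
  have colx: "nth0 col q = idx (?T `` {x})" if q: "q < M" and x: "x \<in> carrier G" "K #> x = h q" for q x
  proof -
    define y where "y = (SOME x. x \<in> carrier G \<and> K #> x = h q)"
    have y: "y \<in> carrier G \<and> K #> y = h q" unfolding y_def by (rule someI[of _ x]) (use x in simp)
    then have "y \<in> K #> x" using rcos_self[OF _ K.is_subgroup, of y] x by simp
    then obtain u where "u \<in> K" "y = u \<otimes> x" by (auto simp: r_coset_def)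
    then have "(y, x) \<in> ?T" using K(3)[OF x(1)] by blast
    from equiv_class_eq[OF eqT this] show ?thesis using col[OF q] unfolding y_def[symmetric] by simp
  qed
  have hx: "\<exists>x\<in>carrier G. K #> x = h q" if "q < M" for q
    using hq[OF that] by (auto simp: carrier_FactGroup)
  have "invariant_colouring ?n (table ta) (table t\<rho>) M W (nth0 col)"
    unfolding invariant_colouring_def
  proof (intro allI impI)
    fix i q assume i: "i < ?n" and q: "q < M"
    obtain x where x: "x \<in> carrier G" "K #> x = h q" using hx[OF q] by blast
    have "K #> (\<phi> (gens ! i) \<otimes> x) = h (?act (W i) q)"
      using wact[OF q, of "W i"] W[OF i] x gi[OF i] by simp
    then have 1: "nth0 col (?act (W i) q) = idx (?T `` {\<phi> (gens ! i) \<otimes> x})"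
      using wact[OF q, of "W i"] x gi[OF i] by (intro colx) auto
    have "K #> (x \<otimes> gens ! i) = h (table t\<rho> i q)"
      using \<rho>[OF i q] x gi[OF i] by simp
    then have 2: "nth0 col (table t\<rho> i q) = idx (?T `` {x \<otimes> gens ! i})"
      using \<rho>[OF i q] x gi[OF i] by (intro colx) auto
    have "(x \<otimes> gens ! i, \<phi> (gens ! i) \<otimes> x) \<in> ?T"
      by (rule twisted_conj_relI[of _ _ "gens ! i"]) (use x gi[OF i] in \<open>auto simp: m_assoc\<close>)
    from equiv_class_eq[OF eqT this] show "nth0 col (?act (W i) q) = nth0 col (table t\<rho> i q)"
      using 1 2 by simp
  qed
  moreover have "\<exists>w. nth0 col (?act w b) = j" if j: "j < r" for j
  proof -
    have "e j \<in> carrier G // ?T" using e j by (auto dest: bij_betwE)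
    then obtain x where x: "x \<in> carrier G" "e j = ?T `` {x}" by (auto simp: quotient_def)
    obtain w where w: "wval gens w = x" using x(1) range_wval[OF gc] gen by (metis imageE)
    have "nth0 col (?act w b) = idx (?T `` {x})"
      using wact[OF b(1), of w] w x(1) b(2) by (intro colx) auto
    also have "\<dots> = j" using bij_betw_inv_into_left[OF e, of j] j unfolding idx_def x(2)[symmetric] by simp
    finally show ?thesis by blast
  qed
  ultimately show ?thesis unfolding r_def by blast
qed

end

lemma computable_table:
  assumes "computable_list p" "computable l" "computable q"
  shows "computable (\<lambda>x. table (p x) (l x) (q x))"
  unfolding table_def by (intro computable_nth0 computable_list_decode assms)

lemma computable_word_act:
  assumes p: "computable_list p" and w: "computable_list w" and q: "computable q"
  shows "computable (\<lambda>x. word_act n (table (p x)) (w x) (q x))"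
proof -
  have "computable (\<lambda>x. foldl (\<lambda>acc l. if Suc l - 2 * n = 0 then table (p x) l acc else acc) (q x) (rev (w x)))"
    by (rule computable_foldl[OF _ q computable_list_rev[OF w]], unfold computable3_def,
       intro computable_If computable_table computable_list_comp[OF p] computable_basic)
  moreover have "(Suc l - 2 * n = 0) = (l < 2 * n)" for l by auto
  ultimately show ?thesis unfolding word_act_def by (simp add: foldr_conv_foldl del: diff_is_0_eq)
qed

lemma sigma_coset_table:
  assumes ta: "computable_list ta" and t: "computable_list t" and M: "computable M" and b: "computable b"
  shows "sigma (\<lambda>x. coset_table n R (table (ta x)) (table (t x)) (M x) (b x))"
  unfolding coset_table_def
  by (intro sigma_conj sigma_less sigma_eq sigma_all_less sigma_all_set computable_table computable_word_act
      computable_list_const computable_flip_letter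
      computable_list_comp[OF ta] computable_list_comp[OF t] computable_comp[OF M] computable_comp[OF b]
      computable_basic)

lemma sigma_invariant_colouring:
  assumes ta: "computable_list ta" and t: "computable_list t" and M: "computable M"
    and col: "computable_list col" and ws: "computable_list ws"
  shows "sigma (\<lambda>x. invariant_colouring n (table (ta x)) (table (t x)) (M x)
    (\<lambda>i. list_decode (nth0 (ws x) i)) (nth0 (col x)))"
  unfolding invariant_colouring_def
  by (intro sigma_eq sigma_all_less computable_nth0 computable_table computable_word_act
      computable_list_decode
      computable_list_comp[OF ta] computable_list_comp[OF t] computable_comp[OF M]
      computable_list_comp[OF col] computable_list_comp[OF ws]
      computable_basic)

section \<open>Certificates for the Reidemeister number\<close>

fun word_box :: "nat \<Rightarrow> nat list list \<Rightarrow> nat list set" where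
  "word_box m [] = {[]}"
| "word_box m (y # ys) = {repeat_word y e @ w | e w. e < m \<and> w \<in> word_box m ys}"

text \<open>
  Each exponent is a bounded quantifier; the prefix \<open>u\<close> of the word and the environment
  \<open>t\<close> vary in the induction.
\<close>

lemma sigma_ball_word_box:
  assumes P: "sigma (\<lambda>z. P (list_decode (pfst z)) (psnd z))"
    and u: "computable_list u" and m: "computable m" and t: "computable t"
  shows "sigma (\<lambda>x. \<forall>w\<in>word_box (m x) ys. P (u x @ w) (t x))"
  using u m t
proof (induction ys arbitrary: u m t)
  case Nil
  have "sigma (\<lambda>x. P (list_decode (pfst (pair (list_encode (u x)) (t x)))) (psnd (pair (list_encode (u x)) (t x))))"
    by (rule sigma_comp[OF P]) (intro computable_basic computable_list_encode Nil)
  then show ?case by simp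
next
  case (Cons y ys)
  have "(\<forall>w\<in>word_box (m x) (y # ys). P (u x @ w) (t x)) \<longleftrightarrow>
      (\<forall>e<m x. \<forall>w\<in>word_box (m x) ys. P ((u x @ repeat_word y e) @ w) (t x))" for x
    by (auto; metis append_assoc)
  moreover have "sigma (\<lambda>x. \<forall>e<m x. \<forall>w\<in>word_box (m x) ys. P ((u x @ repeat_word y e) @ w) (t x))"
    by (rule sigma_all_less[OF _ Cons.prems(2)], rule Cons.IH)
      (intro computable_list_append computable_repeat_word computable_list_const computable_basic
        computable_list_comp[OF Cons.prems(1)] computable_comp[OF Cons.prems(2)] computable_comp[OF Cons.prems(3)])+
  ultimately show ?case by simp
qed

context group
begin

lemma wval_word_box:
  assumes "set gs \<subseteq> carrier G"
  shows "wval gs ` word_box m ys = box m (map (wval gs) ys)"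
proof (induction ys)
  case (Cons y ys)
  have "word_box m (y # ys) = (\<lambda>(e, w). repeat_word y e @ w) ` ({..<m} \<times> word_box m ys)" by auto
  then have "wval gs ` word_box m (y # ys) =
      (\<lambda>(e, w). wval gs y [^] e \<otimes> wval gs w) ` ({..<m} \<times> word_box m ys)"
    by (simp add: image_image case_prod_unfold wval_append[OF assms] wval_repeat_word[OF assms])
  also have "\<dots> = (\<lambda>(e, v). wval gs y [^] e \<otimes> v) ` ({..<m} \<times> wval gs ` word_box m ys)" by force
  also have "\<dots> = box m (map (wval gs) (y # ys))" by (simp add: Cons box_Cons del: box.simps)
  finally show ?case .
qed simp

lemma wval_subst_word_encode:
  assumes "set gs \<subseteq> carrier G"
  shows "wval gs (subst_word (map list_encode zs) w) = wval (map (wval gs) zs) w"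
  by (simp add: wval_subst_word[OF assms] comp_def)

text \<open>
  Some \<open>b [^] Suc E \<otimes> h\<close>, with \<open>h\<close> in the subgroup generated by
  \<open>hs\<close>, has a displacement in the subgroup generated by \<open>zs\<close>.
\<close>

definition ker_cert :: "'a list \<Rightarrow> nat list \<Rightarrow> nat list list \<Rightarrow> nat list list \<Rightarrow> nat \<Rightarrow> bool"
  where "ker_cert gs b hs zs c \<longleftrightarrow> (\<exists>E t s. wval gs
    (subst_word (list_decode c) (repeat_word b (Suc E) @ subst_word (map list_encode hs) t) @
      flip_word (repeat_word b (Suc E) @ subst_word (map list_encode hs) t)) =
    wval gs (subst_word (map list_encode zs) s))"

text \<open>
  Modulo the subgroup generated by \<open>zs'\<close>, the \<open>m\<close>-th power of
  \<open>y\<close> is a displacement from the subgroup generated by \<open>zs\<close>.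
\<close>

definition coker_cert :: "'a list \<Rightarrow> nat list \<Rightarrow> nat list list \<Rightarrow> nat list list \<Rightarrow> nat \<Rightarrow> nat \<Rightarrow> bool"
  where "coker_cert gs y zs zs' m c \<longleftrightarrow> (\<exists>x z. wval gs (repeat_word y m) = wval gs
    (subst_word (list_decode c) (subst_word (map list_encode zs) x) @
      flip_word (subst_word (map list_encode zs) x) @ subst_word (map list_encode zs') z))"

text \<open>
  The values of \<open>w\<close> and of the \<open>j\<close>-th representative in \<open>fs\<close>
  are conjugate by the value of \<open>s\<close>.
\<close>

definition conj_cert :: "'a list \<Rightarrow> nat list \<Rightarrow> nat list \<Rightarrow> nat \<Rightarrow> nat \<Rightarrow> bool"
  where "conj_cert gs w fs r c \<longleftrightarrow> (\<exists>j s. j < r \<and>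
    wval gs (subst_word (list_decode c) s @ w) = wval gs (list_decode (nth0 fs j) @ s))"

definition colouring_cert :: "nat \<Rightarrow> nat list list \<Rightarrow> nat \<Rightarrow> nat \<Rightarrow> bool"
  where "colouring_cert n R r c \<longleftrightarrow> (\<exists>ta t\<rho> col M b. coset_table n R (table ta) (table t\<rho>) M b \<and>
    invariant_colouring n (table ta) (table t\<rho>) M (\<lambda>i. list_decode (nth0 (list_decode c) i)) (nth0 col) \<and>
    (\<forall>j<r. \<exists>w. nth0 col (word_act n (table ta) w b) = j))"

lemma sigma_ker_cert:
  assumes fp: "finite_presentation G gens rels" and c: "computable c"
  shows "sigma (\<lambda>x. ker_cert gens b hs zs (c x))"
  unfolding ker_cert_def
  by (rule sigma_ex, rule sigma_ex_list, rule sigma_ex_list, rule sigma_wval_eq[OF fp];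
      intro computable_words computable_list_basic computable_basic computable_comp[OF c])

lemma sigma_coker_cert:
  assumes fp: "finite_presentation G gens rels" and c: "computable c" and m: "computable m"
  shows "sigma (\<lambda>x. coker_cert gens y zs zs' (m x) (c x))"
  unfolding coker_cert_def
  by (rule sigma_ex_list, rule sigma_ex_list, rule sigma_wval_eq[OF fp];
      intro computable_words computable_list_basic computable_basic computable_comp[OF c] computable_comp[OF m])

lemma sigma_cover_cert:
  assumes fp: "finite_presentation G gens rels" and m: "computable m" and fs: "computable_list fs"
    and r: "computable r" and c: "computable c"
  shows "sigma (\<lambda>x. \<forall>w\<in>word_box (m x) ys. conj_cert gens w (fs x) (r x) (c x))"
proof -
  let ?P = "\<lambda>w y. conj_cert gens w (list_decode (pfst y)) (pfst (psnd y)) (psnd (psnd y))"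
  have "sigma (\<lambda>z. ?P (list_decode (pfst z)) (psnd z))"
    unfolding conj_cert_def
    by (rule sigma_ex, rule sigma_ex_list, intro sigma_conj sigma_less sigma_wval_eq[OF fp]
        computable_words computable_list_basic computable_basic computable_nth0)
  from sigma_ball_word_box[OF this computable_list_const[of "[]"] m, of "\<lambda>x. pair (list_encode (fs x)) (pair (r x) (c x))"]
  show ?thesis
    by (simp add: computable_pair computable_list_encode fs r c)
qed

lemma sigma_colouring_cert:
  assumes r: "computable r" and c: "computable c"
  shows "sigma (\<lambda>x. colouring_cert n R (r x) (c x))"
  unfolding colouring_cert_def
  by (rule sigma_ex_list, rule sigma_ex_list, rule sigma_ex_list, rule sigma_ex, rule sigma_ex,
      rule sigma_conj, rule sigma_coset_table, (intro computable_list_basic computable_basic)+,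
      rule sigma_conj, rule sigma_invariant_colouring,
      (intro computable_list_basic computable_basic computable_comp[OF c])+,
      rule sigma_all_less, rule sigma_ex_list, rule sigma_eq,
      (intro computable_nth0 computable_word_act computable_list_basic computable_basic computable_comp[OF r])+)

end

lemma (in group) classes_covered:
  assumes \<phi>: "\<phi> \<in> hom G G" and A: "finite A"
    and cov: "\<And>g. g \<in> carrier G \<Longrightarrow> \<exists>a\<in>A. (g, f a) \<in> twisted_conj_rel G \<phi>"
  shows "finite (carrier G // twisted_conj_rel G \<phi>)" "card (carrier G // twisted_conj_rel G \<phi>) \<le> card A"
proof -
  let ?T = "twisted_conj_rel G \<phi>"
  have "carrier G // ?T \<subseteq> (\<lambda>a. ?T `` {f a}) ` A"
  proof
    fix C assume "C \<in> carrier G // ?T"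
    then obtain g where g: "g \<in> carrier G" "C = ?T `` {g}" by (auto simp: quotient_def)
    obtain a where "a \<in> A" "(g, f a) \<in> ?T" using cov[OF g(1)] by blast
    then show "C \<in> (\<lambda>a. ?T `` {f a}) ` A"
      unfolding g(2) using equiv_class_eq[OF equiv_twisted_conj_rel[OF \<phi>]] by blast
  qed
  then show "finite (carrier G // ?T)" "card (carrier G // ?T) \<le> card A"
    using A by (auto intro: finite_subset surj_card_le)
qed

text \<open>
  The words in \<open>Z\<close> depend on the group only, so they may be constants of the algorithm.
\<close>

locale presented_series = fg_central_series +
  fixes gens :: "'a list" and rels :: "word list" and Z :: "nat \<Rightarrow> nat list list"
  assumes fp: "finite_presentation G gens rels"
    and Z: "generate G (set (map (wval gens) (Z i))) = \<gamma> i"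
begin

abbreviation val :: "nat list \<Rightarrow> 'a" where "val \<equiv> wval gens"
abbreviation Zv :: "nat \<Rightarrow> 'a list" where "Zv i \<equiv> map val (Z i)"

lemma gens_carrier: "set gens \<subseteq> carrier G" and generate_gens: "generate G (set gens) = carrier G"
  using fp unfolding finite_presentation_def by auto

lemma val_closed: "val w \<in> carrier G" by (rule wval_closed[OF gens_carrier])

lemma ex_val: "g \<in> carrier G \<Longrightarrow> \<exists>w. val w = g"
  using range_wval[OF gens_carrier] generate_gens by (metis imageE)

lemma range_subst: "range (\<lambda>w. val (subst_word (map list_encode zs) w)) = generate G (set (map val zs))"
  using range_wval[of "map val zs"] val_closed by (auto simp: wval_subst_word_encode[OF gens_carrier])

lemma subst_in: "val (subst_word (map list_encode zs) w) \<in> generate G (set (map val zs))"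
  using range_subst by blast

lemma ex_subst: "g \<in> generate G (set (map val zs)) \<Longrightarrow> \<exists>w. val (subst_word (map list_encode zs) w) = g"
  using range_subst[of zs] by (metis imageE)

text \<open>
  For which \<open>i\<close> and \<open>j\<close> the powers of the generator avoid the subgroup
  depends on the group only; the algorithm contains the list of these pairs and does not have to
  verify it.
\<close>

definition infinite_cert :: "nat \<Rightarrow> bool"
  where "infinite_cert c \<longleftrightarrow> (\<exists>i\<in>set [0..<k]. \<exists>j\<in>set [0..<length (Z i)].
    aperiodic_mod (Zv i ! j) (generate G (set (Zv (Suc i) @ take j (Zv i)))) \<and>
    ker_cert gens (Z i ! j) (Z (Suc i) @ take j (Z i)) (Z (Suc i)) c)"

definition finite_cert :: "nat \<Rightarrow> nat \<Rightarrow> bool"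
  where "finite_cert r c \<longleftrightarrow> (\<exists>m fs. 0 < m \<and>
    (\<forall>i\<in>set [0..<k]. \<forall>y\<in>set (Z i). coker_cert gens y (Z i) (Z (Suc i)) m c) \<and>
    (\<forall>w\<in>word_box m (concat (map Z [0..<k])). conj_cert gens w fs r c) \<and>
    colouring_cert (length gens) (map (map letter_code) rels) r c)"

definition output_cert :: "nat \<Rightarrow> nat \<Rightarrow> bool"
  where "output_cert v c \<longleftrightarrow> v = 0 \<and> infinite_cert c \<or> (\<exists>r. v = Suc r \<and> finite_cert r c)"

lemma sigma_output_cert: "sigma (\<lambda>z. output_cert (pfst z) (psnd z))"
proof -
  have "sigma (\<lambda>z. infinite_cert (psnd z))"
    unfolding infinite_cert_def
    by (intro sigma_ex_set sigma_conj sigma_const sigma_ker_cert[OF fp] computable_basic)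
  moreover have "sigma (\<lambda>z. \<exists>r. pfst z = Suc r \<and> finite_cert r (psnd z))"
    unfolding finite_cert_def
    by (rule sigma_ex, rule sigma_conj, rule sigma_eq, (intro computable_basic)+,
        rule sigma_ex, rule sigma_ex_list,
        intro sigma_conj sigma_less sigma_all_set sigma_coker_cert[OF fp] sigma_cover_cert[OF fp]
          sigma_colouring_cert computable_basic computable_list_decode)
  ultimately show ?thesis unfolding output_cert_def
    by (intro sigma_disj sigma_conj sigma_eq computable_basic)
qed

end

text \<open>The number \<open>c\<close> is the input of the algorithm.\<close>

locale presented_automorphism = presented_series + fg_central_series_surj +
  fixes c :: nat
  assumes images: "i < length gens \<Longrightarrow> wval gens (list_decode (nth0 (list_decode c) i)) = \<phi> (gens ! i)"
    and images_length: "length (list_decode c) = length gens"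
begin

lemma val_subst: "val (subst_word (list_decode c) w) = \<phi> (val w)"
proof -
  have "map (\<lambda>d. val (list_decode d)) (list_decode c) = map \<phi> gens"
    using images images_length by (intro nth_equalityI) (auto simp: nth0_def)
  then show ?thesis
    by (simp add: wval_subst_word[OF gens_carrier] hom_wval[OF endo gens_carrier])
qed

lemma val_displace: "val (subst_word (list_decode c) w @ flip_word w) = displace (val w)"
  by (simp add: wval_append[OF gens_carrier] wval_flip_word[OF gens_carrier] val_subst displace_def)

lemma val_displace': "val (subst_word (list_decode c) w @ flip_word w @ u) = displace (val w) \<otimes> val u"
  by (simp add: wval_append[OF gens_carrier] wval_flip_word[OF gens_carrier] val_subst displace_def val_closed m_assoc)

lemma finite_if_all_ker_torsion:
  assumes "\<And>i. i < k \<Longrightarrow> ker_torsion i"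
  shows "finite (carrier G // T)"
    and "\<exists>m>0. \<forall>i<k. \<forall>y\<in>set (Z i). coker_cert gens y (Z i) (Z (Suc i)) m c"
proof -
  have Zi: "set (Zv i) \<subseteq> \<gamma> i" for i using generate.incl[of _ "set (Zv i)" G] Z[of i] by blast
  obtain m where m: "m > 0" "\<forall>i<k. \<forall>y\<in>set (Zv i). y [^] (m::nat) \<in> displaced i"
    using common_exponent_if_coker_torsion[OF _ Zi] assms ker_torsion_iff_coker_torsion by blast
  show "finite (carrier G // T)"
    by (rule classes_covered(1)[OF endo finite_box, of m "concat (map Zv [0..<k])" "\<lambda>b. b"])
      (rule every_element_conj_to_box[OF Z m(1)], use m(2) in auto)
  have "coker_cert gens y (Z i) (Z (Suc i)) m c" if "i < k" "y \<in> set (Z i)" for i y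
  proof -
    have "val y [^] m \<in> displaced i" using m(2) that by auto
    then obtain x z where "val y [^] m = displace x \<otimes> z" "x \<in> \<gamma> i" "z \<in> \<gamma> (Suc i)"
      unfolding displaced_def by auto
    moreover from this obtain x' z' where "val (subst_word (map list_encode (Z i)) x') = x"
      "val (subst_word (map list_encode (Z (Suc i))) z') = z"
      using ex_subst Z by metis
    ultimately show ?thesis unfolding coker_cert_def val_displace'
      by (metis wval_repeat_word[OF gens_carrier])
  qed
  with m(1) show "\<exists>m>0. \<forall>i<k. \<forall>y\<in>set (Z i). coker_cert gens y (Z i) (Z (Suc i)) m c" by blast
qed

text \<open>
  A certificate exhibits a kernel that is not torsion.  Conversely, if all kernels are torsion there
  are finitely many classes; otherwise a suitable power of a kernel element of infinite order has
  the form that the certificate asks for.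
\<close>

lemma infinite_cert_iff: "infinite_cert c \<longleftrightarrow> infinite (carrier G // T)"
proof
  assume "infinite_cert c"
  then obtain i j where ij: "i < k" "j < length (Z i)"
    and ap: "aperiodic_mod (Zv i ! j) (generate G (set (Zv (Suc i) @ take j (Zv i))))"
    and kc: "ker_cert gens (Z i ! j) (Z (Suc i) @ take j (Z i)) (Z (Suc i)) c"
    unfolding infinite_cert_def by auto
  let ?hs = "Z (Suc i) @ take j (Z i)"
  let ?H = "generate G (set (map val ?hs))"
  have vhs: "map val ?hs = Zv (Suc i) @ take j (Zv i)" by (simp add: take_map)
  obtain E t s where eq: "val (subst_word (list_decode c) (repeat_word (Z i ! j) (Suc E) @ subst_word (map list_encode ?hs) t) @
      flip_word (repeat_word (Z i ! j) (Suc E) @ subst_word (map list_encode ?hs) t)) =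
    val (subst_word (map list_encode (Z (Suc i))) s)"
    using kc unfolding ker_cert_def by blast
  define h where "h = val (subst_word (map list_encode ?hs) t)"
  define a where "a = (Zv i ! j) [^] Suc E \<otimes> h"
  have a: "val (repeat_word (Z i ! j) (Suc E) @ subst_word (map list_encode ?hs) t) = a"
    using ij by (simp only: a_def h_def wval_append[OF gens_carrier] wval_repeat_word[OF gens_carrier] nth_map)
  have da: "displace a \<in> \<gamma> (Suc i)"
    using eq subst_in[of "Z (Suc i)" s] Z[of "Suc i"] unfolding val_displace a by simp
  have Zi: "set (Zv l) \<subseteq> \<gamma> l" for l using generate.incl[of _ "set (Zv l)" G] Z[of l] by blast
  have hsi: "set (map val ?hs) \<subseteq> \<gamma> i"
    using Zi[of "Suc i"] Zi[of i] term_Suc[of i] set_take_subset[of j "Zv i"] unfolding vhs by auto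
  have H: "subgroup ?H G" "\<gamma> (Suc i) \<subseteq> ?H" "?H \<subseteq> \<gamma> i"
    using generate_is_subgroup[OF subset_trans[OF hsi subgroup.subset[OF term_subgroup]]]
      generate_subgroup_incl[OF hsi term_subgroup]
      mono_generate[of "set (Zv (Suc i))" "set (map val ?hs)"] Z[of "Suc i"] by auto
  have b: "Zv i ! j \<in> \<gamma> i" using Zi[of i] ij by (auto simp: subset_eq)
  have h: "h \<in> ?H" unfolding h_def by (rule subst_in)
  have "aperiodic_mod a (\<gamma> (Suc i))"
    unfolding a_def by (rule aperiodic_mod_mult[OF H b _ h]) (use ap vhs in simp_all)
  moreover have "a \<in> \<gamma> i"
    unfolding a_def using term_pow[OF b, of "Suc E"] h H(3) by (intro subgroup.m_closed[OF term_subgroup]) auto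
  ultimately have "\<not> ker_torsion i" using da unfolding ker_torsion_def aperiodic_mod_def by blast
  then show "infinite (carrier G // T)" using ker_torsion_if_finitely_many_classes by blast
next
  assume "infinite (carrier G // T)"
  then obtain i where i: "i < k" "\<not> ker_torsion i" using finite_if_all_ker_torsion(1) by blast
  then obtain a where a: "a \<in> \<gamma> i" "displace a \<in> \<gamma> (Suc i)" "aperiodic_mod a (\<gamma> (Suc i))"
    unfolding ker_torsion_def aperiodic_mod_def by blast
  obtain j n E h where j: "j < length (Zv i)"
    and ap: "aperiodic_mod (Zv i ! j) (generate G (set (Zv (Suc i) @ take j (Zv i))))"
    and E: "E > 0" and h: "h \<in> generate G (set (Zv (Suc i) @ take j (Zv i)))"
    and an: "a [^] (n::int) = (Zv i ! j) [^] (E::nat) \<otimes> h"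
    using aperiodic_decomposition[OF Z Z a(1,3)] by blast
  let ?hs = "Z (Suc i) @ take j (Z i)"
  have vhs: "map val ?hs = Zv (Suc i) @ take j (Zv i)" by (simp add: take_map)
  obtain t where t: "val (subst_word (map list_encode ?hs) t) = h" using ex_subst[of h ?hs] h unfolding vhs by blast
  have ac: "a \<in> carrier G" using a(1) term_carrier by blast
  interpret Q: group_hom G "G Mod \<gamma> (Suc i)" "q (Suc i)" by (rule q_hom)
  have "q (Suc i) (\<phi> a) = q (Suc i) a" using a(2) ac by (subst q_eq_iff) (auto simp: displace_def)
  then have "q (Suc i) (\<phi> (a [^] n)) = q (Suc i) (a [^] n)"
    using ac by (simp add: \<phi>.hom_int_pow Q.hom_int_pow)
  then have da: "displace (a [^] n) \<in> \<gamma> (Suc i)"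
    using ac by (subst (asm) q_eq_iff) (auto simp: displace_def)
  obtain s where s: "val (subst_word (map list_encode (Z (Suc i))) s) = displace (a [^] n)"
    using ex_subst[of "displace (a [^] n)" "Z (Suc i)"] da Z[of "Suc i"] by auto
  have va: "val (repeat_word (Z i ! j) (Suc (E - 1)) @ subst_word (map list_encode ?hs) t) = a [^] n"
    using E j t an by (simp add: wval_append[OF gens_carrier] wval_repeat_word[OF gens_carrier] del: nat_pow_Suc)
  have "ker_cert gens (Z i ! j) ?hs (Z (Suc i)) c"
    unfolding ker_cert_def val_displace
    by (intro exI[of _ "E - 1"] exI[of _ t] exI[of _ s]) (simp only: va s)
  then show "infinite_cert c" unfolding infinite_cert_def using i(1) j ap
    by (intro bexI[of _ i] bexI[of _ j] conjI) simp_all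
qed

text \<open>
  The products in the box bound the number of classes from above, the coloured table from below.
\<close>

lemma finite_cert_iff: "finite_cert r c \<longleftrightarrow> finite (carrier G // T) \<and> card (carrier G // T) = r"
proof
  assume "finite_cert r c"
  then obtain m fs where m: "0 < m"
    and cok: "\<forall>i\<in>set [0..<k]. \<forall>y\<in>set (Z i). coker_cert gens y (Z i) (Z (Suc i)) m c"
    and cov: "\<forall>w\<in>word_box m (concat (map Z [0..<k])). conj_cert gens w fs r c"
    and col: "colouring_cert (length gens) (map (map letter_code) rels) r c"
    unfolding finite_cert_def by (elim exE conjE)
  have disp: "y [^] m \<in> displaced i" if y: "i < k" "y \<in> set (Zv i)" for i y
  proof -
    obtain y' where y': "y' \<in> set (Z i)" "y = val y'" using y by auto
    obtain x z where "val (repeat_word y' m) = displace (val (subst_word (map list_encode (Z i)) x)) \<otimes>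
        val (subst_word (map list_encode (Z (Suc i))) z)"
      using bspec[OF bspec[OF cok, of i] y'(1)] y(1) unfolding coker_cert_def val_displace' by auto
    then show ?thesis unfolding displaced_def y'(2)
      using subst_in[of "Z i" x] subst_in[of "Z (Suc i)" z] Z[of i] Z[of "Suc i"]
      by (auto simp: wval_repeat_word[OF gens_carrier])
  qed
  have "\<exists>j\<in>{..<r}. (g, val (list_decode (nth0 fs j))) \<in> T" if g: "g \<in> carrier G" for g
  proof -
    obtain b where b: "b \<in> box m (concat (map Zv [0..<k]))" "(g, b) \<in> T"
      using every_element_conj_to_box[OF Z m disp g] by blast
    have "concat (map Zv [0..<k]) = map val (concat (map Z [0..<k]))" by (simp add: map_concat comp_def)
    then obtain w where w: "w \<in> word_box m (concat (map Z [0..<k]))" "b = val w"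
      using b(1) wval_word_box[OF gens_carrier, of m "concat (map Z [0..<k])"] by auto
    obtain j s where j: "j < r" "val (subst_word (list_decode c) s @ w) = val (list_decode (nth0 fs j) @ s)"
      using bspec[OF cov w(1)] unfolding conj_cert_def by blast
    have "(b, val (list_decode (nth0 fs j))) \<in> T"
      by (rule twisted_conj_relI[of _ _ "val s"])
        (use j(2) val_closed w(2) in \<open>auto simp: wval_append[OF gens_carrier] val_subst\<close>)
    with b(2) j(1) T_trans show ?thesis by blast
  qed
  note cov = classes_covered[OF endo finite_lessThan this]
  have fin: "finite (carrier G // T)" by (rule cov(1))
  have "card (carrier G // T) \<le> r" using cov(2) by simp
  moreover have "r \<le> card (carrier G // T)"
  proof -
    obtain ta t\<rho> cl M b where "coset_table (length gens) (map (map letter_code) rels) (table ta) (table t\<rho>) M b"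
      "invariant_colouring (length gens) (table ta) (table t\<rho>) M (\<lambda>i. list_decode (nth0 (list_decode c) i)) (nth0 cl)"
      "\<forall>j<r. \<exists>w. nth0 cl (word_act (length gens) (table ta) w b) = j"
      using col unfolding colouring_cert_def by blast
    from classes_lower_bound[OF fp endo images this(1,2) _ fin] this(3) show ?thesis by blast
  qed
  ultimately show "finite (carrier G // T) \<and> card (carrier G // T) = r" using fin by simp
next
  assume "finite (carrier G // T) \<and> card (carrier G // T) = r"
  then have fin: "finite (carrier G // T)" and r: "card (carrier G // T) = r" by auto
  have ker: "ker_torsion i" for i by (rule ker_torsion_if_finitely_many_classes[OF fin])
  obtain m where m: "m > 0" "\<forall>i<k. \<forall>y\<in>set (Z i). coker_cert gens y (Z i) (Z (Suc i)) m c"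
    using finite_if_all_ker_torsion(2)[OF ker] by blast
  obtain e where e: "bij_betw e {..<r} (carrier G // T)"
    using ex_bij_betw_nat_finite[OF fin] r unfolding atLeast0LessThan by blast
  have "\<exists>w. e j = T `` {val w}" if "j < r" for j
  proof -
    have "e j \<in> carrier G // T" using bij_betwE[OF e] that by blast
    then obtain g where "g \<in> carrier G" "e j = T `` {g}" by (auto simp: quotient_def)
    then show ?thesis using ex_val by blast
  qed
  then obtain f where f: "\<And>j. j < r \<Longrightarrow> e j = T `` {val (f j)}" by metis
  define fs where "fs = map (\<lambda>j. list_encode (f j)) [0..<r]"
  have fs: "list_decode (nth0 fs j) = f j" if "j < r" for j using that by (simp add: fs_def nth0_def)
  have "conj_cert gens w fs r c" for w
  proof -
    have "T `` {val w} \<in> carrier G // T" using val_closed by (auto intro: quotientI)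
    then obtain j where j: "j < r" "e j = T `` {val w}"
      using bij_betw_imp_surj_on[OF e] by (metis imageE lessThan_iff)
    then have "(val w, val (f j)) \<in> T"
      using eq_equiv_class[OF _ equiv_T, of "val w" "val (f j)"] f[OF j(1)] val_closed by simp
    then obtain x where x: "x \<in> carrier G" "\<phi> x \<otimes> val w = val (f j) \<otimes> x"
      by (auto simp: twisted_conj_rel_def)
    obtain s where "val s = x" using ex_val[OF x(1)] by blast
    then show ?thesis unfolding conj_cert_def using j(1) x(2)
      by (intro exI[of _ j] exI[of _ s]) (simp add: wval_append[OF gens_carrier] val_subst fs)
  qed
  moreover have "colouring_cert (length gens) (map (map letter_code) rels) r c"
  proof -
    obtain K where K: "K \<lhd> G" "finite (rcosets K)" "\<forall>g\<in>carrier G. \<forall>h\<in>K. (h \<otimes> g, g) \<in> T"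
      using finite_index_normal_subgroup_within_classes[OF fin] by blast
    show ?thesis unfolding colouring_cert_def
      using classes_lower_bound_attained[OF fp endo images K(1,2) _ fin] K(3) unfolding r by blast
  qed
  ultimately show "finite_cert r c" unfolding finite_cert_def using m
    by (intro exI[of _ m] exI[of _ fs]) auto
qed

lemma output_cert_iff: "output_cert v c \<longleftrightarrow> v = enat_code (reidemeister_number G \<phi>)"
  unfolding output_cert_def infinite_cert_iff finite_cert_iff reidemeister_number_def enat_code_def Let_def
  by auto

end

lemma (in fg_central_series) ex_generating_words:
  assumes "finite_presentation G gens rels"
  shows "\<exists>Z. \<forall>i. generate G (set (map (wval gens) (Z i))) = \<gamma> i"
proof -
  have gc: "set gens \<subseteq> carrier G" and gen: "generate G (set gens) = carrier G"
    using assms unfolding finite_presentation_def by auto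
  have "\<exists>zs. generate G (set (map (wval gens) zs)) = \<gamma> i" for i
  proof -
    obtain S where S: "finite S" "generate G S = \<gamma> i" using term_fg by blast
    have "S \<subseteq> \<gamma> i" using generate.incl[of _ S G] S(2) by blast
    then have "S \<subseteq> range (wval gens)" using range_wval[OF gc] gen term_carrier by blast
    then obtain A where A: "finite A" "S = wval gens ` A"
      using finite_subset_image[OF S(1), of "wval gens" UNIV] by auto
    obtain zs where "set zs = A" using finite_list[OF A(1)] by blast
    then show ?thesis using S(2) A(2) by (intro exI[of _ zs]) simp
  qed
  then show ?thesis by metis
qed

theorem theorem1:
  fixes N :: "('a, 'b) monoid_scheme" and k :: nat
    and gens :: "'a list" and rels :: "word list"
  assumes "group N" and "nilpotent_of_class N k"
    and "finite_presentation N gens rels"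
  shows "\<exists>alg :: recf. \<forall>\<phi> \<in> auto N. \<forall>ws. given_by_words N gens \<phi> ws \<longrightarrow>
           recf_eval alg [words_code ws] (enat_code (reidemeister_number N \<phi>))"
proof -
  interpret N: group N by fact
  have gen: "generate N (set gens) = carrier N"
    using assms(3) unfolding finite_presentation_def by auto
  have lc: "lower_central N k = {\<one>\<^bsub>N\<^esub>}" using assms(2) unfolding nilpotent_of_class_def by blast
  interpret S: fg_central_series N "lower_central N" k
    by (rule N.lower_central_fg_central_series[OF _ gen lc]) simp
  obtain Z where Z: "\<And>i. generate N (set (map (N.wval gens) (Z i))) = lower_central N i"
    using S.ex_generating_words[OF assms(3)] by blast
  interpret P: presented_series N "lower_central N" k gens rels Z
    by unfold_locales (rule assms(3), rule Z)
  obtain alg where alg: "\<And>x v. \<lbrakk>P.output_cert v x; \<forall>v'. P.output_cert v' x \<longrightarrow> v' = v\<rbrakk> \<Longrightarrow> recf_eval alg [x] v"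
    using recf_of_sigma_graph[OF P.sigma_output_cert] by blast
  show ?thesis
  proof (intro exI[of _ alg] ballI allI impI)
    fix \<phi> ws assume \<phi>: "\<phi> \<in> auto N" and ws: "given_by_words N gens \<phi> ws"
    have hom: "\<phi> \<in> hom N N" and surj: "\<phi> ` carrier N = carrier N"
      using \<phi> by (auto simp: auto_def Bij_def bij_betw_def)
    let ?c = "words_code ws"
    have c: "list_decode ?c = map (\<lambda>w. list_encode (map letter_code w)) ws" by (simp add: words_code_def)
    have len: "length ws = length gens" and sub: "set ws \<subseteq> words_over (length gens)"
      and im: "\<And>i. i < length gens \<Longrightarrow> \<phi> (gens ! i) = word_value N gens (ws ! i)"
      using ws unfolding given_by_words_def by auto
    interpret A: presented_automorphism N "lower_central N" k gens rels Z \<phi> ?c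
    proof unfold_locales
      show "\<phi> \<in> hom N N" by (rule hom)
      show "\<phi> ` lower_central N i \<subseteq> lower_central N i" for i by (rule N.lower_central_hom_image[OF hom])
      show "\<phi> ` carrier N = carrier N" by (rule surj)
      show "length (list_decode ?c) = length gens" using c len by simp
      show "N.wval gens (list_decode (nth0 (list_decode ?c) i)) = \<phi> (gens ! i)" if "i < length gens" for i
      proof -
        have "ws ! i \<in> words_over (length gens)" using that len sub nth_mem[of i ws] by auto
        then show ?thesis using that len im[OF that] N.wval_code[of "ws ! i" gens] by (simp add: c nth0_def)
      qed
    qed
    show "recf_eval alg [?c] (enat_code (reidemeister_number N \<phi>))"
      by (rule alg) (simp_all add: A.output_cert_iff)
  qed
qed

end
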